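(* Consider Problem (SLQ) with the operators $\mathcal N\in\mathcal L(\mathcal U[0,T])$, $\mathcal H(\eta)\in\mathcal U[0,T]$ and the quantity $\mathcal M(\eta)\in\mathbb R$ defined in the context. Then: 1) If Problem (SLQ) is finite at some $\eta\in H$, then $\mathcal N\ge0$. 2) Problem (SLQ) is solvable at $\eta\in H$ if and only if $\mathcal N\ge0$ and there exists a control $\bar u(\cdot)\in\mathcal U[0,T]$ such that $$\mathcal N\bar u(\cdot)+\mathcal H(\eta)=0.$$ In this case, $\bar u(\cdot)$ is an optimal control. 3) If $\mathcal N\gg0$, then for any $\eta\in H$, $\mathcal J(\eta;\cdot)$ admits a unique minimizer $\bar u(\cdot)$ given by $\bar u(\cdot)=-\mathcal N^{-1}\mathcal H(\eta)$, and in this case $$\inf_{u(\cdot)\in\mathcal U[0,T]}\mathcal J(\eta;u(\cdot))=\mathcal J(\eta;\bar u(\cdot))=\frac12\Big(\mathcal M(\eta)-\langle\mathcal N^{-1}\mathcal H(\eta),\mathcal H(\eta)\rangle_{L^2_{\mathbb F}(0,T;U)}\Big).$$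
   Context: Let $T>0$ and $(\Omega,\mathcal F,\mathbf F,\mathbb P)$, $\mathbf F=\{\mathcal F_t\}_{t\in[0,T]}$, be a complete filtered probability space satisfying the usual condition and carrying a one-dimensional standard Brownian motion $W$. "Adapted" means progressively measurable. For a Banach space $X$, $L^p_{\mathcal F_T}(\Omega;X)$ ($1\le p\le\infty$) denotes $\mathcal F_T$-measurable $L^p$ random variables, $L^p_{\mathbb F}(0,T;X)$ denotes adapted $X$-valued processes that are $L^p$ on $(0,T)\times\Omega$ (essentially bounded if $p=\infty$). $H$ is a separable real Hilbert space, $U$ a real Hilbert space, $A$ generates a $C_0$-semigroup $S(\cdot)$ on $H$; $\mathbb S(\cdot)$ denotes the bounded self-adjoint operators. Let $A_1,C\in L^\infty_{\mathbb F}(0,T;\mathcal L(H))$, $B,D\in L^\infty_{\mathbb F}(0,T;\mathcal L(U;H))$, $M\in L^\infty_{\mathbb F}(0,T;\mathbb S(H))$, $R\in L^\infty_{\mathbb F}(0,T;\mathbb S(U))$, $G\in L^\infty_{\mathcal F_T}(\Omega;\mathbb S(H))$, and $\mathcal U[0,T]=L^2_{\mathbb F}(0,T;U)$. For $\eta\in H$, $u\in\mathcal U[0,T]$, let $X(\cdot)=X(\cdot;\eta,u)$ be the mild solution of $$dX=(AX+A_1X+Bu)\,dt+(CX+Du)\,dW(t)\ \text{in }(0,T],\quad X(0)=\eta,$$ i.e. $X(t)=S(t)\eta+\int_0^tS(t-s)(A_1X+Bu)ds+\int_0^tS(t-s)(CX+Du)dW(s)$. The cost is $$\mathcal J(\eta;u)=\frac12\mathbb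 E\Big[\int_0^T\big(\langle MX,X\rangle_H+\langle Ru,u\rangle_U\big)dt+\langle GX(T),X(T)\rangle_H\Big].$$ Problem (SLQ): for each $\eta\in H$ find $\bar u\in\mathcal U[0,T]$ with $\mathcal J(\eta;\bar u)=\inf_{u\in\mathcal U[0,T]}\mathcal J(\eta;u)$. It is finite at $\eta$ if this infimum is $>-\infty$, and solvable at $\eta$ if the infimum is attained; a minimizer is called an optimal control. Define bounded linear operators $\Xi:\mathcal U[0,T]\to L^2_{\mathbb F}(0,T;H)$, $\widehat\Xi:\mathcal U[0,T]\to L^2_{\mathcal F_T}(\Omega;H)$, $\Gamma:H\to L^2_{\mathbb F}(0,T;H)$, $\widehat\Gamma:H\to L^2_{\mathcal F_T}(\Omega;H)$ by $\Xi u=X(\cdot;0,u)$, $\widehat\Xi u=X(T;0,u)$, $\Gamma\eta=X(\cdot;\eta,0)$, $\widehat\Gamma\eta=X(T;\eta,0)$, and set (with $M,R,G$ acting as multiplication operators and $*$ denoting Hilbert space adjoints) $$\mathcal N=R+\Xi^*M\Xi+\widehat\Xi^*G\widehat\Xi,\quad \mathcal H(\eta)=\Xi^*M\Gamma\eta+\widehat\Xi^*G\widehat\Gamma\eta,$$ $$\mathcal M(\eta)=\langle M\Gamma\eta,\Gamma\eta\rangle_{L^2_{\mathbb F}(0,T;H)}+\langle G\widehat\Gamma\eta,\widehat\Gamma\eta\rangle_{L^2_{\mathcal F_T}(\Omega;H)}.$$ $\mathcal N\ge0$ means positive semidefinite; $\mathcal N\gg0$ means $\mathcal N\ge\delta I$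 for some $\delta>0$. *)

theory Defs
  imports "HOL-Probability.Probability"
begin

section \<open>Measurability and filtrations\<close>

text \<open>
  The control space is a Hilbert space that need not be separable, and spaces of bounded operators
  are usually not separable either.  Measurability of Banach-space-valued maps is therefore
  measurability in the sense of Bochner; for separable targets this is Borel measurability.
\<close>

definition strongly_measurable :: "'a measure \<Rightarrow> ('a \<Rightarrow> 'x::real_normed_vector) \<Rightarrow> bool" where
  "strongly_measurable N f \<longleftrightarrow>
     (\<exists>s. (\<forall>n::nat. simple_function N (s n)) \<and> (\<forall>x\<in>space N. (\<lambda>n. s n x) \<longlonglongrightarrow> f x))"

text \<open>Only the indices \<open>t \<in> {0..T}\<close> matter, and only the sigma-algebra of \<open>F t\<close>, not its measure.\<close>

definition usual_filtration :: "'w measure \<Rightarrow> (real \<Rightarrow> 'w measure) \<Rightarrow> real \<Rightarrow> bool" where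
  "usual_filtration P F T \<longleftrightarrow>
     (\<forall>t\<in>{0..T}. subalgebra P (F t)) \<and>
     (\<forall>s\<in>{0..T}. \<forall>t\<in>{0..T}. s \<le> t \<longrightarrow> sets (F s) \<subseteq> sets (F t)) \<and>
     null_sets P \<subseteq> sets (F 0) \<and>
     (\<forall>t\<in>{0..<T}. sets (F t) = (\<Inter>s\<in>{t<..T}. sets (F s)))"

definition brownian_motion ::
    "'w measure \<Rightarrow> (real \<Rightarrow> 'w measure) \<Rightarrow> real \<Rightarrow> (real \<Rightarrow> 'w \<Rightarrow> real) \<Rightarrow> bool" where
  "brownian_motion P F T W \<longleftrightarrow>
     (\<forall>t\<in>{0..T}. W t \<in> borel_measurable (F t)) \<and>
     (AE w in P. W 0 w = 0) \<and>
     (AE w in P. continuous_on {0..T} (\<lambda>t. W t w)) \<and>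
     (\<forall>s t. 0 \<le> s \<longrightarrow> s < t \<longrightarrow> t \<le> T \<longrightarrow>
        distributed P lborel (\<lambda>w. W t w - W s w) (normal_density 0 (sqrt (t - s))) \<and>
        prob_space.indep_set P (sets (F s))
          (sets (vimage_algebra (space P) (\<lambda>w. W t w - W s w) borel)))"

definition progressive ::
    "(real \<Rightarrow> 'w measure) \<Rightarrow> real \<Rightarrow> (real \<Rightarrow> 'w \<Rightarrow> 'x::real_normed_vector) \<Rightarrow> bool" where
  "progressive F T f \<longleftrightarrow>
     (\<forall>t\<in>{0..T}. strongly_measurable (restrict_space borel {0..t} \<Otimes>\<^sub>M F t) (\<lambda>(s, w). f s w))"


section \<open>Spaces of random variables and processes\<close>

text \<open>
  Elements of these spaces are represented by functions; equality in the space is almost-everywhere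
  equality with respect to the underlying measure.
\<close>

definition time_prob :: "'w measure \<Rightarrow> real \<Rightarrow> (real \<times> 'w) measure" where
  "time_prob P T = restrict_space lborel {0..T} \<Otimes>\<^sub>M P"

definition L2F :: "'w measure \<Rightarrow> (real \<Rightarrow> 'w measure) \<Rightarrow> real \<Rightarrow> (real \<Rightarrow> 'w \<Rightarrow> 'x::real_normed_vector) set" where
  "L2F P F T = {f. progressive F T f \<and> integrable (time_prob P T) (\<lambda>(t, w). (norm (f t w))\<^sup>2)}"

definition LinfF :: "'w measure \<Rightarrow> (real \<Rightarrow> 'w measure) \<Rightarrow> real \<Rightarrow> (real \<Rightarrow> 'w \<Rightarrow> 'x::real_normed_vector) set" where
  "LinfF P F T = {f. progressive F T f \<and> (\<exists>K. AE (t, w) in time_prob P T. norm (f t w) \<le> K)}"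

definition Linf_rv :: "'w measure \<Rightarrow> 'w measure \<Rightarrow> ('w \<Rightarrow> 'x::real_normed_vector) set" where
  "Linf_rv P E = {f. strongly_measurable E f \<and> (\<exists>K. AE w in P. norm (f w) \<le> K)}"

definition ip_proc :: "'w measure \<Rightarrow> real \<Rightarrow> (real \<Rightarrow> 'w \<Rightarrow> 'x::real_inner) \<Rightarrow> (real \<Rightarrow> 'w \<Rightarrow> 'x) \<Rightarrow> real" where
  "ip_proc P T f g = (LINT (t, w)|time_prob P T. f t w \<bullet> g t w)"

definition ip_rv :: "'w measure \<Rightarrow> ('w \<Rightarrow> 'x::real_inner) \<Rightarrow> ('w \<Rightarrow> 'x) \<Rightarrow> real" where
  "ip_rv P f g = (LINT w|P. f w \<bullet> g w)"

definition eq_proc :: "'w measure \<Rightarrow> real \<Rightarrow> (real \<Rightarrow> 'w \<Rightarrow> 'x) \<Rightarrow> (real \<Rightarrow> 'w \<Rightarrow> 'x) \<Rightarrow> bool" where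
  "eq_proc P T f g \<longleftrightarrow> (AE (t, w) in time_prob P T. f t w = g t w)"

definition selfadjoint :: "('x::real_inner \<Rightarrow>\<^sub>L 'x) \<Rightarrow> bool" where
  "selfadjoint a \<longleftrightarrow> (\<forall>x y. blinfun_apply a x \<bullet> y = x \<bullet> blinfun_apply a y)"


section \<open>Stochastic integral\<close>

text \<open>
  A list of triples \<open>(a, b, \<xi>)\<close> represents the elementary process given by the sum of the
  \<open>1\<^bsub>(a,b]\<^esub> \<xi>\<close>, where the intervals may overlap.
\<close>

definition elementary ::
    "(real \<Rightarrow> 'w measure) \<Rightarrow> real \<Rightarrow> (real \<times> real \<times> ('w \<Rightarrow> 'x::real_normed_vector)) list \<Rightarrow> bool" where
  "elementary F t ps \<longleftrightarrow>
     (\<forall>(a, b, \<xi>)\<in>set ps. 0 \<le> a \<and> a \<le> b \<and> b \<le> t \<and>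
        strongly_measurable (F a) \<xi> \<and> bounded (\<xi> ` space (F a)))"

definition elem_process ::
    "(real \<times> real \<times> ('w \<Rightarrow> 'x::real_normed_vector)) list \<Rightarrow> real \<Rightarrow> 'w \<Rightarrow> 'x" where
  "elem_process ps s w = (\<Sum>(a, b, \<xi>)\<leftarrow>ps. indicator {a<..b} s *\<^sub>R \<xi> w)"

definition elem_integral ::
    "(real \<Rightarrow> 'w \<Rightarrow> real) \<Rightarrow> (real \<times> real \<times> ('w \<Rightarrow> 'x::real_normed_vector)) list \<Rightarrow> 'w \<Rightarrow> 'x" where
  "elem_integral W ps w = (\<Sum>(a, b, \<xi>)\<leftarrow>ps. (W b w - W a w) *\<^sub>R \<xi> w)"

text \<open>
  \<open>I\<close> is a version of the Ito integral of \<open>f\<close> over \<open>(0, t]\<close>: the mean-square limit of the integrals of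
  elementary processes that converge to \<open>f\<close> in \<open>L\<^sup>2\<close>.  It is determined up to almost sure equality.
\<close>

definition has_ito_integral ::
    "'w measure \<Rightarrow> (real \<Rightarrow> 'w measure) \<Rightarrow> (real \<Rightarrow> 'w \<Rightarrow> real) \<Rightarrow> real \<Rightarrow>
     (real \<Rightarrow> 'w \<Rightarrow> 'x::real_normed_vector) \<Rightarrow> ('w \<Rightarrow> 'x) \<Rightarrow> bool" where
  "has_ito_integral P F W t f I \<longleftrightarrow>
     f \<in> L2F P F t \<and> strongly_measurable P I \<and> integrable P (\<lambda>w. (norm (I w))\<^sup>2) \<and>
     (\<exists>ps. (\<forall>n::nat. elementary F t (ps n)) \<and>
        (\<lambda>n. LINT (s, w)|time_prob P t. (norm (elem_process (ps n) s w - f s w))\<^sup>2) \<longlonglongrightarrow> 0 \<and>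
        (\<lambda>n. LINT w|P. (norm (elem_integral W (ps n) w - I w))\<^sup>2) \<longlonglongrightarrow> 0)"


section \<open>The state equation\<close>

definition C0_semigroup :: "(real \<Rightarrow> 'h::real_normed_vector \<Rightarrow>\<^sub>L 'h) \<Rightarrow> bool" where
  "C0_semigroup S \<longleftrightarrow>
     S 0 = id_blinfun \<and>
     (\<forall>s t. 0 \<le> s \<longrightarrow> 0 \<le> t \<longrightarrow> S (s + t) = S s o\<^sub>L S t) \<and>
     (\<forall>x. ((\<lambda>t. blinfun_apply (S t) x) \<longlongrightarrow> x) (at_right 0))"

text \<open>The unbounded operator \<open>A\<close> with domain \<open>domA\<close> is the infinitesimal generator of \<open>S\<close>.\<close>

definition is_generator ::
    "(real \<Rightarrow> 'h::real_normed_vector \<Rightarrow>\<^sub>L 'h) \<Rightarrow> 'h set \<Rightarrow> ('h \<Rightarrow> 'h) \<Rightarrow> bool" where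
  "is_generator S domA A \<longleftrightarrow>
     domA = {x. \<exists>y. ((\<lambda>t. (blinfun_apply (S t) x - x) /\<^sub>R t) \<longlongrightarrow> y) (at_right 0)} \<and>
     (\<forall>x\<in>domA. ((\<lambda>t. (blinfun_apply (S t) x - x) /\<^sub>R t) \<longlongrightarrow> A x) (at_right 0))"

definition mild_solution ::
    "'w measure \<Rightarrow> (real \<Rightarrow> 'w measure) \<Rightarrow> real \<Rightarrow> (real \<Rightarrow> 'w \<Rightarrow> real) \<Rightarrow>
     (real \<Rightarrow> 'h \<Rightarrow>\<^sub>L 'h) \<Rightarrow>
     (real \<Rightarrow> 'w \<Rightarrow> 'h \<Rightarrow>\<^sub>L 'h) \<Rightarrow> (real \<Rightarrow> 'w \<Rightarrow> 'u::real_inner \<Rightarrow>\<^sub>L 'h) \<Rightarrow>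
     (real \<Rightarrow> 'w \<Rightarrow> 'h \<Rightarrow>\<^sub>L 'h) \<Rightarrow> (real \<Rightarrow> 'w \<Rightarrow> 'u \<Rightarrow>\<^sub>L 'h) \<Rightarrow>
     'h \<Rightarrow> (real \<Rightarrow> 'w \<Rightarrow> 'u) \<Rightarrow>
     (real \<Rightarrow> 'w \<Rightarrow> 'h::{real_inner, banach, second_countable_topology}) \<Rightarrow> bool" where
  "mild_solution P F T W S A1 B C D \<eta> u X \<longleftrightarrow>
     X \<in> L2F P F T \<and>
     (\<forall>t\<in>{0..T}. \<exists>I.
        has_ito_integral P F W t
          (\<lambda>s w. blinfun_apply (S (t - s))
             (blinfun_apply (C s w) (X s w) + blinfun_apply (D s w) (u s w))) I \<and>
        (AE w in P. X t w =
           blinfun_apply (S t) \<eta> +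
           (LINT s:{0..t}|lborel. blinfun_apply (S (t - s))
              (blinfun_apply (A1 s w) (X s w) + blinfun_apply (B s w) (u s w))) +
           I w))"


section \<open>The control problem\<close>

definition cost ::
    "'w measure \<Rightarrow> real \<Rightarrow>
     (real \<Rightarrow> 'w \<Rightarrow> 'h \<Rightarrow>\<^sub>L 'h) \<Rightarrow> (real \<Rightarrow> 'w \<Rightarrow> 'u \<Rightarrow>\<^sub>L 'u) \<Rightarrow> ('w \<Rightarrow> 'h \<Rightarrow>\<^sub>L 'h) \<Rightarrow>
     ('h \<Rightarrow> (real \<Rightarrow> 'w \<Rightarrow> 'u) \<Rightarrow> real \<Rightarrow> 'w \<Rightarrow> 'h::real_inner) \<Rightarrow>
     'h \<Rightarrow> (real \<Rightarrow> 'w \<Rightarrow> 'u::real_inner) \<Rightarrow> real" where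
  "cost P T M R G X \<eta> u =
     1 / 2 * (LINT w|P.
       (LINT t:{0..T}|lborel.
          blinfun_apply (M t w) (X \<eta> u t w) \<bullet> X \<eta> u t w + blinfun_apply (R t w) (u t w) \<bullet> u t w) +
       blinfun_apply (G w) (X \<eta> u T w) \<bullet> X \<eta> u T w)"

definition cost_inf :: "'c set \<Rightarrow> ('c \<Rightarrow> real) \<Rightarrow> ereal" where
  "cost_inf V J = (INF u\<in>V. ereal (J u))"

definition finite_problem :: "'c set \<Rightarrow> ('c \<Rightarrow> real) \<Rightarrow> bool" where
  "finite_problem V J \<longleftrightarrow> cost_inf V J > - \<infinity>"

definition optimal :: "'c set \<Rightarrow> ('c \<Rightarrow> real) \<Rightarrow> 'c \<Rightarrow> bool" where
  "optimal V J u \<longleftrightarrow> u \<in> V \<and> ereal (J u) = cost_inf V J"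

definition solvable_problem :: "'c set \<Rightarrow> ('c \<Rightarrow> real) \<Rightarrow> bool" where
  "solvable_problem V J \<longleftrightarrow> (\<exists>u. optimal V J u)"


section \<open>The associated operators\<close>

text \<open>
  The Hilbert space adjoint at \<open>y\<close> of an operator \<open>L\<close> defined on a Hilbert space of functions \<open>V\<close>
  with inner product \<open>ipV\<close>, and with values in a space with inner product \<open>ipY\<close>.  The choice is
  between representatives of the same element of the space.
\<close>

definition hilbert_adjoint ::
    "'a set \<Rightarrow> ('a \<Rightarrow> 'a \<Rightarrow> real) \<Rightarrow> ('b \<Rightarrow> 'b \<Rightarrow> real) \<Rightarrow> ('a \<Rightarrow> 'b) \<Rightarrow> 'b \<Rightarrow> 'a" where
  "hilbert_adjoint V ipV ipY L y = (SOME v. v \<in> V \<and> (\<forall>u\<in>V. ipV u v = ipY (L u) y))"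

text \<open>In the next definitions \<open>X \<eta> u\<close> is the state belonging to the initial datum \<open>\<eta>\<close> and the control \<open>u\<close>.\<close>

definition Xi :: "('h::real_inner \<Rightarrow> (real \<Rightarrow> 'w \<Rightarrow> 'u::real_inner) \<Rightarrow> real \<Rightarrow> 'w \<Rightarrow> 'h) \<Rightarrow>
    (real \<Rightarrow> 'w \<Rightarrow> 'u) \<Rightarrow> real \<Rightarrow> 'w \<Rightarrow> 'h" where
  "Xi X u = X 0 u"

definition Xi_hat :: "real \<Rightarrow> ('h::real_inner \<Rightarrow> (real \<Rightarrow> 'w \<Rightarrow> 'u::real_inner) \<Rightarrow> real \<Rightarrow> 'w \<Rightarrow> 'h) \<Rightarrow>
    (real \<Rightarrow> 'w \<Rightarrow> 'u) \<Rightarrow> 'w \<Rightarrow> 'h" where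
  "Xi_hat T X u = X 0 u T"

definition Gam :: "('h::real_inner \<Rightarrow> (real \<Rightarrow> 'w \<Rightarrow> 'u::real_inner) \<Rightarrow> real \<Rightarrow> 'w \<Rightarrow> 'h) \<Rightarrow>
    'h \<Rightarrow> real \<Rightarrow> 'w \<Rightarrow> 'h" where
  "Gam X \<eta> = X \<eta> (\<lambda>t w. 0)"

definition Gam_hat :: "real \<Rightarrow> ('h::real_inner \<Rightarrow> (real \<Rightarrow> 'w \<Rightarrow> 'u::real_inner) \<Rightarrow> real \<Rightarrow> 'w \<Rightarrow> 'h) \<Rightarrow>
    'h \<Rightarrow> 'w \<Rightarrow> 'h" where
  "Gam_hat T X \<eta> = X \<eta> (\<lambda>t w. 0) T"

definition Xi_adj ::
    "'w measure \<Rightarrow> (real \<Rightarrow> 'w measure) \<Rightarrow> real \<Rightarrow>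
     ('h::real_inner \<Rightarrow> (real \<Rightarrow> 'w \<Rightarrow> 'u::real_inner) \<Rightarrow> real \<Rightarrow> 'w \<Rightarrow> 'h) \<Rightarrow>
     (real \<Rightarrow> 'w \<Rightarrow> 'h) \<Rightarrow> real \<Rightarrow> 'w \<Rightarrow> 'u" where
  "Xi_adj P F T X = hilbert_adjoint (L2F P F T) (ip_proc P T) (ip_proc P T) (Xi X)"

definition Xi_hat_adj ::
    "'w measure \<Rightarrow> (real \<Rightarrow> 'w measure) \<Rightarrow> real \<Rightarrow>
     ('h::real_inner \<Rightarrow> (real \<Rightarrow> 'w \<Rightarrow> 'u::real_inner) \<Rightarrow> real \<Rightarrow> 'w \<Rightarrow> 'h) \<Rightarrow>
     ('w \<Rightarrow> 'h) \<Rightarrow> real \<Rightarrow> 'w \<Rightarrow> 'u" where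
  "Xi_hat_adj P F T X = hilbert_adjoint (L2F P F T) (ip_proc P T) (ip_rv P) (Xi_hat T X)"

definition op_N ::
    "'w measure \<Rightarrow> (real \<Rightarrow> 'w measure) \<Rightarrow> real \<Rightarrow>
     (real \<Rightarrow> 'w \<Rightarrow> 'h \<Rightarrow>\<^sub>L 'h) \<Rightarrow> (real \<Rightarrow> 'w \<Rightarrow> 'u \<Rightarrow>\<^sub>L 'u) \<Rightarrow> ('w \<Rightarrow> 'h \<Rightarrow>\<^sub>L 'h) \<Rightarrow>
     ('h::real_inner \<Rightarrow> (real \<Rightarrow> 'w \<Rightarrow> 'u::real_inner) \<Rightarrow> real \<Rightarrow> 'w \<Rightarrow> 'h) \<Rightarrow>
     (real \<Rightarrow> 'w \<Rightarrow> 'u) \<Rightarrow> real \<Rightarrow> 'w \<Rightarrow> 'u" where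
  "op_N P F T M R G X u = (\<lambda>t w.
     blinfun_apply (R t w) (u t w) +
     Xi_adj P F T X (\<lambda>s v. blinfun_apply (M s v) (Xi X u s v)) t w +
     Xi_hat_adj P F T X (\<lambda>v. blinfun_apply (G v) (Xi_hat T X u v)) t w)"

definition vec_H ::
    "'w measure \<Rightarrow> (real \<Rightarrow> 'w measure) \<Rightarrow> real \<Rightarrow>
     (real \<Rightarrow> 'w \<Rightarrow> 'h \<Rightarrow>\<^sub>L 'h) \<Rightarrow> ('w \<Rightarrow> 'h \<Rightarrow>\<^sub>L 'h) \<Rightarrow>
     ('h::real_inner \<Rightarrow> (real \<Rightarrow> 'w \<Rightarrow> 'u::real_inner) \<Rightarrow> real \<Rightarrow> 'w \<Rightarrow> 'h) \<Rightarrow>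
     'h \<Rightarrow> real \<Rightarrow> 'w \<Rightarrow> 'u" where
  "vec_H P F T M G X \<eta> = (\<lambda>t w.
     Xi_adj P F T X (\<lambda>s v. blinfun_apply (M s v) (Gam X \<eta> s v)) t w +
     Xi_hat_adj P F T X (\<lambda>v. blinfun_apply (G v) (Gam_hat T X \<eta> v)) t w)"

definition quad_M ::
    "'w measure \<Rightarrow> real \<Rightarrow> (real \<Rightarrow> 'w \<Rightarrow> 'h \<Rightarrow>\<^sub>L 'h) \<Rightarrow> ('w \<Rightarrow> 'h \<Rightarrow>\<^sub>L 'h) \<Rightarrow>
     ('h::real_inner \<Rightarrow> (real \<Rightarrow> 'w \<Rightarrow> 'u::real_inner) \<Rightarrow> real \<Rightarrow> 'w \<Rightarrow> 'h) \<Rightarrow>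
     'h \<Rightarrow> real" where
  "quad_M P T M G X \<eta> =
     ip_proc P T (\<lambda>t w. blinfun_apply (M t w) (Gam X \<eta> t w)) (Gam X \<eta>) +
     ip_rv P (\<lambda>w. blinfun_apply (G w) (Gam_hat T X \<eta> w)) (Gam_hat T X \<eta>)"

definition pos_semidef :: "'a set \<Rightarrow> ('a \<Rightarrow> 'a \<Rightarrow> real) \<Rightarrow> ('a \<Rightarrow> 'a) \<Rightarrow> bool" where
  "pos_semidef V ip L \<longleftrightarrow> (\<forall>u\<in>V. 0 \<le> ip (L u) u)"

definition unif_pos :: "'a set \<Rightarrow> ('a \<Rightarrow> 'a \<Rightarrow> real) \<Rightarrow> ('a \<Rightarrow> 'a) \<Rightarrow> bool" where
  "unif_pos V ip L \<longleftrightarrow> (\<exists>\<delta>>0. \<forall>u\<in>V. \<delta> * ip u u \<le> ip (L u) u)"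

text \<open>The inverse of \<open>L\<close> on \<open>V\<close>, where \<open>eq\<close> is equality of the elements represented.\<close>

definition op_inverse :: "'a set \<Rightarrow> ('a \<Rightarrow> 'a \<Rightarrow> bool) \<Rightarrow> ('a \<Rightarrow> 'a) \<Rightarrow> 'a \<Rightarrow> 'a" where
  "op_inverse V eq L v = (SOME u. u \<in> V \<and> eq (L u) v)"

end

theory Submission
  imports Defs
begin

text \<open>
  By uniqueness of mild solutions the state is affine in the control up to null sets, so the cost is
  the quadratic functional \<open>u \<mapsto> (\<langle>\<N>u, u\<rangle> + 2\<langle>\<H>(\<eta>), u\<rangle> + \<M>(\<eta>)) / 2\<close>, and everything follows from the
  one-dimensional polynomials \<open>t \<mapsto> \<J>(\<eta>; u + tv)\<close>.  The analytic input is the a priori bound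
  \<open>E|X(t)|\<^sup>2 \<le> K(|\<eta>|\<^sup>2 + \<parallel>u\<parallel>\<^sup>2)\<close>, obtained from the isometry for elementary integrands and Gronwall's
  inequality: it gives uniqueness, and it bounds the functionals whose Riesz representatives are the
  adjoints.  Since the elements of the function spaces are representatives of classes, Riesz' theorem is proved
  for semidefinite forms on sets of functions, by minimising the quadratic functional of the form.
  The same theorem for the equivalent form \<open>\<langle>\<N>u, v\<rangle>\<close> inverts a uniformly positive \<open>\<N>\<close>.
\<close>

section \<open>Bochner measurability and square integrability\<close>

text \<open>The state map \<open>X\<close> is an arbitrary choice of one mild solution for each
  datum and control, so its linearity holds only up to null sets. The cost also contains the
  terminal state, a single time slice that almost everywhere equality on the product space does not
  see. Estimate and uniqueness are therefore proved for every fixed time as well as for the whole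
  process. Only boundedness of the maps from controls to states matters, never their norms. The
  state is estimated with integrals in the extended nonnegative reals, so that inequalities can be
  chained before finiteness is known. Gronwall's inequality nevertheless needs a finite bound in
  advance. It comes from the a priori inequality itself, because a mild solution belongs to
  \<open>L2F\<close> by definition.\<close>

lemma strongly_measurable_imp_borel_measurable:
  assumes "strongly_measurable N f"
  shows "f \<in> borel_measurable N"
proof -
  obtain s where s: "\<And>n. simple_function N (s n)" "\<And>x. x \<in> space N \<Longrightarrow> (\<lambda>n::nat. s n x) \<longlonglongrightarrow> f x"
    using assms unfolding strongly_measurable_def by auto
  show ?thesis
    by (rule borel_measurable_LIMSEQ_metric[OF borel_measurable_simple_function[OF s(1)] s(2)])
qed

text \<open>A pointwise limit of simple functions stays in the closure of the countable set of their
  values. Conversely, sending x to the nearest of the first n + 1 points of a sequence dense near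
  the range gives simple approximants.\<close>

lemma strongly_measurable_iff:
  fixes f :: "'a \<Rightarrow> 'x::real_normed_vector"
  shows "strongly_measurable N f \<longleftrightarrow>
    f \<in> borel_measurable N \<and> (\<exists>D. countable D \<and> f ` space N \<subseteq> closure D)"
proof (intro iffI conjI)
  assume sm: "strongly_measurable N f"
  then show "f \<in> borel_measurable N" by (rule strongly_measurable_imp_borel_measurable)
  obtain s where s: "\<And>n. simple_function N (s n)" "\<And>x. x \<in> space N \<Longrightarrow> (\<lambda>n::nat. s n x) \<longlonglongrightarrow> f x"
    using sm unfolding strongly_measurable_def by auto
  have "countable (\<Union>n. s n ` space N)"
    using simple_functionD(1)[OF s(1)] by (auto intro!: countable_UN intro: countable_finite)
  moreover have "f ` space N \<subseteq> closure (\<Union>n. s n ` space N)"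
  proof safe
    fix x assume x: "x \<in> space N"
    show "f x \<in> closure (\<Union>n. s n ` space N)"
      unfolding closure_sequential using s(2)[OF x] x by (intro exI[of _ "\<lambda>n. s n x"]) auto
  qed
  ultimately show "\<exists>D. countable D \<and> f ` space N \<subseteq> closure D" by blast
next
  assume "f \<in> borel_measurable N \<and> (\<exists>D. countable D \<and> f ` space N \<subseteq> closure D)"
  then obtain D where f[measurable]: "f \<in> borel_measurable N" and D: "countable D" "f ` space N \<subseteq> closure D"
    by blast
  show "strongly_measurable N f"
  proof (cases "space N = {}")
    case True
    then show ?thesis unfolding strongly_measurable_def by (intro exI[of _ "\<lambda>n x. 0"]) auto
  next
    case False
    then have "D \<noteq> {}" using D by auto
    define d where "d = from_nat_into D"
    have rd: "range d = D" unfolding d_def using \<open>D \<noteq> {}\<close> D(1) by (rule range_from_nat_into)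
    define good where "good n x i \<longleftrightarrow> i \<le> n \<and> (\<forall>j\<le>n. dist (f x) (d i) \<le> dist (f x) (d j))" for n x i
    \<comment> \<open>Ties between nearest points are broken by the least index, which keeps
      \<open>k n\<close> measurable.\<close>
    define k where "k n x = (LEAST i. good n x i)" for n x
    have ex: "\<exists>i. good n x i" for n x
    proof -
      obtain i where "i \<in> {..n}" "\<forall>j\<in>{..n}. dist (f x) (d i) \<le> dist (f x) (d j)"
        using ex_min_if_finite[of "(\<lambda>i. dist (f x) (d i)) ` {..n}"]
        by (force simp: not_less)
      then show ?thesis unfolding good_def by auto
    qed
    have kg: "good n x (k n x)" for n x unfolding k_def by (rule LeastI_ex[OF ex])
    have [measurable]: "(\<lambda>x. dist (f x) y) \<in> borel_measurable N" for y
      by (rule measurable_compose[OF f]) (intro borel_measurable_continuous_onI continuous_intros)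
    have [measurable]: "Measurable.pred N (\<lambda>x. good n x i)" for n i
      unfolding good_def by measurable
    have [measurable]: "k n \<in> measurable N (count_space UNIV)" for n
      unfolding k_def by measurable
    have "k n ` space N \<subseteq> {..n}" for n using kg unfolding good_def by auto
    then have "simple_function N (k n)" for n
      by (auto simp: simple_function_eq_measurable intro: finite_subset)
    then have "simple_function N (\<lambda>x. d (k n x))" for n by (rule simple_function_compose1)
    moreover have "(\<lambda>n. d (k n x)) \<longlonglongrightarrow> f x" if x: "x \<in> space N" for x
    proof (rule metric_LIMSEQ_I)
      fix e :: real assume "e > 0"
      have "f x \<in> closure D" using D x by auto
      then obtain y where "y \<in> D" "dist y (f x) < e" using \<open>e > 0\<close> unfolding closure_approachable by blast
      then obtain j where j: "dist (f x) (d j) < e" using rd by (metis dist_commute rangeE)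
      have "dist (d (k n x)) (f x) < e" if "n \<ge> j" for n
      proof -
        have "dist (f x) (d (k n x)) \<le> dist (f x) (d j)" using kg[of n x] that unfolding good_def by auto
        then show ?thesis using j by (simp add: dist_commute)
      qed
      then show "\<exists>n0. \<forall>n\<ge>n0. dist (d (k n x)) (f x) < e" by blast
    qed
    ultimately show ?thesis unfolding strongly_measurable_def by (intro exI[of _ "\<lambda>n x. d (k n x)"]) auto
  qed
qed

text \<open>The state space is second countable, so the arguments about the semigroup and the Ito
  integral may work with Borel measurability.\<close>

lemma strongly_measurable_iff_borel_measurable:
  fixes f :: "'a \<Rightarrow> 'x::{real_normed_vector, second_countable_topology}"
  shows "strongly_measurable N f \<longleftrightarrow> f \<in> borel_measurable N"
proof -
  obtain D :: "'x set" where D: "countable D" "\<And>X. open X \<Longrightarrow> X \<noteq> {} \<Longrightarrow> \<exists>d\<in>D. d \<in> X"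
    by (erule countable_dense_setE)
  have "x \<in> closure D" for x
    unfolding closure_approachable
  proof (intro allI impI)
    fix e :: real assume "e > 0"
    then show "\<exists>y\<in>D. dist y x < e" using D(2)[of "ball x e"] by (auto simp: dist_commute)
  qed
  then show ?thesis unfolding strongly_measurable_iff using D(1) by auto
qed

lemma strongly_measurable_compose:
  assumes "strongly_measurable N f" "g \<in> measurable M N"
  shows "strongly_measurable M (\<lambda>x. f (g x))"
  using assms measurable_space[OF assms(2)] unfolding strongly_measurable_iff
  by (fastforce intro: measurable_compose)

lemma strongly_measurable_const: "strongly_measurable N (\<lambda>x. c)"
  unfolding strongly_measurable_def by (intro exI[of _ "\<lambda>n x. c"]) auto

text \<open>The simple approximants are composed directly. Composing Borel maps instead would go
  through the product sigma-algebra, which can miss Borel sets of a product of nonseparable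
  spaces.\<close>

lemma strongly_measurable_continuous2:
  assumes f: "strongly_measurable N f" and g: "strongly_measurable N g"
    and h: "continuous_on UNIV (\<lambda>(x, y). h x y)"
  shows "strongly_measurable N (\<lambda>x. h (f x) (g x))"
proof -
  obtain s where s: "\<And>n. simple_function N (s n)" "\<And>x. x \<in> space N \<Longrightarrow> (\<lambda>n::nat. s n x) \<longlonglongrightarrow> f x"
    using f unfolding strongly_measurable_def by auto
  obtain r where r: "\<And>n. simple_function N (r n)" "\<And>x. x \<in> space N \<Longrightarrow> (\<lambda>n::nat. r n x) \<longlonglongrightarrow> g x"
    using g unfolding strongly_measurable_def by auto
  have "(\<lambda>n. h (s n x) (r n x)) \<longlonglongrightarrow> h (f x) (g x)" if "x \<in> space N" for x
    using continuous_on_tendsto_compose[OF h tendsto_Pair[OF s(2)[OF that] r(2)[OF that]]] by simp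
  then show ?thesis unfolding strongly_measurable_def
    using simple_function_compose2[OF s(1) r(1)] by (intro exI[of _ "\<lambda>n x. h (s n x) (r n x)"]) auto
qed

lemma strongly_measurable_add:
  "strongly_measurable N f \<Longrightarrow> strongly_measurable N g \<Longrightarrow> strongly_measurable N (\<lambda>x. f x + g x)"
  by (rule strongly_measurable_continuous2) (auto intro!: continuous_intros simp: split_beta)

lemma strongly_measurable_diff:
  "strongly_measurable N f \<Longrightarrow> strongly_measurable N g \<Longrightarrow> strongly_measurable N (\<lambda>x. f x - g x)"
  by (rule strongly_measurable_continuous2) (auto intro!: continuous_intros simp: split_beta)

lemma strongly_measurable_scaleR:
  "strongly_measurable N f \<Longrightarrow> strongly_measurable N g \<Longrightarrow> strongly_measurable N (\<lambda>x. f x *\<^sub>R g x)"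
  by (rule strongly_measurable_continuous2) (auto intro!: continuous_intros simp: split_beta)

lemma strongly_measurable_blinfun_apply:
  "strongly_measurable N f \<Longrightarrow> strongly_measurable N g \<Longrightarrow> strongly_measurable N (\<lambda>x. blinfun_apply (f x) (g x))"
  by (rule strongly_measurable_continuous2) (auto intro!: continuous_intros simp: split_beta)

lemma strongly_measurable_inner:
  "strongly_measurable N f \<Longrightarrow> strongly_measurable N g \<Longrightarrow> (\<lambda>x. f x \<bullet> g x) \<in> borel_measurable N"
  unfolding strongly_measurable_iff_borel_measurable[symmetric]
  by (rule strongly_measurable_continuous2) (auto intro!: continuous_intros simp: split_beta)

lemma strongly_measurable_norm:
  "strongly_measurable N f \<Longrightarrow> (\<lambda>x. norm (f x)) \<in> borel_measurable N"
  using strongly_measurable_imp_borel_measurable by measurable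

text \<open>This is the limit used for completeness of the process spaces. The value 0 on the
  divergence set defines it at every point, so no null set has to be modified and progressive
  measurability survives.\<close>

lemma strongly_measurable_lim:
  fixes u :: "nat \<Rightarrow> 'a \<Rightarrow> 'x::banach"
  assumes u: "\<And>n. strongly_measurable N (u n)"
  shows "strongly_measurable N (\<lambda>x. if convergent (\<lambda>n. u n x) then lim (\<lambda>n. u n x) else 0)"
proof -
  let ?C = "\<lambda>x. convergent (\<lambda>n. u n x)"
  have d[measurable]: "(\<lambda>x. dist (u m x) (u n x)) \<in> borel_measurable N" for m n
    unfolding dist_norm by (intro strongly_measurable_norm strongly_measurable_diff u)
  \<comment> \<open>In a complete space convergence is the Cauchy property, a countable condition on
    distances.\<close>
  have [measurable]: "Measurable.pred N ?C"
    unfolding Cauchy_convergent_iff[symmetric] metric_Cauchy_iff2 by measurable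
  \<comment> \<open>Multiplying by the indicator of the convergence set produces a sequence that
    converges everywhere.\<close>
  have v: "strongly_measurable N (\<lambda>x. (if ?C x then 1 else 0::real) *\<^sub>R u n x)" for n
    by (intro strongly_measurable_scaleR u) (simp add: strongly_measurable_iff_borel_measurable)
  have lim: "(\<lambda>n. (if ?C x then 1 else 0::real) *\<^sub>R u n x) \<longlonglongrightarrow> (if ?C x then lim (\<lambda>n. u n x) else 0)" for x
    by (auto simp: convergent_LIMSEQ_iff)
  have "\<exists>D. countable D \<and> (\<lambda>x. (if ?C x then 1 else 0::real) *\<^sub>R u n x) ` space N \<subseteq> closure D" for n
    using v unfolding strongly_measurable_iff by blast
  then obtain D where D: "\<And>n. countable (D n)"
    "\<And>n. (\<lambda>x. (if ?C x then 1 else 0::real) *\<^sub>R u n x) ` space N \<subseteq> closure (D n)"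
    by metis
  have "(if ?C x then lim (\<lambda>n. u n x) else 0) \<in> closure (\<Union>n. D n)" if "x \<in> space N" for x
  proof (rule closed_sequentially[OF closed_closure _ lim])
    fix n
    show "(if ?C x then 1 else 0::real) *\<^sub>R u n x \<in> closure (\<Union>n. D n)"
      using D(2)[of n] that closure_mono[of "D n" "\<Union>n. D n"] by blast
  qed
  then have "(\<lambda>x. if ?C x then lim (\<lambda>n. u n x) else 0) ` space N \<subseteq> closure (\<Union>n. D n)"
    by (rule image_subsetI)
  moreover have "countable (\<Union>n. D n)" using D(1) by blast
  moreover have "(\<lambda>x. if ?C x then lim (\<lambda>n. u n x) else 0) \<in> borel_measurable N"
    by (rule borel_measurable_LIMSEQ_metric[OF strongly_measurable_imp_borel_measurable[OF v] lim])
  ultimately show ?thesis unfolding strongly_measurable_iff by blast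
qed

section \<open>Square-integrable functions and their limits\<close>

definition sq_integrable :: "'a measure \<Rightarrow> ('a \<Rightarrow> 'x::real_normed_vector) \<Rightarrow> bool" where
  "sq_integrable N f \<longleftrightarrow> strongly_measurable N f \<and> integrable N (\<lambda>x. (norm (f x))\<^sup>2)"

lemma norm_add_sq_le: "(norm (x + y :: 'x::real_normed_vector))\<^sup>2 \<le> 2 * (norm x)\<^sup>2 + 2 * (norm y)\<^sup>2"
proof -
  have "(norm (x + y))\<^sup>2 \<le> (norm x + norm y)\<^sup>2" by (intro power_mono norm_triangle_ineq) auto
  also have "\<dots> \<le> 2 * (norm x)\<^sup>2 + 2 * (norm y)\<^sup>2" using sum_squares_bound[of "norm x" "norm y"]
    by (simp add: power2_sum)
  finally show ?thesis .
qed

lemma abs_inner_le_norm_sq: "\<bar>x \<bullet> y\<bar> \<le> (norm x)\<^sup>2 + (norm y)\<^sup>2"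
proof -
  have "0 \<le> norm x * norm y" by simp
  then show ?thesis using Cauchy_Schwarz_ineq2[of x y] sum_squares_bound[of "norm x" "norm y"] by linarith
qed

lemma sq_integrable_bound:
  assumes "sq_integrable N f" "strongly_measurable N g" "AE x in N. norm (g x) \<le> K * norm (f x)"
  shows "sq_integrable N g"
  unfolding sq_integrable_def
proof (intro conjI)
  show "integrable N (\<lambda>x. (norm (g x))\<^sup>2)"
  proof (rule Bochner_Integration.integrable_bound)
    show "integrable N (\<lambda>x. K\<^sup>2 * (norm (f x))\<^sup>2)" using assms by (simp add: sq_integrable_def)
    show "(\<lambda>x. (norm (g x))\<^sup>2) \<in> borel_measurable N"
      using strongly_measurable_norm[OF assms(2)] by measurable
    show "AE x in N. norm ((norm (g x))\<^sup>2) \<le> norm (K\<^sup>2 * (norm (f x))\<^sup>2)"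
      using assms(3) by (auto elim!: eventually_mono simp flip: power_mult_distrib intro: power_mono)
  qed
qed fact

lemma sq_integrable_scaleR:
  assumes "sq_integrable N f" shows "sq_integrable N (\<lambda>x. c *\<^sub>R f x)"
  by (rule sq_integrable_bound[OF assms, of _ "\<bar>c\<bar>"])
    (use assms in \<open>auto simp: sq_integrable_def intro!: strongly_measurable_scaleR strongly_measurable_const\<close>)

lemma sq_integrable_add:
  assumes f: "sq_integrable N f" and g: "sq_integrable N g"
  shows "sq_integrable N (\<lambda>x. f x + g x)"
  unfolding sq_integrable_def
proof (intro conjI)
  show sm: "strongly_measurable N (\<lambda>x. f x + g x)"
    using f g by (auto simp: sq_integrable_def intro: strongly_measurable_add)
  show "integrable N (\<lambda>x. (norm (f x + g x))\<^sup>2)"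
  proof (rule Bochner_Integration.integrable_bound)
    show "integrable N (\<lambda>x. 2 * (norm (f x))\<^sup>2 + 2 * (norm (g x))\<^sup>2)"
      using f g by (simp add: sq_integrable_def)
    show "(\<lambda>x. (norm (f x + g x))\<^sup>2) \<in> borel_measurable N"
      using strongly_measurable_norm[OF sm] by measurable
  qed (auto intro: norm_add_sq_le)
qed

lemma sq_integrable_lincomb:
  assumes "sq_integrable N f" "sq_integrable N g"
  shows "sq_integrable N (\<lambda>x. a *\<^sub>R f x + c *\<^sub>R g x)"
  by (intro sq_integrable_add sq_integrable_scaleR assms)

lemma sq_integrable_diff:
  assumes "sq_integrable N f" "sq_integrable N g"
  shows "sq_integrable N (\<lambda>x. f x - g x)"
  using sq_integrable_lincomb[OF assms, of 1 "-1"] by simp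

lemma sq_integrable_inner:
  assumes f: "sq_integrable N f" and g: "sq_integrable N g"
  shows "integrable N (\<lambda>x. f x \<bullet> g x)"
proof (rule Bochner_Integration.integrable_bound)
  show "integrable N (\<lambda>x. (norm (f x))\<^sup>2 + (norm (g x))\<^sup>2)"
    using f g by (simp add: sq_integrable_def)
  show "(\<lambda>x. f x \<bullet> g x) \<in> borel_measurable N"
    using f g by (auto simp: sq_integrable_def intro: strongly_measurable_inner)
  show "AE x in N. norm (f x \<bullet> g x) \<le> norm ((norm (f x))\<^sup>2 + (norm (g x))\<^sup>2)"
    by (intro AE_I2) (simp add: abs_inner_le_norm_sq)
qed

lemma sq_integrable_nn_integral:
  assumes "sq_integrable N f"
  shows "(\<integral>\<^sup>+x. ennreal ((norm (f x))\<^sup>2) \<partial>N) = ennreal (\<integral>x. (norm (f x))\<^sup>2 \<partial>N)"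
  using assms by (intro nn_integral_eq_integral) (auto simp: sq_integrable_def)

lemma sq_integrable_iff_nn_integral:
  "sq_integrable N f \<longleftrightarrow> strongly_measurable N f \<and> (\<integral>\<^sup>+x. ennreal ((norm (f x))\<^sup>2) \<partial>N) < \<infinity>"
  using strongly_measurable_norm[of N f]
  by (auto simp: sq_integrable_def integrable_iff_bounded)

text \<open>The core of the Riesz-Fischer theorem: the increments are absolutely summable almost
  everywhere, and the telescoping series is the sequence itself.\<close>

lemma sq_integrable_fast_Cauchy_convergent:
  fixes u :: "nat \<Rightarrow> 'a \<Rightarrow> 'x::banach"
  assumes u: "\<And>n. sq_integrable N (u n)"
    and c: "\<And>n m. n \<le> m \<Longrightarrow> (\<integral>x. (norm (u n x - u m x))\<^sup>2 \<partial>N) \<le> c * (1/4)^n"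
  shows "AE x in N. convergent (\<lambda>n. u n x)"
proof -
  have [measurable]: "(\<lambda>x. norm (u n x - u m x)) \<in> borel_measurable N" for n m
    using sq_integrable_diff[OF u u] by (auto simp: sq_integrable_def intro: strongly_measurable_norm)
  have "c \<ge> 0" using c[of 0 0] by simp
  \<comment> \<open>The weights \<open>2\<^sup>n\<close> leave the series integrable, and \<open>r \<le> 2\<^bsup>-n\<^esup> + 2\<^sup>n r\<^sup>2\<close> then controls the norms themselves.\<close>
  have "(\<integral>\<^sup>+x. (\<Sum>n. ennreal (2^n * (norm (u n x - u (Suc n) x))\<^sup>2)) \<partial>N) =
      (\<Sum>n. \<integral>\<^sup>+x. ennreal (2^n * (norm (u n x - u (Suc n) x))\<^sup>2) \<partial>N)"
    by (rule nn_integral_suminf) measurable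
  also have "\<dots> \<le> (\<Sum>n. ennreal (c * (1/2)^n))"
  proof (intro suminf_le allI)
    fix n
    have "(\<integral>\<^sup>+x. ennreal (2^n * (norm (u n x - u (Suc n) x))\<^sup>2) \<partial>N)
       = ennreal (2^n * (\<integral>x. (norm (u n x - u (Suc n) x))\<^sup>2 \<partial>N))"
      using sq_integrable_diff[OF u u] unfolding sq_integrable_def
      by (subst nn_integral_eq_integral) auto
    also have "\<dots> \<le> ennreal (2^n * (c * (1/4)^n))"
      by (intro ennreal_leI mult_left_mono c) auto
    also have "(2::real)^n * (c * (1/4)^n) = c * (1/2)^n"
      by (simp add: power_divide power_mult_distrib[symmetric] flip: power_mult)
        (simp add: field_simps flip: power_mult_distrib)
    finally show "(\<integral>\<^sup>+x. ennreal (2^n * (norm (u n x - u (Suc n) x))\<^sup>2) \<partial>N) \<le> ennreal (c * (1/2)^n)" .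
  qed auto
  also have "\<dots> = ennreal (\<Sum>n. c * (1/2)^n)"
    using \<open>c \<ge> 0\<close> by (intro suminf_ennreal2 summable_mult summable_geometric) auto
  also have "\<dots> < \<infinity>" by simp
  finally have "AE x in N. (\<Sum>n. ennreal (2^n * (norm (u n x - u (Suc n) x))\<^sup>2)) \<noteq> \<infinity>"
    by (intro nn_integral_PInf_AE) auto
  then show ?thesis
  proof eventually_elim
    case (elim x)
    have s: "summable (\<lambda>n. (1/2)^n + 2^n * (norm (u n x - u (Suc n) x))\<^sup>2)"
      using elim by (intro summable_add summable_geometric summable_suminf_not_top) auto
    have "summable (\<lambda>n. norm (u (Suc n) x - u n x))"
    proof (rule summable_comparison_test'[OF s])
      fix n :: nat
      have am: "r \<le> inverse p + p * r\<^sup>2" if "p > 0" "r \<ge> 0" for p r :: real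
      proof -
        have "2 * (p * r) \<le> 1 + (p * r)\<^sup>2" using sum_squares_bound[of 1 "p * r"] by simp
        moreover have "0 \<le> p * r" using that by simp
        ultimately have "p * r \<le> 1 + (p * r)\<^sup>2" by linarith
        moreover have "p * (inverse p + p * r\<^sup>2) = 1 + (p * r)\<^sup>2"
          using that by (simp add: distrib_left power2_eq_square)
        ultimately have "p * r \<le> p * (inverse p + p * r\<^sup>2)" by linarith
        then show ?thesis using mult_le_cancel_left_pos[OF \<open>p > 0\<close>] by blast
      qed
      show "norm (norm (u (Suc n) x - u n x)) \<le> (1/2)^n + 2^n * (norm (u n x - u (Suc n) x))\<^sup>2"
        using am[of "2^n" "norm (u n x - u (Suc n) x)"]
        by (simp add: norm_minus_commute power_one_over inverse_eq_divide)
    qed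
    then have "summable (\<lambda>n. u (Suc n) x - u n x)" by (rule summable_norm_cancel)
    then have "convergent (\<lambda>n. \<Sum>i<n. u (Suc i) x - u i x)" by (simp add: summable_iff_convergent)
    then have "convergent (\<lambda>n. u n x - u 0 x)" by (simp add: sum_lessThan_telescope[of "\<lambda>n. u n x"])
    then show ?case using convergent_add[OF _ convergent_const[of "u 0 x"]] by fastforce
  qed
qed

text \<open>For fixed n, Fatou's lemma in m carries the rate over to the limit. Then
  \<open>l\<close> is square integrable because it is the difference of \<open>u 0\<close> and
  \<open>u 0 - l\<close>.\<close>

lemma sq_integrable_Fatou:
  fixes u :: "nat \<Rightarrow> 'a \<Rightarrow> 'x::banach"
  assumes u: "\<And>n. sq_integrable N (u n)"
    and c: "\<And>n m. n \<le> m \<Longrightarrow> (\<integral>x. (norm (u n x - u m x))\<^sup>2 \<partial>N) \<le> c * (1/4)^n"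
    and l: "strongly_measurable N l" "AE x in N. (\<lambda>n. u n x) \<longlonglongrightarrow> l x"
  shows "sq_integrable N l" "(\<integral>x. (norm (u n x - l x))\<^sup>2 \<partial>N) \<le> c * (1/4)^n"
proof -
  have [measurable]: "(\<lambda>x. norm (u n x - u m x)) \<in> borel_measurable N" for n m
    using sq_integrable_diff[OF u u] by (auto simp: sq_integrable_def intro: strongly_measurable_norm)
  have "c \<ge> 0" using c[of 0 0] by simp
  have sd: "strongly_measurable N (\<lambda>x. u n x - l x)" for n
    using u by (intro strongly_measurable_diff l) (auto simp: sq_integrable_def)
  have bd: "(\<integral>\<^sup>+x. ennreal ((norm (u n x - l x))\<^sup>2) \<partial>N) \<le> ennreal (c * (1/4)^n)" for n
  proof -
    have "(\<integral>\<^sup>+x. ennreal ((norm (u n x - l x))\<^sup>2) \<partial>N) =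
        (\<integral>\<^sup>+x. liminf (\<lambda>m. ennreal ((norm (u n x - u m x))\<^sup>2)) \<partial>N)"
    proof (rule nn_integral_cong_AE, use l(2) in eventually_elim)
      case (elim x)
      then have "(\<lambda>m. ennreal ((norm (u n x - u m x))\<^sup>2)) \<longlonglongrightarrow> ennreal ((norm (u n x - l x))\<^sup>2)"
        by (intro tendsto_intros)
      then show ?case by (intro lim_imp_Liminf[symmetric]) simp_all
    qed
    also have "\<dots> \<le> liminf (\<lambda>m. \<integral>\<^sup>+x. ennreal ((norm (u n x - u m x))\<^sup>2) \<partial>N)"
      by (rule nn_integral_liminf) measurable
    also have "\<dots> \<le> ennreal (c * (1/4)^n)"
    proof (rule Liminf_le)
      show "eventually (\<lambda>m. (\<integral>\<^sup>+x. ennreal ((norm (u n x - u m x))\<^sup>2) \<partial>N) \<le> ennreal (c * (1/4)^n)) sequentially"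
        using eventually_ge_at_top[of n]
        by eventually_elim
          (use sq_integrable_nn_integral[OF sq_integrable_diff[OF u u]] c in \<open>auto intro: ennreal_leI\<close>)
    qed simp
    finally show ?thesis .
  qed
  have sq: "sq_integrable N (\<lambda>x. u n x - l x)" for n
    unfolding sq_integrable_iff_nn_integral using sd bd[of n] by (auto intro: le_less_trans)
  from sq_integrable_diff[OF u[of 0] this[of 0]] show "sq_integrable N l" by simp
  show "(\<integral>x. (norm (u n x - l x))\<^sup>2 \<partial>N) \<le> c * (1/4)^n"
    using bd[of n] sq_integrable_nn_integral[OF sq[of n]] \<open>c \<ge> 0\<close> by (simp add: ennreal_le_iff)
qed

section \<open>Riesz representation and quadratic functionals\<close>

text \<open>No sign is required, so the axioms cover the inner product of processes as well as
  \<langle>\<N>u, v\<rangle>, whose positivity is part of what is to be proved. Linearity is phrased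
  with combinations because \<open>V\<close> is a set of functions.\<close>

locale form_on =
  fixes V :: "('a \<Rightarrow> 'b \<Rightarrow> 'x::real_vector) set"
    and q :: "('a \<Rightarrow> 'b \<Rightarrow> 'x) \<Rightarrow> ('a \<Rightarrow> 'b \<Rightarrow> 'x) \<Rightarrow> real"
  assumes zero_in: "(\<lambda>s w. 0) \<in> V"
    and lincomb_in: "f \<in> V \<Longrightarrow> g \<in> V \<Longrightarrow> (\<lambda>s w. a *\<^sub>R f s w + c *\<^sub>R g s w) \<in> V"
    and sym: "f \<in> V \<Longrightarrow> g \<in> V \<Longrightarrow> q f g = q g f"
    and lincomb_left: "f \<in> V \<Longrightarrow> g \<in> V \<Longrightarrow> h \<in> V \<Longrightarrow>
      q (\<lambda>s w. a *\<^sub>R f s w + c *\<^sub>R g s w) h = a * q f h + c * q g h"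
begin

lemma lincomb_right: "f \<in> V \<Longrightarrow> g \<in> V \<Longrightarrow> h \<in> V \<Longrightarrow>
  q h (\<lambda>s w. a *\<^sub>R f s w + c *\<^sub>R g s w) = a * q h f + c * q h g"
  by (subst sym) (simp_all add: lincomb_in lincomb_left sym[of _ h])

lemma diff_in: "f \<in> V \<Longrightarrow> g \<in> V \<Longrightarrow> (\<lambda>s w. f s w - g s w) \<in> V"
  using lincomb_in[of f g 1 "-1"] by simp

lemma diff_left: "f \<in> V \<Longrightarrow> g \<in> V \<Longrightarrow> h \<in> V \<Longrightarrow> q (\<lambda>s w. f s w - g s w) h = q f h - q g h"
  using lincomb_left[of f g h 1 "-1"] by simp

lemma square_lincomb: "f \<in> V \<Longrightarrow> g \<in> V \<Longrightarrow>
  q (\<lambda>s w. a *\<^sub>R f s w + c *\<^sub>R g s w) (\<lambda>s w. a *\<^sub>R f s w + c *\<^sub>R g s w) =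
    a\<^sup>2 * q f f + 2 * a * c * q f g + c\<^sup>2 * q g g"
  by (simp add: lincomb_left lincomb_right lincomb_in sym[of g f] power2_eq_square algebra_simps)

end

text \<open>Almost everywhere convergence in a space of square-integrable functions is directly
  available for the rate 4^-n, and minimising sequences can be chosen that fast. The free factor
  \<open>c\<close> lets the axiom pass to equivalent forms.\<close>

locale complete_form = form_on +
  assumes nonneg: "f \<in> V \<Longrightarrow> 0 \<le> q f f"
    and complete: "(\<And>n::nat. u n \<in> V) \<Longrightarrow>
      (\<And>n m. n \<le> m \<Longrightarrow> q (\<lambda>s w. u n s w - u m s w) (\<lambda>s w. u n s w - u m s w) \<le> c * (1/4)^n) \<Longrightarrow>
      \<exists>l\<in>V. (\<lambda>n. q (\<lambda>s w. u n s w - l s w) (\<lambda>s w. u n s w - l s w)) \<longlonglongrightarrow> 0"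
begin

text \<open>The form may degenerate. If \<open>q g g = 0\<close>, then \<open>q\<close> along the
  line f + t g is affine in t, and nonnegativity forces the slope to vanish.\<close>

lemma Cauchy_Schwarz:
  assumes f: "f \<in> V" and g: "g \<in> V"
  shows "(q f g)\<^sup>2 \<le> q f f * q g g"
proof (cases "q g g = 0")
  case True
  have *: "0 \<le> q f f + 2 * t * q f g" for t
    using nonneg[OF lincomb_in[OF f g, of 1 t]] square_lincomb[OF f g, of 1 t] True by simp
  have "q f g = 0"
  proof (rule ccontr)
    assume "q f g \<noteq> 0"
    then show False using *[of "- (q f f + 1) / (2 * q f g)"] by (simp add: field_simps)
  qed
  then show ?thesis using True by simp
next
  case False
  then have pos: "q g g > 0" using nonneg[OF g] by simp
  \<comment> \<open>The coefficients are those of the minimiser t = - \<open>q f g\<close> /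
    \<open>q g g\<close> on the line f + t g, cleared of the denominator.\<close>
  have "0 \<le> (q g g)\<^sup>2 * q f f + 2 * q g g * (- q f g) * q f g + (- q f g)\<^sup>2 * q g g"
    unfolding square_lincomb[OF f g, symmetric] by (intro nonneg lincomb_in f g)
  also have "\<dots> = q g g * (q f f * q g g - (q f g)\<^sup>2)" by (simp add: power2_eq_square algebra_simps)
  finally show ?thesis using pos by (simp add: zero_le_mult_iff)
qed

text \<open>A linear functional bounded by \<open>K * (q f f + 1)\<close> is bounded in the usual
  sense, as scaling of f shows. Here that scaling is done once, to bound the functional
  \<open>E\<close> from below.\<close>

theorem Riesz:
  assumes lin: "\<And>a c f g. f \<in> V \<Longrightarrow> g \<in> V \<Longrightarrow> \<phi> (\<lambda>s w. a *\<^sub>R f s w + c *\<^sub>R g s w) = a * \<phi> f + c * \<phi> g"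
    and bd: "\<And>f. f \<in> V \<Longrightarrow> \<bar>\<phi> f\<bar> \<le> K * (q f f + 1)"
  shows "\<exists>g\<in>V. \<forall>f\<in>V. q f g = \<phi> f"
proof -
  define E where "E f = q f f - 2 * \<phi> f" for f
  have E_lincomb: "E (\<lambda>s w. a *\<^sub>R f s w + c *\<^sub>R g s w) =
      a\<^sup>2 * q f f + 2 * a * c * q f g + c\<^sup>2 * q g g - 2 * (a * \<phi> f + c * \<phi> g)" if "f \<in> V" "g \<in> V" for a c f g
    unfolding E_def square_lincomb[OF that] lin[OF that] ..
  have z: "q (\<lambda>s w. 0) (\<lambda>s w. 0) = 0" using lincomb_left[OF zero_in zero_in zero_in, of 0 0] by simp
  have "0 \<le> K" using bd[OF zero_in] z by simp
  have below: "- (4 * K * (K + 1)) \<le> E f" if f: "f \<in> V" for f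
  proof -
    \<comment> \<open>With this scale the bound on 2 \<phi> f contains only the multiple K / (K + 1)
      of \<open>q f f\<close>, which the quadratic term of \<open>E\<close> absorbs. The remainder
      is 4 K (K + 1).\<close>
    let ?l = "1 / (2 * (K + 1))"
    have "\<bar>?l * \<phi> f\<bar> \<le> K * (?l\<^sup>2 * q f f + 1)"
      using bd[OF lincomb_in[OF f zero_in, of ?l 0]] square_lincomb[OF f zero_in, of ?l 0]
        lin[OF f zero_in, of ?l 0] by simp
    then have "?l * \<phi> f \<le> K * (?l\<^sup>2 * q f f + 1)" by linarith
    then have "(4 * (K + 1)) * (?l * \<phi> f) \<le> (4 * (K + 1)) * (K * (?l\<^sup>2 * q f f + 1))"
      using \<open>0 \<le> K\<close> by (intro mult_left_mono) auto
    also have "\<dots> = K / (K + 1) * q f f + 4 * K * (K + 1)"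
    proof -
      have "(4 * k) * (K * ((1 / (2 * k))\<^sup>2 * r + 1)) = K / k * r + 4 * K * k" if "k > 0" for k r
        using that by (simp add: field_simps power2_eq_square)
      then show ?thesis by this (use \<open>0 \<le> K\<close> in linarith)
    qed
    also have "\<dots> \<le> 1 * q f f + 4 * K * (K + 1)"
      using \<open>0 \<le> K\<close> nonneg[OF f] by (intro add_right_mono mult_right_mono) auto
    also have "(4 * (K + 1)) * (?l * \<phi> f) = 2 * \<phi> f" using \<open>0 \<le> K\<close> by (simp add: field_simps)
    finally show ?thesis unfolding E_def by simp
  qed
  \<comment> \<open>A minimising sequence of \<open>E\<close> is Cauchy by the parallelogram law; the rate \<open>4\<^bsup>-n\<^esup>\<close> is the one
    for which completeness is assumed.\<close>
  define m where "m = (INF f\<in>V. E f)"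
  have bb: "bdd_below (E ` V)" using below by (intro bdd_belowI2) auto
  have m_le: "m \<le> E f" if "f \<in> V" for f unfolding m_def using bb that by (rule cINF_lower)
  \<comment> \<open>The extra quarter cancels the factor 2 of each energy in the parallelogram
    identity down to one half, and the two halves add up to at most (1/4)^n.\<close>
  have "\<exists>f\<in>V. E f < m + (1/4)^n / 4" for n
    using cINF_less_iff[OF _ bb, of "m + (1/4)^n / 4"] zero_in unfolding m_def by force
  then obtain u where u: "\<And>n. u n \<in> V" "\<And>n::nat. E (u n) < m + (1/4)^n / 4" by metis
  have "q (\<lambda>s w. u n s w - u k s w) (\<lambda>s w. u n s w - u k s w) \<le> 1 * (1/4)^n" if "n \<le> k" for n k
  proof -
    have "q (\<lambda>s w. u n s w - u k s w) (\<lambda>s w. u n s w - u k s w) =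
        2 * E (u n) + 2 * E (u k) - 4 * E (\<lambda>s w. (1/2) *\<^sub>R u n s w + (1/2) *\<^sub>R u k s w)"
      using square_lincomb[OF u(1) u(1), of 1 n "-1" k] E_lincomb[OF u(1) u(1), of "1/2" n "1/2" k]
      by (simp add: E_def power2_eq_square)
    also have "\<dots> \<le> (1/4)^n / 2 + (1/4)^k / 2"
    proof -
      have "2 * x + 2 * y - 4 * z \<le> p / 2 + r / 2"
        if "x < m + p / 4" "y < m + r / 4" "m \<le> z" for x y z p r using that by linarith
      from this[OF u(2) u(2) m_le[OF lincomb_in[OF u(1) u(1)]]] show ?thesis .
    qed
    also have "\<dots> \<le> 1 * (1/4)^n" using power_decreasing[OF that, of "1/4::real"] by linarith
    finally show ?thesis .
  qed
  then obtain l where l: "l \<in> V" and ql: "(\<lambda>n. q (\<lambda>s w. u n s w - l s w) (\<lambda>s w. u n s w - l s w)) \<longlonglongrightarrow> 0"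
    using complete[of u 1] u(1) by blast
  \<comment> \<open>The limit of \<open>q (u n) f\<close> is found twice: it is \<open>q l f\<close>
    by Cauchy-Schwarz and \<phi> f by near-minimality of \<open>u n\<close>.\<close>
  have "q f l = \<phi> f" if f: "f \<in> V" for f
  proof -
    have "(\<lambda>n. q (\<lambda>s w. u n s w - l s w) f) \<longlonglongrightarrow> 0"
    proof (rule Lim_null_comparison)
      show "eventually (\<lambda>n. norm (q (\<lambda>s w. u n s w - l s w) f) \<le>
          sqrt (q (\<lambda>s w. u n s w - l s w) (\<lambda>s w. u n s w - l s w) * q f f)) sequentially"
        using Cauchy_Schwarz[OF diff_in[OF u(1) l] f] by (intro always_eventually allI) (simp add: real_le_rsqrt)
      show "(\<lambda>n. sqrt (q (\<lambda>s w. u n s w - l s w) (\<lambda>s w. u n s w - l s w) * q f f)) \<longlonglongrightarrow> 0"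
        using tendsto_real_sqrt[OF tendsto_mult_right[OF ql, of "q f f"]] by simp
    qed
    then have lim1: "(\<lambda>n. q (u n) f - q l f) \<longlonglongrightarrow> 0" by (simp add: diff_left u l f)
    have lim2: "(\<lambda>n. q (u n) f - \<phi> f) \<longlonglongrightarrow> 0"
    proof (rule Lim_null_comparison)
      show "(\<lambda>n. (1/2)^n * (q f f + 1)) \<longlonglongrightarrow> 0"
        using tendsto_mult_right[OF LIMSEQ_power_zero[of "1/2::real"], of "q f f + 1"] by simp
      show "eventually (\<lambda>n. norm (q (u n) f - \<phi> f) \<le> (1/2)^n * (q f f + 1)) sequentially"
      proof (intro always_eventually allI)
        fix n
        \<comment> \<open>Near-minimality is tested in the direction t f. The choice t =
          \<plusminus> (1/2)^n balances the error (1/4)^n / 4 against the quadratic term, and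
          division by (1/2)^n leaves a bound of order (1/2)^n for the difference.\<close>
        have var: "0 \<le> (1/4)^n / 4 + 2 * t * (q (u n) f - \<phi> f) + t\<^sup>2 * q f f" for t
          using m_le[OF lincomb_in[OF u(1) f], of 1 n t] E_lincomb[OF u(1) f, of 1 n t] u(2)[of n]
          by (simp add: E_def algebra_simps)
        have p: "(1/4::real)^n = (1/2)^n * (1/2)^n" by (simp flip: power_mult_distrib)
        have pos: "(1/2::real)^n > 0" by simp
        have abs_le: "\<bar>d\<bar> \<le> c" if "0 \<le> (1/2)^n * (c + 2 * d)" "0 \<le> (1/2)^n * (c - 2 * d)" for c d :: real
        proof -
          have "0 \<le> c + 2 * d" "0 \<le> c - 2 * d" using that pos by (auto simp: zero_le_mult_iff)
          then show ?thesis by linarith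
        qed
        have "norm (q (u n) f - \<phi> f) \<le> (1/2)^n * (q f f + 1/4)"
          unfolding real_norm_def
        proof (rule abs_le)
          show "0 \<le> (1/2)^n * ((1/2)^n * (q f f + 1/4) + 2 * (q (u n) f - \<phi> f))"
            using var[of "(1/2)^n"] p by (simp add: power2_eq_square algebra_simps)
          show "0 \<le> (1/2)^n * ((1/2)^n * (q f f + 1/4) - 2 * (q (u n) f - \<phi> f))"
            using var[of "- ((1/2)^n)"] p by (simp add: power2_eq_square algebra_simps)
        qed
        also have "\<dots> \<le> (1/2)^n * (q f f + 1)"
          by (intro mult_left_mono) auto
        finally show "norm (q (u n) f - \<phi> f) \<le> (1/2)^n * (q f f + 1)" .
      qed
    qed
    have "(\<lambda>n. (q (u n) f - \<phi> f) - (q (u n) f - q l f)) \<longlonglongrightarrow> 0 - 0" by (intro tendsto_diff lim1 lim2)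
    then have "q l f - \<phi> f = 0" by (simp add: LIMSEQ_const_iff)
    then show ?thesis using sym[OF f l] by simp
  qed
  then show ?thesis using l by blast
qed

end

text \<open>The lower bound turns a fast Cauchy sequence for \<open>b\<close> into one for
  \<open>q\<close>, with c / \<delta> in place of c. The upper bound brings the convergence back to
  \<open>b\<close>.\<close>

lemma (in complete_form) equivalent_complete_form:
  assumes "form_on V b"
    and lower: "\<And>f. f \<in> V \<Longrightarrow> \<delta> * q f f \<le> b f f" and "\<delta> > 0"
    and upper: "\<And>f. f \<in> V \<Longrightarrow> b f f \<le> K * q f f"
  shows "complete_form V b"
proof -
  interpret b: form_on V b by fact
  show ?thesis
  proof
    fix f assume f: "f \<in> V"
    show "0 \<le> b f f" using lower[OF f] nonneg[OF f] \<open>\<delta> > 0\<close> by (smt (verit) mult_nonneg_nonneg)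
  next
    fix u :: "nat \<Rightarrow> _" and c :: real
    assume u: "\<And>n. u n \<in> V"
      and c: "\<And>n m. n \<le> m \<Longrightarrow> b (\<lambda>s w. u n s w - u m s w) (\<lambda>s w. u n s w - u m s w) \<le> c * (1/4)^n"
    have "q (\<lambda>s w. u n s w - u m s w) (\<lambda>s w. u n s w - u m s w) \<le> (c / \<delta>) * (1/4)^n" if "n \<le> m" for n m
    proof -
      have "\<delta> * q (\<lambda>s w. u n s w - u m s w) (\<lambda>s w. u n s w - u m s w) \<le> c * (1/4)^n"
        by (rule order_trans[OF lower[OF diff_in[OF u u]] c[OF that]])
      then show ?thesis using \<open>\<delta> > 0\<close> by (simp add: pos_le_divide_eq mult.commute)
    qed
    then obtain l where l: "l \<in> V" and ql: "(\<lambda>n. q (\<lambda>s w. u n s w - l s w) (\<lambda>s w. u n s w - l s w)) \<longlonglongrightarrow> 0"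
      using complete[of u "c / \<delta>"] u by blast
    have "(\<lambda>n. b (\<lambda>s w. u n s w - l s w) (\<lambda>s w. u n s w - l s w)) \<longlonglongrightarrow> 0"
    proof (rule tendsto_sandwich[OF _ _ tendsto_const])
      show "(\<lambda>n. K * q (\<lambda>s w. u n s w - l s w) (\<lambda>s w. u n s w - l s w)) \<longlonglongrightarrow> 0"
        using tendsto_mult_left[OF ql, of K] by simp
      show "eventually (\<lambda>n. 0 \<le> b (\<lambda>s w. u n s w - l s w) (\<lambda>s w. u n s w - l s w)) sequentially"
        using lower[OF diff_in[OF u l]] nonneg[OF diff_in[OF u l]] \<open>\<delta> > 0\<close>
        by (intro always_eventually allI) (smt (verit) mult_nonneg_nonneg)
      show "eventually (\<lambda>n. b (\<lambda>s w. u n s w - l s w) (\<lambda>s w. u n s w - l s w) \<le>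
          K * q (\<lambda>s w. u n s w - l s w) (\<lambda>s w. u n s w - l s w)) sequentially"
        using upper[OF diff_in[OF u l]] by (intro always_eventually allI) auto
    qed
    then show "\<exists>l\<in>V. (\<lambda>n. b (\<lambda>s w. u n s w - l s w) (\<lambda>s w. u n s w - l s w)) \<longlonglongrightarrow> 0" using l by blast
  qed
qed

section \<open>Minimisation of quadratic functionals\<close>

lemma optimal_iff: "optimal V J u \<longleftrightarrow> u \<in> V \<and> (\<forall>v\<in>V. J u \<le> J v)"
proof
  assume "optimal V J u"
  then have u: "u \<in> V" "ereal (J u) = (INF v\<in>V. ereal (J v))" unfolding optimal_def cost_inf_def by auto
  have "J u \<le> J v" if "v \<in> V" for v
  proof -
    have "ereal (J u) \<le> ereal (J v)" unfolding u(2) using that by (rule INF_lower)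
    then show ?thesis by simp
  qed
  then show "u \<in> V \<and> (\<forall>v\<in>V. J u \<le> J v)" using u by blast
next
  assume "u \<in> V \<and> (\<forall>v\<in>V. J u \<le> J v)"
  then show "optimal V J u" unfolding optimal_def cost_inf_def
    by (auto intro!: antisym INF_greatest INF_lower)
qed

lemma finite_problem_bounded_below:
  assumes "finite_problem V J"
  shows "\<exists>L. \<forall>u\<in>V. L \<le> J u"
proof -
  have "- \<infinity> < cost_inf V J" using assms unfolding finite_problem_def .
  then obtain L where L: "ereal L < cost_inf V J" using ereal_dense2 by blast
  have "L \<le> J u" if "u \<in> V" for u
  proof -
    have "cost_inf V J \<le> ereal (J u)" unfolding cost_inf_def using that by (rule INF_lower)
    with L have "ereal L < ereal (J u)" by (rule less_le_trans)
    then show ?thesis by simp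
  qed
  then show ?thesis by blast
qed

text \<open>This isolates what the claims need from the stochastic problem: \<open>q\<close> is the
  inner product of controls, \<open>b\<close> the form of the operator \<open>N\<close>, and
  \<open>m\<close> the constant term. Through \<open>N_eq\<close>, statements about \<open>N\<close>
  become statements about \<open>b\<close>.\<close>

locale quadratic_cost = complete_form V q + b: form_on V b
  for V and q b :: "('a \<Rightarrow> 'b \<Rightarrow> 'x::real_vector) \<Rightarrow> ('a \<Rightarrow> 'b \<Rightarrow> 'x) \<Rightarrow> real" +
  fixes N :: "('a \<Rightarrow> 'b \<Rightarrow> 'x) \<Rightarrow> 'a \<Rightarrow> 'b \<Rightarrow> 'x" and H :: "'a \<Rightarrow> 'b \<Rightarrow> 'x" and J :: "('a \<Rightarrow> 'b \<Rightarrow> 'x) \<Rightarrow> real" and m :: real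
  assumes N_in: "u \<in> V \<Longrightarrow> N u \<in> V" and N_eq: "u \<in> V \<Longrightarrow> v \<in> V \<Longrightarrow> q (N u) v = b u v"
    and H_in: "H \<in> V"
    and J_eq: "u \<in> V \<Longrightarrow> J u = 1 / 2 * (b u u + 2 * q H u + m)"
begin

text \<open>The second-order expansion of a quadratic functional is exact; its linear coefficient is
  the stationarity condition tested with \<open>v\<close>.\<close>

lemma J_shift:
  assumes "u \<in> V" "v \<in> V"
  shows "J (\<lambda>s w. u s w + t *\<^sub>R v s w) = J u + t * (b u v + q H v) + t\<^sup>2 / 2 * b v v"
proof -
  have "(\<lambda>s w. u s w + t *\<^sub>R v s w) \<in> V" using lincomb_in[OF assms, of 1 t] by simp
  then show ?thesis
    using J_eq assms b.square_lincomb[OF assms, of 1 t] lincomb_right[OF assms H_in, of 1 t]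
    by (simp add: algebra_simps)
qed

lemma shift_in: "u \<in> V \<Longrightarrow> v \<in> V \<Longrightarrow> (\<lambda>s w. u s w + t *\<^sub>R v s w) \<in> V"
  using lincomb_in[of u v 1 t] by simp

text \<open>Adding the values of J at t v and - t v removes the linear term, so a negative
  \<open>b v v\<close> would drive the sum below any bound.\<close>

lemma form_nonneg_if_bounded_below:
  assumes L: "\<And>u. u \<in> V \<Longrightarrow> L \<le> J u" and v: "v \<in> V"
  shows "0 \<le> b v v"
proof (rule ccontr)
  assume "\<not> 0 \<le> b v v"
  then have neg: "b v v < 0" by simp
  let ?z = "\<lambda>s w. 0"
  have J0: "L \<le> J ?z" by (rule L[OF zero_in])
  \<comment> \<open>With this t the sum of the two values is 2 L - 1, below the guaranteed 2
    L.\<close>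
  define t where "t = sqrt ((2 * (J ?z - L) + 1) / (- b v v))"
  have t2: "t\<^sup>2 * b v v = - (2 * (J ?z - L) + 1)"
    unfolding t_def using neg J0 by (simp add: field_simps)
  have "L \<le> J ?z + t * (b ?z v + q H v) + t\<^sup>2 / 2 * b v v"
    using L[OF shift_in[OF zero_in v]] unfolding J_shift[OF zero_in v] .
  moreover have "L \<le> J ?z + (- t) * (b ?z v + q H v) + (- t)\<^sup>2 / 2 * b v v"
    using L[OF shift_in[OF zero_in v]] unfolding J_shift[OF zero_in v] .
  ultimately have "2 * L \<le> 2 * J ?z + t\<^sup>2 * b v v" by simp
  then show False unfolding t2 by simp
qed

text \<open>Positivity comes from boundedness below, stationarity from a one-dimensional variation.
  Conversely, at a stationary \<open>u\<close> the increase of J equals half of \<open>b\<close> on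
  the difference of the controls.\<close>

lemma minimizer_iff:
  assumes u: "u \<in> V"
  shows "(\<forall>v\<in>V. J u \<le> J v) \<longleftrightarrow> (\<forall>v\<in>V. 0 \<le> b v v) \<and> (\<forall>v\<in>V. b u v + q H v = 0)"
proof (intro iffI conjI ballI)
  assume min: "\<forall>v\<in>V. J u \<le> J v"
  fix v assume v: "v \<in> V"
  show b0: "0 \<le> b v v" using min v by (intro form_nonneg_if_bounded_below[of "J u"]) auto
  define g B where "g = b u v + q H v" and "B = b v v"
  have B: "B \<ge> 0" using b0 unfolding B_def .
  have "0 \<le> t * g + t\<^sup>2 / 2 * B" for t
    using min shift_in[OF u v, of t] J_shift[OF u v, of t] unfolding g_def B_def by fastforce
  \<comment> \<open>The minimiser of t g + t^2 B / 2 would be - g / B. Using B + 1 avoids a zero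
    denominator, and multiplication by 2 (B + 1)^2 leaves - g^2 (B + 2).\<close>
  from this[of "- g / (B + 1)"] have "0 \<le> 2 * (B + 1)\<^sup>2 * (- g / (B + 1) * g + (- g / (B + 1))\<^sup>2 / 2 * B)"
    using B by simp
  also have "\<dots> = - (g\<^sup>2 * (B + 2))"
  proof -
    have "2 * k\<^sup>2 * (- g / k * g + (- g / k)\<^sup>2 / 2 * B) = g\<^sup>2 * B - 2 * k * g\<^sup>2" if "k > 0" for k
      using that by (simp add: field_simps power2_eq_square)
    from this[of "B + 1"] show ?thesis using B by (simp add: algebra_simps)
  qed
  finally have "g\<^sup>2 * (B + 2) \<le> 0" by simp
  then have "g\<^sup>2 \<le> 0" using B by (simp add: mult_le_0_iff)
  then show "b u v + q H v = 0" unfolding g_def by simp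
next
  assume *: "(\<forall>v\<in>V. 0 \<le> b v v) \<and> (\<forall>v\<in>V. b u v + q H v = 0)"
  fix v assume v: "v \<in> V"
  have d: "(\<lambda>s w. v s w - u s w) \<in> V" by (rule diff_in[OF v u])
  have "J v = J u + 1 / 2 * b (\<lambda>s w. v s w - u s w) (\<lambda>s w. v s w - u s w)"
    using J_shift[OF u d, of 1] * d by simp
  then show "J u \<le> J v" using * d by simp
qed

text \<open>Since \<open>q\<close> is only semidefinite, the equation N u + H = 0 takes the form of
  a vanishing seminorm. Cauchy-Schwarz identifies this with orthogonality to all of
  \<open>V\<close>.\<close>

lemma stationary_iff:
  assumes u: "u \<in> V"
  shows "(\<forall>v\<in>V. b u v + q H v = 0) \<longleftrightarrow> q (\<lambda>s w. N u s w + H s w) (\<lambda>s w. N u s w + H s w) = 0"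
proof -
  let ?d = "\<lambda>s w. N u s w + H s w"
  have d: "?d \<in> V" using lincomb_in[OF N_in[OF u] H_in, of 1 1] by simp
  have eq: "q ?d v = b u v + q H v" if "v \<in> V" for v
    using lincomb_left[OF N_in[OF u] H_in that, of 1 1] N_eq[OF u that] by simp
  show ?thesis
  proof
    assume "q ?d ?d = 0"
    then have "(q ?d v)\<^sup>2 \<le> 0" if "v \<in> V" for v using Cauchy_Schwarz[OF d that] by simp
    then show "\<forall>v\<in>V. b u v + q H v = 0" using eq by simp
  qed (use eq d in auto)
qed

text \<open>Riesz for the form \<open>b\<close> represents the functional v \<mapsto>
  \<open>q H v\<close>. In terms of the operator this solves N u = H, so the stationary point of J
  is - u.\<close>

lemma stationary_exists:
  assumes lower: "\<And>f. f \<in> V \<Longrightarrow> \<delta> * q f f \<le> b f f" and "\<delta> > 0"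
    and upper: "\<And>f. f \<in> V \<Longrightarrow> b f f \<le> K * q f f"
  shows "\<exists>u\<in>V. \<forall>v\<in>V. b u v = q H v"
proof -
  interpret B: complete_form V b
    by (rule equivalent_complete_form[OF b.form_on_axioms lower \<open>\<delta> > 0\<close> upper])
  have "\<exists>u\<in>V. \<forall>v\<in>V. b v u = q H v"
  proof (rule B.Riesz)
    show "q H (\<lambda>s w. a *\<^sub>R f s w + c *\<^sub>R g s w) = a * q H f + c * q H g" if "f \<in> V" "g \<in> V" for a c f g
      by (rule lincomb_right[OF that H_in])
    fix f assume f: "f \<in> V"
    have "0 \<le> q H H + 2 * t * q H f + t\<^sup>2 * q f f" for t
      using nonneg[OF lincomb_in[OF H_in f, of 1 t]] square_lincomb[OF H_in f, of 1 t] by simp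
    from this[of 1] this[of "-1"] have "2 * \<bar>q H f\<bar> \<le> q H H + q f f" by (simp add: abs_if)
    then have "\<bar>q H f\<bar> \<le> q H H + q f f" by linarith
    also have "q f f \<le> b f f / \<delta>" using lower[OF f] \<open>\<delta> > 0\<close> by (simp add: field_simps)
    finally have "\<bar>q H f\<bar> \<le> q H H + (1 / \<delta>) * b f f" by simp
    also have "\<dots> \<le> (q H H + 1 / \<delta>) * (b f f + 1)"
    proof -
      have "0 \<le> q H H * b f f + 1 / \<delta>"
        using nonneg[OF H_in] B.nonneg[OF f] \<open>\<delta> > 0\<close> by (intro add_nonneg_nonneg mult_nonneg_nonneg) auto
      then show ?thesis by (simp add: algebra_simps)
    qed
    finally show "\<bar>q H f\<bar> \<le> (q H H + 1 / \<delta>) * (b f f + 1)" .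
  qed
  then show ?thesis using b.sym by metis
qed

end

section \<open>Strongly continuous semigroups\<close>

text \<open>The Banach-Steinhaus theorem: the closed sets \<open>C k\<close> cover the space, so by
  Baire one of them contains a ball.\<close>

lemma uniform_boundedness:
  fixes f :: "nat \<Rightarrow> 'a::banach \<Rightarrow>\<^sub>L 'b::real_normed_vector"
  assumes "\<And>x. \<exists>K. \<forall>n. norm (blinfun_apply (f n) x) \<le> K"
  shows "\<exists>K. \<forall>n. norm (f n) \<le> K"
proof -
  define C where "C k = {x. \<forall>n. norm (blinfun_apply (f n) x) \<le> real k}" for k :: nat
  have "closed (C k)" for k
  proof -
    have "C k = (\<Inter>n. {x. norm (blinfun_apply (f n) x) \<le> real k})" unfolding C_def by auto
    then show ?thesis by (auto intro!: closed_INT closed_Collect_le continuous_intros)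
  qed
  have "x \<in> (\<Union>k. C k)" for x
  proof -
    obtain K where "\<forall>n. norm (blinfun_apply (f n) x) \<le> K" using assms by blast
    then have "x \<in> C (nat \<lceil>K\<rceil>)" unfolding C_def using real_nat_ceiling_ge[of K] by (auto intro: order_trans)
    then show ?thesis by blast
  qed
  then have UN: "\<Union>(range C) = UNIV" by auto
  have "\<exists>k. interior (C k) \<noteq> {}"
  proof (rule ccontr)
    assume "\<not> ?thesis"
    then have "Met_TC.mtopology interior_of \<Union>(range C) = {}"
      using \<open>\<And>k. closed (C k)\<close>
      by (intro Met_TC.metric_Baire_category_alt) (auto simp: mcomplete_iff_complete complete_UNIV)
    then show False using UN by simp
  qed
  then obtain k x0 r where r: "r > 0" "ball x0 r \<subseteq> C k"
    by (meson all_not_in_conv mem_interior)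
  have x0: "norm (blinfun_apply (f n) x0) \<le> real k" for n
    using r centre_in_ball[of x0 r] unfolding C_def by blast
  \<comment> \<open>A vector of norm r / 2 is the difference of two points of the ball, each with
    image of norm at most k. Hence 2 k on norm r / 2, and 4 k / r on norm 1.\<close>
  have "norm (f n) \<le> 4 * real k / r" for n
  proof (rule norm_blinfun_bound)
    fix x
    show "norm (blinfun_apply (f n) x) \<le> 4 * real k / r * norm x"
    proof (cases "x = 0")
      case False
      let ?c = "r / (2 * norm x)"
      have "x0 + ?c *\<^sub>R x \<in> ball x0 r" using r False by (simp add: dist_norm)
      then have "norm (blinfun_apply (f n) (x0 + ?c *\<^sub>R x)) \<le> real k" using r unfolding C_def by blast
      moreover have "blinfun_apply (f n) (?c *\<^sub>R x) = blinfun_apply (f n) (x0 + ?c *\<^sub>R x) - blinfun_apply (f n) x0"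
        by (simp add: blinfun.add_right)
      ultimately have "norm (blinfun_apply (f n) (?c *\<^sub>R x)) \<le> real k + real k"
        using x0[of n] by (simp only:) (intro norm_triangle_le_diff add_mono)
      then have "?c * norm (blinfun_apply (f n) x) \<le> 2 * real k"
        using r by (simp add: blinfun.scaleR_right)
      then show ?thesis using r False by (simp add: field_simps)
    qed simp
  qed (use r in simp)
  then show ?thesis by blast
qed

text \<open>If it failed, there would be times decreasing to 0 along which the operator norms are
  unbounded although every orbit converges, against uniform boundedness.\<close>

lemma C0_semigroup_locally_bounded:
  fixes S :: "real \<Rightarrow> 'h::banach \<Rightarrow>\<^sub>L 'h"
  assumes "C0_semigroup S"
  shows "\<exists>\<delta>>0. \<exists>K. \<forall>t\<in>{0..\<delta>}. norm (S t) \<le> K"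
proof (rule ccontr)
  assume neg: "\<not> ?thesis"
  \<comment> \<open>The threshold is at least 1, hence above the norm of the identity
    \<open>S 0\<close> or equal to it. This excludes the time 0, at which the one-sided limit says
    nothing.\<close>
  have "\<exists>t\<in>{0..1 / real (Suc n)}. real n + 1 < norm (S t)" for n
    using neg by (metis not_le of_nat_0_less_iff zero_less_Suc zero_less_divide_1_iff)
  then obtain t where t: "\<And>n. t n \<in> {0..1 / real (Suc n)}" "\<And>n. real n + 1 < norm (S (t n))" by metis
  have "t n \<noteq> 0" for n
  proof
    assume "t n = 0"
    then have "norm (S (t n)) \<le> 1" using assms norm_blinfun_id_le unfolding C0_semigroup_def by auto
    then show False using t(2)[of n] by simp
  qed
  then have pos: "t n > 0" for n using t(1)[of n] by (simp add: order_less_le)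
  have "t \<longlonglongrightarrow> 0"
    by (rule tendsto_sandwich[OF _ _ tendsto_const LIMSEQ_inverse_real_of_nat])
      (use t(1) in \<open>auto simp: inverse_eq_divide\<close>)
  then have lim: "filterlim t (at_right 0) sequentially"
    using pos by (simp add: filterlim_at order_less_imp_not_eq2)
  have "\<exists>K. \<forall>n. norm (blinfun_apply (S (t n)) x) \<le> K" for x
  proof -
    have "((\<lambda>s. blinfun_apply (S s) x) \<longlongrightarrow> x) (at_right 0)" using assms unfolding C0_semigroup_def by blast
    from filterlim_compose[OF this lim] have "Bseq (\<lambda>n. blinfun_apply (S (t n)) x)"
      by (intro convergent_imp_Bseq convergentI)
    then show ?thesis by (auto simp: Bseq_def)
  qed
  then obtain K where "\<And>n. norm (S (t n)) \<le> K" using uniform_boundedness[of "\<lambda>n. S (t n)"] by blast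
  moreover obtain n where "K < real n" using reals_Archimedean2 by blast
  ultimately show False using t(2)[of n] by (smt (verit))
qed

text \<open>Each further step of length \<delta> costs one factor K. The normalisation K \<ge> 1
  makes the powers increase, so that shorter times obey the same bound.\<close>

lemma C0_semigroup_bounded:
  fixes S :: "real \<Rightarrow> 'h::banach \<Rightarrow>\<^sub>L 'h"
  assumes S: "C0_semigroup S"
  shows "\<exists>K\<ge>1. \<forall>t\<in>{0..T}. norm (S t) \<le> K"
proof -
  obtain \<delta> K0 where \<delta>: "\<delta> > 0" and K0: "\<And>t. t \<in> {0..\<delta>} \<Longrightarrow> norm (S t) \<le> K0"
    using C0_semigroup_locally_bounded[OF S] by blast
  define K where "K = max 1 K0"
  have K: "K \<ge> 1" "\<And>t. t \<in> {0..\<delta>} \<Longrightarrow> norm (S t) \<le> K"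
    using K0 unfolding K_def by (auto simp: le_max_iff_disj)
  have "\<forall>t\<in>{0..real (Suc n) * \<delta>}. norm (S t) \<le> K ^ Suc n" for n
  proof (induction n)
    case 0
    then show ?case using K by auto
  next
    case (Suc n)
    show ?case
    proof
      fix t assume t: "t \<in> {0..real (Suc (Suc n)) * \<delta>}"
      show "norm (S t) \<le> K ^ Suc (Suc n)"
      proof (cases "t \<le> \<delta>")
        case True
        then have "norm (S t) \<le> K" using t K by auto
        also have "K \<le> K ^ Suc (Suc n)" using K(1) by (rule self_le_power) simp
        finally show ?thesis .
      next
        case False
        have "S t = S \<delta> o\<^sub>L S (t - \<delta>)" using S \<delta> False unfolding C0_semigroup_def
          by (metis add.commute diff_add_cancel diff_ge_0_iff_ge less_eq_real_def linorder_le_less_linear)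
        then have "norm (S t) \<le> norm (S \<delta>) * norm (S (t - \<delta>))" by (simp add: norm_blinfun_compose)
        also have "\<dots> \<le> K * K ^ Suc n"
          using Suc t False K \<delta> by (intro mult_mono) (auto simp: algebra_simps)
        finally show ?thesis by simp
      qed
    qed
  qed
  moreover obtain n where "T < real n * \<delta>" using \<delta> reals_Archimedean3 by blast
  then have "T \<le> real (Suc n) * \<delta>" using \<delta> by (simp add: algebra_simps)
  ultimately have "\<forall>t\<in>{0..T}. norm (S t) \<le> K ^ Suc n" by fastforce
  then show ?thesis using K(1) one_le_power by blast
qed

text \<open>Only right continuity at 0 is given. Factoring the semigroup at the earlier of two times
  bounds the increment by K times that of S at the time difference, which settles continuity from
  both sides.\<close>

lemma C0_semigroup_continuous_on:
  fixes S :: "real \<Rightarrow> 'h::banach \<Rightarrow>\<^sub>L 'h"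
  assumes S: "C0_semigroup S"
  shows "continuous_on {0..T} (\<lambda>t. blinfun_apply (S t) x)"
proof -
  obtain K where K: "K \<ge> 1" "\<And>t. t \<in> {0..T} \<Longrightarrow> norm (S t) \<le> K" using C0_semigroup_bounded[OF S] by blast
  have le: "dist (blinfun_apply (S t) x) (blinfun_apply (S s) x) \<le> K * dist (blinfun_apply (S (t - s)) x) x"
    if "0 \<le> s" "s \<le> t" "t \<le> T" for s t
  proof -
    have "S t = S s o\<^sub>L S (t - s)" using S that unfolding C0_semigroup_def
      by (metis add_diff_cancel_left' diff_add_cancel add.commute diff_ge_0_iff_ge)
    then have "blinfun_apply (S t) x - blinfun_apply (S s) x = blinfun_apply (S s) (blinfun_apply (S (t - s)) x - x)"
      by (simp add: blinfun.diff_right)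
    then have "dist (blinfun_apply (S t) x) (blinfun_apply (S s) x) \<le> norm (S s) * dist (blinfun_apply (S (t - s)) x) x"
      unfolding dist_norm by (metis norm_blinfun)
    also have "\<dots> \<le> K * dist (blinfun_apply (S (t - s)) x) x" using K that by (intro mult_right_mono) auto
    finally show ?thesis .
  qed
  have lim: "((\<lambda>t. blinfun_apply (S t) x) \<longlongrightarrow> x) (at_right 0)" using S unfolding C0_semigroup_def by blast
  have ev: "\<exists>d>0. \<forall>h. 0 < h \<and> h < d \<longrightarrow> dist (blinfun_apply (S h) x) x < e" if "e > 0" for e
    using tendstoD[OF lim that] by (simp add: eventually_at_right_field) blast
  show ?thesis
    unfolding continuous_on_iff
  proof (intro ballI allI impI)
    fix s e :: real assume s: "s \<in> {0..T}" and e: "e > 0"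
    obtain d where d: "d > 0" "\<And>h. 0 < h \<Longrightarrow> h < d \<Longrightarrow> dist (blinfun_apply (S h) x) x < e / K"
      using ev[of "e / K"] e K by auto
    have *: "dist (blinfun_apply (S t) x) (blinfun_apply (S r) x) < e"
      if "0 \<le> r" "r < t" "t \<le> T" "t - r < d" for r t
      using le[of r t] d(2)[of "t - r"] that K by (simp add: field_simps)
    show "\<exists>d>0. \<forall>t\<in>{0..T}. dist t s < d \<longrightarrow> dist (blinfun_apply (S t) x) (blinfun_apply (S s) x) < e"
    proof (intro exI conjI ballI impI)
      fix t assume "t \<in> {0..T}" "dist t s < d"
      then show "dist (blinfun_apply (S t) x) (blinfun_apply (S s) x) < e"
        using *[of s t] *[of t s] s e by (cases t s rule: linorder_cases) (auto simp: dist_real_def dist_commute)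
    qed (rule d)
  qed
qed

text \<open>Strong continuity does not make the semigroup measurable as an operator-valued map.
  Simple approximation of \<open>g\<close> reduces the claim to fixed vectors, whose orbits are
  continuous.\<close>

lemma C0_semigroup_measurable:
  fixes S :: "real \<Rightarrow> 'h::{banach, second_countable_topology} \<Rightarrow>\<^sub>L 'h"
  assumes S: "C0_semigroup S" and \<tau>: "\<tau> \<in> borel_measurable N" "\<And>z. z \<in> space N \<Longrightarrow> \<tau> z \<in> {0..T}"
    and g: "g \<in> borel_measurable N"
  shows "(\<lambda>z. blinfun_apply (S (\<tau> z)) (g z)) \<in> borel_measurable N"
proof -
  obtain s where s: "\<And>n. simple_function N (s n)" "\<And>z. z \<in> space N \<Longrightarrow> (\<lambda>n::nat. s n z) \<longlonglongrightarrow> g z"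
    using borel_measurable_implies_sequence_metric[OF g, of 0] by blast
  have "(\<lambda>z. blinfun_apply (S (\<tau> z)) (s n z)) \<in> borel_measurable N" for n
  proof (rule measurable_compose_countable'[where I="s n ` space N" and f="\<lambda>y z. blinfun_apply (S (\<tau> z)) y"])
    show "countable (s n ` space N)" using simple_functionD(1)[OF s(1)] by (rule countable_finite)
    show "s n \<in> measurable N (count_space (s n ` space N))"
      using simple_functionD[OF s(1)] by (auto simp: measurable_count_space_eq2)
    have [measurable]: "\<tau> \<in> measurable N (restrict_space borel {0..T})"
      using \<tau> by (auto intro!: measurable_restrict_space2)
    show "(\<lambda>z. blinfun_apply (S (\<tau> z)) y) \<in> borel_measurable N" for y
      using borel_measurable_continuous_on_restrict[OF C0_semigroup_continuous_on[OF S, of T y]]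
      by measurable
  qed
  moreover have "(\<lambda>n. blinfun_apply (S (\<tau> z)) (s n z)) \<longlonglongrightarrow> blinfun_apply (S (\<tau> z)) (g z)"
    if "z \<in> space N" for z
    using s(2)[OF that] by (intro tendsto_intros)
  ultimately show ?thesis by (rule borel_measurable_LIMSEQ_metric)
qed

section \<open>Processes on the product space\<close>

lemma sets_time_prob: "sets (time_prob P T) = sets (restrict_space borel {0..T} \<Otimes>\<^sub>M P)"
  unfolding time_prob_def by (intro sets_pair_measure_cong sets_restrict_space_cong) auto

lemma space_time_prob: "space (time_prob P T) = {0..T} \<times> space P"
  unfolding time_prob_def by (simp add: space_pair_measure space_restrict_space)

lemma finite_measure_time: "finite_measure (restrict_space lborel {0..T::real})"
  by (rule finite_measureI) (simp add: emeasure_restrict_space space_restrict_space emeasure_lborel_Icc_eq)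

lemma pair_sigma_finite_time:
  assumes "prob_space P"
  shows "pair_sigma_finite (restrict_space lborel {0..T::real}) P"
proof -
  interpret prob_space P by fact
  interpret t: finite_measure "restrict_space lborel {0..T::real}" by (rule finite_measure_time)
  show ?thesis ..
qed

lemma finite_measure_time_prob:
  assumes "prob_space P"
  shows "finite_measure (time_prob P T)"
  unfolding time_prob_def using assms finite_measure_time
  by (intro finite_measure_pair_measure) (auto intro: prob_space.axioms)

lemma measurable_time_prob_fst: "fst \<in> borel_measurable (time_prob P T)"
  unfolding time_prob_def
  by (rule measurable_compose[OF measurable_fst]) (auto intro: measurable_restrict_space1)

lemma measurable_snd_time_prob: "snd \<in> measurable (time_prob P T) P"
  unfolding time_prob_def by (rule measurable_snd)

lemma nn_integral_time_prob:
  assumes "prob_space P" "f \<in> borel_measurable (time_prob P T)"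
  shows "(\<integral>\<^sup>+z. f z \<partial>time_prob P T) = (\<integral>\<^sup>+s. (\<integral>\<^sup>+w. f (s, w) \<partial>P) * indicator {0..T} s \<partial>lborel)"
proof -
  interpret prob_space P by fact
  show ?thesis
    using nn_integral_fst[of f "restrict_space lborel {0..T}"] assms(2)
    unfolding time_prob_def by (simp add: nn_integral_restrict_space)
qed

lemma nn_integral_time_prob_snd:
  assumes "prob_space P" "f \<in> borel_measurable (time_prob P T)"
  shows "(\<integral>\<^sup>+z. f z \<partial>time_prob P T) = (\<integral>\<^sup>+w. (\<integral>\<^sup>+s. f (s, w) * indicator {0..T} s \<partial>lborel) \<partial>P)"
proof -
  interpret pair_sigma_finite "restrict_space lborel {0..T}" P by (rule pair_sigma_finite_time) fact
  show ?thesis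
    using nn_integral_snd[of f] assms(2)
    unfolding time_prob_def by (simp add: nn_integral_restrict_space)
qed

text \<open>The measures for t and T live on different spaces, \<open>{0..t}\<close> and
  \<open>{0..T}\<close> times \<Omega>, so measurability, integrals and null sets have to be carried
  along the inclusion.\<close>

lemma measurable_time_prob_mono:
  assumes "t \<le> T" "f \<in> measurable (time_prob P T) M"
  shows "f \<in> measurable (time_prob P t) M"
proof -
  have [measurable]: "(\<lambda>s. s) \<in> measurable (restrict_space lborel {0..t}) (restrict_space lborel {0..T})"
    using assms(1) by (intro measurable_restrict_space3) auto
  have "(\<lambda>z. (fst z, snd z)) \<in> measurable (time_prob P t) (time_prob P T)"
    unfolding time_prob_def by measurable
  then show ?thesis using measurable_compose[OF _ assms(2)] by simp
qed

lemma nn_integral_time_prob_mono: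
  assumes "prob_space P" "f \<in> borel_measurable (time_prob P T)" "t \<le> T"
  shows "(\<integral>\<^sup>+z. f z \<partial>time_prob P t) \<le> (\<integral>\<^sup>+z. f z \<partial>time_prob P T)"
  unfolding nn_integral_time_prob[OF assms(1,2)]
    nn_integral_time_prob[OF assms(1) measurable_time_prob_mono[OF assms(3,2)]]
  using assms(3) by (intro nn_integral_mono mult_left_mono) (auto simp: indicator_def)

lemma AE_time_prob_mono:
  assumes "prob_space P" "AE z in time_prob P T. Q z" "t \<le> T"
  shows "AE z in time_prob P t. Q z"
proof -
  obtain N where N: "{z \<in> space (time_prob P T). \<not> Q z} \<subseteq> N" "emeasure (time_prob P T) N = 0" "N \<in> sets (time_prob P T)"
    using AE_E[OF assms(2)] by blast
  have "(\<integral>\<^sup>+z. indicator N z \<partial>time_prob P t) \<le> (\<integral>\<^sup>+z. indicator N z \<partial>time_prob P T)"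
    using N(3) by (intro nn_integral_time_prob_mono assms) simp
  also have "\<dots> = 0" using N by simp
  finally have "(\<integral>\<^sup>+z. indicator N z \<partial>time_prob P t) = 0" by simp
  moreover have "(indicator N :: _ \<Rightarrow> ennreal) \<in> borel_measurable (time_prob P t)"
    using N(3) by (intro measurable_time_prob_mono[OF assms(3)]) simp
  ultimately have "AE z in time_prob P t. (indicator N z :: ennreal) = 0"
    by (simp add: nn_integral_0_iff_AE)
  then show ?thesis
  proof (rule AE_mp, intro AE_I2 impI)
    fix z assume z: "z \<in> space (time_prob P t)" "(indicator N z :: ennreal) = 0"
    then have "z \<in> space (time_prob P T)" "z \<notin> N"
      using assms(3) by (auto simp: space_time_prob indicator_def split: if_splits)
    then show "Q z" using N(1) by blast
  qed
qed

lemma measurable_ident_subalgebra: "subalgebra P E \<Longrightarrow> (\<lambda>w. w) \<in> measurable P E"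
  by (auto simp: subalgebra_def measurable_def)

lemma progressive_strongly_measurable:
  assumes "progressive F T f" "subalgebra P (F T)" "0 \<le> T"
  shows "strongly_measurable (time_prob P T) (\<lambda>(s, w). f s w)"
proof -
  have "strongly_measurable (restrict_space borel {0..T} \<Otimes>\<^sub>M F T) (\<lambda>(s, w). f s w)"
    using assms unfolding progressive_def by auto
  moreover have "(\<lambda>z. z) \<in> measurable (time_prob P T) (restrict_space borel {0..T} \<Otimes>\<^sub>M F T)"
  proof -
    have [measurable]: "(\<lambda>w. w) \<in> measurable P (F T)" by (rule measurable_ident_subalgebra) fact
    have "(\<lambda>z. (fst z, snd z)) \<in> measurable (restrict_space borel {0..T} \<Otimes>\<^sub>M P) (restrict_space borel {0..T} \<Otimes>\<^sub>M F T)"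
      by measurable
    then show ?thesis by (simp cong: measurable_cong_sets add: measurable_cong_sets[OF sets_time_prob refl])
  qed
  ultimately show ?thesis using strongly_measurable_compose[of _ _ "\<lambda>z. z"] by auto
qed

text \<open>Gronwall's inequality and the terminal cost evaluate the state at individual times,
  where a statement on the product space gives no information.\<close>

lemma progressive_section:
  assumes "progressive F T f" "t \<in> {0..T}"
  shows "strongly_measurable (F t) (f t)"
proof -
  have "strongly_measurable (restrict_space borel {0..t} \<Otimes>\<^sub>M F t) (\<lambda>(s, w). f s w)"
    using assms unfolding progressive_def by auto
  moreover have "(\<lambda>w. (t, w)) \<in> measurable (F t) (restrict_space borel {0..t} \<Otimes>\<^sub>M F t)"
    using assms by (intro measurable_Pair1') (auto simp: space_restrict_space)
  ultimately have "strongly_measurable (F t) (\<lambda>w. case (t, w) of (s, w) \<Rightarrow> f s w)"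
    by (rule strongly_measurable_compose)
  then show ?thesis by simp
qed

lemma strongly_measurable_subalgebra:
  "subalgebra P E \<Longrightarrow> strongly_measurable E f \<Longrightarrow> strongly_measurable P f"
  using strongly_measurable_compose[OF _ measurable_ident_subalgebra] by auto

lemma progressive_continuous2:
  assumes "progressive F T f" "progressive F T g" "continuous_on UNIV (\<lambda>(x, y). h x y)"
  shows "progressive F T (\<lambda>s w. h (f s w) (g s w))"
  unfolding progressive_def
proof
  fix t assume "t \<in> {0..T}"
  then show "strongly_measurable (restrict_space borel {0..t} \<Otimes>\<^sub>M F t) (\<lambda>(s, w). h (f s w) (g s w))"
    using strongly_measurable_continuous2[OF _ _ assms(3), of "restrict_space borel {0..t} \<Otimes>\<^sub>M F t"
        "\<lambda>(s, w). f s w" "\<lambda>(s, w). g s w"] assms(1,2)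
    by (auto simp: progressive_def case_prod_unfold)
qed

lemma progressive_zero: "progressive F T (\<lambda>s w. 0)"
  unfolding progressive_def by (simp add: strongly_measurable_const case_prod_unfold)

lemma progressive_lincomb:
  "progressive F T f \<Longrightarrow> progressive F T g \<Longrightarrow> progressive F T (\<lambda>s w. a *\<^sub>R f s w + c *\<^sub>R g s w)"
  by (rule progressive_continuous2) (auto intro!: continuous_intros simp: case_prod_unfold)

lemma progressive_blinfun_apply:
  "progressive F T a \<Longrightarrow> progressive F T f \<Longrightarrow> progressive F T (\<lambda>s w. blinfun_apply (a s w) (f s w))"
  by (rule progressive_continuous2) (auto intro!: continuous_intros simp: case_prod_unfold)

lemma progressive_lim:
  fixes u :: "nat \<Rightarrow> real \<Rightarrow> 'w \<Rightarrow> 'x::banach"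
  assumes "\<And>n. progressive F T (u n)"
  shows "progressive F T (\<lambda>s w. if convergent (\<lambda>n. u n s w) then lim (\<lambda>n. u n s w) else 0)"
  unfolding progressive_def
proof
  fix t assume "t \<in> {0..T}"
  then show "strongly_measurable (restrict_space borel {0..t} \<Otimes>\<^sub>M F t)
      (\<lambda>(s, w). if convergent (\<lambda>n. u n s w) then lim (\<lambda>n. u n s w) else 0)"
    using strongly_measurable_lim[of "restrict_space borel {0..t} \<Otimes>\<^sub>M F t" "\<lambda>n z. u n (fst z) (snd z)"] assms
    by (auto simp: progressive_def case_prod_unfold)
qed

lemma L2F_iff_sq_integrable:
  assumes "subalgebra P (F T)" "0 \<le> T"
  shows "f \<in> L2F P F T \<longleftrightarrow> progressive F T f \<and> sq_integrable (time_prob P T) (\<lambda>(s, w). f s w)"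
  using progressive_strongly_measurable[of F T f P] assms unfolding L2F_def sq_integrable_def
  by (auto simp: case_prod_unfold)

lemma L2F_lincomb:
  assumes "subalgebra P (F T)" "0 \<le> T" "f \<in> L2F P F T" "g \<in> L2F P F T"
  shows "(\<lambda>s w. a *\<^sub>R f s w + c *\<^sub>R g s w) \<in> L2F P F T"
  using assms(3,4) sq_integrable_lincomb[of "time_prob P T" "\<lambda>(s, w). f s w" "\<lambda>(s, w). g s w"]
  by (auto simp: L2F_iff_sq_integrable[of P F T, OF assms(1,2)] case_prod_unfold intro: progressive_lincomb)

lemma L2F_zero: "(\<lambda>s w. 0) \<in> L2F P F T"
  unfolding L2F_def by (simp add: progressive_zero case_prod_unfold)

lemma L2F_blinfun_apply:
  assumes "subalgebra P (F T)" "0 \<le> T" "a \<in> LinfF P F T" "f \<in> L2F P F T"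
  shows "(\<lambda>s w. blinfun_apply (a s w) (f s w)) \<in> L2F P F T"
proof -
  obtain K where K: "AE (s, w) in time_prob P T. norm (a s w) \<le> K"
    using assms(3) unfolding LinfF_def by blast
  have p: "progressive F T (\<lambda>s w. blinfun_apply (a s w) (f s w))"
    using assms by (auto simp: LinfF_def L2F_def intro: progressive_blinfun_apply)
  have "sq_integrable (time_prob P T) (\<lambda>(s, w). blinfun_apply (a s w) (f s w))"
  proof (rule sq_integrable_bound)
    show "sq_integrable (time_prob P T) (\<lambda>(s, w). f s w)"
      using assms L2F_iff_sq_integrable[of P F T f] by auto
    show "strongly_measurable (time_prob P T) (\<lambda>(s, w). blinfun_apply (a s w) (f s w))"
      using p assms(1,2) by (rule progressive_strongly_measurable)
    show "AE z in time_prob P T. norm (case z of (s, w) \<Rightarrow> blinfun_apply (a s w) (f s w)) \<le>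
        K * norm (case z of (s, w) \<Rightarrow> f s w)"
      using K by eventually_elim (auto intro!: order_trans[OF norm_blinfun mult_right_mono])
  qed
  then show ?thesis using p L2F_iff_sq_integrable[of P F T] assms by blast
qed

section \<open>The Ito integral\<close>

locale brownian_filtration = prob_space P
  for P :: "'w measure" +
  fixes F :: "real \<Rightarrow> 'w measure" and T :: real and W :: "real \<Rightarrow> 'w \<Rightarrow> real"
  assumes T_pos: "T > 0" and filtration: "usual_filtration P F T" and brownian: "brownian_motion P F T W"
begin

lemma subalgebra_F: "0 \<le> t \<Longrightarrow> t \<le> T \<Longrightarrow> subalgebra P (F t)"
  using filtration unfolding usual_filtration_def by auto

lemma space_F: "0 \<le> t \<Longrightarrow> t \<le> T \<Longrightarrow> space (F t) = space P"
  using subalgebra_F unfolding subalgebra_def by auto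

lemma subalgebra_F_mono: "0 \<le> s \<Longrightarrow> s \<le> t \<Longrightarrow> t \<le> T \<Longrightarrow> subalgebra (F t) (F s)"
  using filtration space_F[of s] space_F[of t] unfolding usual_filtration_def subalgebra_def by auto

lemma measurable_F: "0 \<le> s \<Longrightarrow> s \<le> T \<Longrightarrow> f \<in> measurable (F s) M \<Longrightarrow> f \<in> measurable P M"
  using measurable_from_subalg[OF subalgebra_F] by blast

lemma measurable_F_mono: "0 \<le> s \<Longrightarrow> s \<le> t \<Longrightarrow> t \<le> T \<Longrightarrow> f \<in> measurable (F s) M \<Longrightarrow> f \<in> measurable (F t) M"
  using measurable_from_subalg[OF subalgebra_F_mono] by blast

lemma W_measurable_F: "0 \<le> s \<Longrightarrow> s \<le> t \<Longrightarrow> t \<le> T \<Longrightarrow> W s \<in> borel_measurable (F t)"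
  using brownian measurable_F_mono[of s t "W s" borel] unfolding brownian_motion_def by auto

lemma W_measurable: "0 \<le> s \<Longrightarrow> s \<le> T \<Longrightarrow> W s \<in> borel_measurable P"
  using W_measurable_F[of s s] measurable_F by auto

lemma increment_moments:
  assumes "0 \<le> s" "s < t" "t \<le> T"
  shows "integrable P (\<lambda>w. W t w - W s w)" "expectation (\<lambda>w. W t w - W s w) = 0"
    "integrable P (\<lambda>w. (W t w - W s w)\<^sup>2)" "expectation (\<lambda>w. (W t w - W s w)\<^sup>2) = t - s"
proof -
  have pos: "0 < sqrt (t - s)" using assms by simp
  have D: "distributed P lborel (\<lambda>w. W t w - W s w) (normal_density 0 (sqrt (t - s)))"
    using brownian assms unfolding brownian_motion_def by blast
  show "integrable P (\<lambda>w. W t w - W s w)"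
    using distributed_integrable_var[OF D] integrable_normal_moment_nz_1[OF pos] by simp
  show e: "expectation (\<lambda>w. W t w - W s w) = 0"
    by (rule normal_distributed_expectation[OF pos D])
  show "integrable P (\<lambda>w. (W t w - W s w)\<^sup>2)"
    using distributed_integrable[OF D, of "\<lambda>x. x\<^sup>2"] integrable_normal_moment[OF pos, of 0 2] by simp
  show "expectation (\<lambda>w. (W t w - W s w)\<^sup>2) = t - s"
    using normal_distributed_variance[OF pos D] e assms by simp
qed

text \<open>Independence of the past and the increment passes to the smaller sigma-algebra generated
  by \<open>Z\<close>, and expectations factor. The cases \<phi> x = x and \<phi> x = x^2 give
  orthogonality and variance.\<close>

lemma increment_indep:
  fixes Z :: "'w \<Rightarrow> real"
  assumes st: "0 \<le> s" "s < t" "t \<le> T"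
    and Z: "Z \<in> borel_measurable (F s)" "integrable P Z"
    and \<phi>: "\<phi> \<in> borel_measurable borel" "integrable P (\<lambda>w. \<phi> (W t w - W s w))"
  shows "integrable P (\<lambda>w. Z w * \<phi> (W t w - W s w))"
    "expectation (\<lambda>w. Z w * \<phi> (W t w - W s w)) = expectation Z * expectation (\<lambda>w. \<phi> (W t w - W s w))"
proof -
  let ?D = "\<lambda>w. W t w - W s w"
  have [measurable]: "W t \<in> borel_measurable P" "W s \<in> borel_measurable P" using st by (auto intro: W_measurable)
  have D: "?D \<in> borel_measurable P" by measurable
  have ind: "indep_set (sets (F s)) (sets (vimage_algebra (space P) ?D borel))"
    using brownian st unfolding brownian_motion_def by blast
  have "sigma_sets (space P) {Z -` A \<inter> space P |A. A \<in> sets borel} \<subseteq> sets (F s)"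
  proof -
    have "{Z -` A \<inter> space P |A. A \<in> sets borel} \<subseteq> sets (F s)"
      using measurable_sets[OF Z(1)] space_F st by auto
    then show ?thesis using sets.sigma_sets_subset[of _ "F s"] space_F[of s] st by auto
  qed
  moreover have "sigma_sets (space P) {?D -` A \<inter> space P |A. A \<in> sets borel} \<subseteq>
      sets (vimage_algebra (space P) ?D borel)"
    by (simp add: sets_vimage_algebra)
  ultimately have "indep_set (sigma_sets (space P) {Z -` A \<inter> space P |A. A \<in> sets borel})
     (sigma_sets (space P) {?D -` A \<inter> space P |A. A \<in> sets borel})"
    using ind unfolding indep_sets2_eq by blast
  then have "indep_var borel Z borel ?D"
    unfolding indep_var_eq using Z(2) D by auto
  from indep_var_compose[OF this _ \<phi>(1), of "\<lambda>x. x" borel]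
  have iv: "indep_var borel Z borel (\<lambda>w. \<phi> (?D w))" by (simp add: comp_def)
  show "integrable P (\<lambda>w. Z w * \<phi> (?D w))" by (rule indep_var_integrable[OF iv Z(2) \<phi>(2)])
  show "expectation (\<lambda>w. Z w * \<phi> (?D w)) = expectation Z * expectation (\<lambda>w. \<phi> (?D w))"
    by (rule indep_var_lebesgue_integral[OF iv Z(2) \<phi>(2)])
qed

lemma increment_orthogonal:
  fixes Z :: "'w \<Rightarrow> real"
  assumes st: "0 \<le> s" "s \<le> t" "t \<le> T" and Z: "Z \<in> borel_measurable (F s)" "integrable P Z"
  shows "integrable P (\<lambda>w. Z w * (W t w - W s w))" "expectation (\<lambda>w. Z w * (W t w - W s w)) = 0"
proof -
  have "integrable P (\<lambda>w. Z w * (W t w - W s w)) \<and> expectation (\<lambda>w. Z w * (W t w - W s w)) = 0"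
  proof (cases "s = t")
    case False
    then show ?thesis
      using increment_indep[OF _ _ _ Z, of t "\<lambda>x. x"] increment_moments[of s t] st by simp
  qed simp
  then show "integrable P (\<lambda>w. Z w * (W t w - W s w))" "expectation (\<lambda>w. Z w * (W t w - W s w)) = 0" by auto
qed

lemma increment_square:
  fixes Z :: "'w \<Rightarrow> real"
  assumes st: "0 \<le> s" "s \<le> t" "t \<le> T" and Z: "Z \<in> borel_measurable (F s)" "integrable P Z"
  shows "integrable P (\<lambda>w. Z w * (W t w - W s w)\<^sup>2)"
    "expectation (\<lambda>w. Z w * (W t w - W s w)\<^sup>2) = (t - s) * expectation Z"
proof -
  have "integrable P (\<lambda>w. Z w * (W t w - W s w)\<^sup>2) \<and>
      expectation (\<lambda>w. Z w * (W t w - W s w)\<^sup>2) = (t - s) * expectation Z"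
  proof (cases "s = t")
    case False
    then show ?thesis
      using increment_indep[OF _ _ _ Z, of t "\<lambda>x. x\<^sup>2"] increment_moments[of s t] st by simp
  qed simp
  then show "integrable P (\<lambda>w. Z w * (W t w - W s w)\<^sup>2)"
    "expectation (\<lambda>w. Z w * (W t w - W s w)\<^sup>2) = (t - s) * expectation Z" by auto
qed

text \<open>The longer increment is cut at b. The part up to b produces the variance, and the part
  after b is orthogonal to everything known at b.\<close>

lemma increment_product_same_start:
  fixes Z :: "'w \<Rightarrow> real"
  assumes "0 \<le> c" "c \<le> b" "b \<le> d" "d \<le> T" and Z: "Z \<in> borel_measurable (F c)" "integrable P Z"
  shows "integrable P (\<lambda>w. Z w * (W b w - W c w) * (W d w - W c w))"
    "expectation (\<lambda>w. Z w * (W b w - W c w) * (W d w - W c w)) = (b - c) * expectation Z"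
proof -
  have [measurable]: "W b \<in> borel_measurable (F b)" "W c \<in> borel_measurable (F b)"
    by (rule W_measurable_F; use assms in linarith)+
  have [measurable]: "Z \<in> borel_measurable (F b)"
    by (rule measurable_F_mono[of c b]) (use assms in auto)
  note sq = increment_square[of c b Z] and Zi = increment_orthogonal(1)[of c b Z]
  have m: "(\<lambda>w. Z w * (W b w - W c w)) \<in> borel_measurable (F b)" by measurable
  note or = increment_orthogonal[OF _ _ _ m, of d]
  have eq: "(\<lambda>w. Z w * (W b w - W c w) * (W d w - W c w)) =
      (\<lambda>w. Z w * (W b w - W c w)\<^sup>2 + Z w * (W b w - W c w) * (W d w - W b w))"
    by (auto simp: power2_eq_square algebra_simps)
  show "integrable P (\<lambda>w. Z w * (W b w - W c w) * (W d w - W c w))"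
    unfolding eq using assms sq Zi or by simp
  show "expectation (\<lambda>w. Z w * (W b w - W c w) * (W d w - W c w)) = (b - c) * expectation Z"
    unfolding eq using assms sq Zi or by simp
qed

text \<open>The increment over (a, b] is cut at the later start c. What lies before c is known at c
  and hence orthogonal to the other increment; what lies after has a common start with it. The
  overlap length remains.\<close>

lemma increment_product_ordered:
  fixes Z :: "'w \<Rightarrow> real"
  assumes ab: "0 \<le> a" "a \<le> b" "b \<le> T" and cd: "a \<le> c" "c \<le> d" "d \<le> T"
    and Z: "Z \<in> borel_measurable (F c)" "\<And>w. w \<in> space P \<Longrightarrow> \<bar>Z w\<bar> \<le> K"
  shows "integrable P (\<lambda>w. Z w * (W b w - W a w) * (W d w - W c w)) \<and>
    expectation (\<lambda>w. Z w * (W b w - W a w) * (W d w - W c w)) = max 0 (min b d - c) * expectation Z"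
proof -
  have Zm: "Z \<in> borel_measurable P" using measurable_F[of c Z borel] assms by simp
  have Zi: "integrable P Z" by (rule integrable_const_bound[of _ K]) (use Z Zm in auto)
  \<comment> \<open>Boundedness of \<open>Z\<close> is what keeps its product with an unbounded
    Gaussian increment integrable.\<close>
  have before: "(\<lambda>w. Z w * (W r w - W a w)) \<in> borel_measurable (F c)"
    "integrable P (\<lambda>w. Z w * (W r w - W a w))" if "a \<le> r" "r \<le> c" for r
  proof -
    note Z(1)[measurable]
    have [measurable]: "W r \<in> borel_measurable (F c)" "W a \<in> borel_measurable (F c)"
      by (rule W_measurable_F; use assms that in linarith)+
    show m: "(\<lambda>w. Z w * (W r w - W a w)) \<in> borel_measurable (F c)" by measurable
    show "integrable P (\<lambda>w. Z w * (W r w - W a w))"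
    proof (rule Bochner_Integration.integrable_bound)
      show "integrable P (\<lambda>w. K * (W r w - W a w))"
        using increment_moments(1)[of a r] assms that by (cases "a = r") auto
      show "(\<lambda>w. Z w * (W r w - W a w)) \<in> borel_measurable P" using measurable_F[OF _ _ m] assms by simp
      show "AE w in P. norm (Z w * (W r w - W a w)) \<le> norm (K * (W r w - W a w))"
        using Z(2) by (intro AE_I2) (auto simp: abs_mult intro!: mult_right_mono order_trans[OF Z(2) abs_ge_self])
    qed
  qed
  show ?thesis
  proof (cases "b \<le> c")
    case True
    then show ?thesis
      using increment_orthogonal[of c d "\<lambda>w. Z w * (W b w - W a w)"] before[of b] assms by simp
  next
    case False
    have same: "integrable P (\<lambda>w. Z w * (W b w - W c w) * (W d w - W c w)) \<and>
      expectation (\<lambda>w. Z w * (W b w - W c w) * (W d w - W c w)) = (min b d - c) * expectation Z"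
    proof (cases "b \<le> d")
      case True
      then show ?thesis using increment_product_same_start[of c b d Z] assms Zi False by simp
    next
      case F: False
      have "(\<lambda>w. Z w * (W b w - W c w) * (W d w - W c w)) = (\<lambda>w. Z w * (W d w - W c w) * (W b w - W c w))"
        by (auto simp: algebra_simps)
      then show ?thesis using increment_product_same_start[of c d b Z] assms Zi False F by simp
    qed
    have "(\<lambda>w. Z w * (W b w - W a w) * (W d w - W c w)) =
      (\<lambda>w. Z w * (W c w - W a w) * (W d w - W c w) + Z w * (W b w - W c w) * (W d w - W c w))"
      by (auto simp: algebra_simps)
    moreover have "max 0 (min b d - c) = min b d - c" using False assms by simp
    ultimately show ?thesis
      using same increment_orthogonal[of c d "\<lambda>w. Z w * (W c w - W a w)"] before[of c] assms by simp
  qed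
qed

text \<open>The inner product of the two coefficients is known at the later of the starting times,
  which is where the ordered case wants its scalar weight.\<close>

lemma increment_product:
  fixes \<xi> \<eta> :: "'w \<Rightarrow> 'h::{real_inner, second_countable_topology}"
  assumes ab: "0 \<le> a" "a \<le> b" "b \<le> T" and cd: "0 \<le> c" "c \<le> d" "d \<le> T"
    and \<xi>: "\<xi> \<in> borel_measurable (F a)" "\<And>w. w \<in> space P \<Longrightarrow> norm (\<xi> w) \<le> K"
    and \<eta>: "\<eta> \<in> borel_measurable (F c)" "\<And>w. w \<in> space P \<Longrightarrow> norm (\<eta> w) \<le> L"
  shows "integrable P (\<lambda>w. ((W b w - W a w) *\<^sub>R \<xi> w) \<bullet> ((W d w - W c w) *\<^sub>R \<eta> w))" (is ?i)
    "expectation (\<lambda>w. ((W b w - W a w) *\<^sub>R \<xi> w) \<bullet> ((W d w - W c w) *\<^sub>R \<eta> w)) =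
      max 0 (min b d - max a c) * expectation (\<lambda>w. \<xi> w \<bullet> \<eta> w)" (is ?e)
proof -
  have bd: "\<bar>\<xi> w \<bullet> \<eta> w\<bar> \<le> K * L" if "w \<in> space P" for w
  proof -
    have "0 \<le> K" using \<xi>(2)[OF that] norm_ge_zero order_trans by blast
    then have "norm (\<xi> w) * norm (\<eta> w) \<le> K * L" using \<xi>(2)[OF that] \<eta>(2)[OF that] by (intro mult_mono) auto
    then show ?thesis using Cauchy_Schwarz_ineq2 order_trans by blast
  qed
  have "?i \<and> ?e"
  proof (cases "a \<le> c")
    case True
    note \<eta>(1)[measurable]
    have [measurable]: "\<xi> \<in> borel_measurable (F c)"
      by (rule measurable_F_mono[of a c]) (use assms True in auto)
    have "(\<lambda>w. \<xi> w \<bullet> \<eta> w) \<in> borel_measurable (F c)" by measurable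
    from increment_product_ordered[of a b c d "\<lambda>w. \<xi> w \<bullet> \<eta> w" "K * L", OF _ _ _ _ _ _ this bd]
    show ?thesis using assms True by (simp add: mult.assoc mult.commute mult.left_commute max_absorb2)
  next
    case False
    note \<xi>(1)[measurable]
    have [measurable]: "\<eta> \<in> borel_measurable (F a)"
      by (rule measurable_F_mono[of c a]) (use assms False in auto)
    have "(\<lambda>w. \<xi> w \<bullet> \<eta> w) \<in> borel_measurable (F a)" by measurable
    from increment_product_ordered[of c d a b "\<lambda>w. \<xi> w \<bullet> \<eta> w" "K * L", OF _ _ _ _ _ _ this bd]
    show ?thesis using assms False
      by (simp add: mult.assoc mult.commute mult.left_commute max_absorb1 min.commute)
  qed
  then show ?i ?e by auto
qed

text \<open>On the product space the overlap length appears as the integral of two indicators,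
  matching the covariance of the increments pair by pair.\<close>

lemma time_prob_product:
  fixes Z :: "'w \<Rightarrow> real"
  assumes abcd: "0 \<le> a" "b \<le> t" "0 \<le> c" "d \<le> t"
    and Z: "Z \<in> borel_measurable P" "\<And>w. w \<in> space P \<Longrightarrow> \<bar>Z w\<bar> \<le> K"
  shows "integrable (time_prob P t) (\<lambda>(s, w). indicator {a<..b} s * indicator {c<..d} s * Z w)" (is ?i)
    "(LINT (s, w)|time_prob P t. indicator {a<..b} s * indicator {c<..d} s * Z w) =
       max 0 (min b d - max a c) * expectation Z" (is ?e)
proof -
  interpret t: pair_sigma_finite "restrict_space lborel {0..t}" P
    by (rule pair_sigma_finite_time) (rule prob_space_axioms)
  interpret tf: finite_measure "time_prob P t" by (rule finite_measure_time_prob) (rule prob_space_axioms)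
  note Z(1)[measurable] measurable_time_prob_fst[measurable] measurable_snd_time_prob[measurable]
  show i: ?i
  proof (rule tf.integrable_const_bound[of _ "\<bar>K\<bar>"])
    show "(\<lambda>(s, w). indicator {a<..b} s * indicator {c<..d} s * Z w) \<in> borel_measurable (time_prob P t)"
      unfolding case_prod_unfold by measurable
    show "AE z in time_prob P t. norm (case z of (s, w) \<Rightarrow> indicator {a<..b} s * indicator {c<..d} s * Z w) \<le> \<bar>K\<bar>"
      by (intro AE_I2) (auto simp: space_time_prob indicator_def intro: order_trans[OF Z(2) abs_ge_self])
  qed
  have "(LINT (s, w)|time_prob P t. indicator {a<..b} s * indicator {c<..d} s * Z w) =
      (LINT s|restrict_space lborel {0..t}. LINT w|P. indicator {a<..b} s * indicator {c<..d} s * Z w)"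
    using t.integral_fst[of "\<lambda>s w. indicator {a<..b} s * indicator {c<..d} s * Z w"] i
    unfolding time_prob_def by simp
  also have "\<dots> = (LINT s|lborel. indicator {max a c<..min b d} s * expectation Z)"
    unfolding integral_restrict_space[of "{0..t}" lborel, simplified]
    using abcd by (intro Bochner_Integration.integral_cong) (auto simp: indicator_def)
  also have "\<dots> = max 0 (min b d - max a c) * expectation Z"
    by (cases "max a c \<le> min b d") auto
  finally show ?e .
qed

text \<open>Both squared norms are expanded into double sums over pairs of list entries, and
  corresponding terms agree. Overlapping intervals are thus handled without a common
  refinement.\<close>

theorem elementary_isometry:
  fixes ps :: "(real \<times> real \<times> ('w \<Rightarrow> 'h::{real_inner, second_countable_topology})) list"
  assumes ps: "elementary F t ps" and t: "0 \<le> t" "t \<le> T"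
  shows "sq_integrable P (elem_integral W ps)"
    "sq_integrable (time_prob P t) (\<lambda>(s, w). elem_process ps s w)"
    "(LINT w|P. (norm (elem_integral W ps w))\<^sup>2) = (LINT (s, w)|time_prob P t. (norm (elem_process ps s w))\<^sup>2)"
proof -
  define n where "n = length ps"
  define a b \<xi> where "a i = fst (ps ! i)" and "b i = fst (snd (ps ! i))" and "\<xi> i = snd (snd (ps ! i))" for i
  have ab: "0 \<le> a i" "a i \<le> b i" "b i \<le> t" and m: "\<xi> i \<in> borel_measurable (F (a i))"
    and bdd: "bounded (\<xi> i ` space (F (a i)))" if "i < n" for i
    using ps nth_mem[of i ps] that
    unfolding elementary_def a_def b_def \<xi>_def n_def strongly_measurable_iff_borel_measurable
    by (auto simp: case_prod_unfold)
  have "\<exists>K. \<forall>w\<in>space P. norm (\<xi> i w) \<le> K" if "i < n" for i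
    using bdd[OF that] space_F[of "a i"] ab[OF that] t
    by (auto simp: bounded_iff)
  then obtain K where K: "\<And>i w. i < n \<Longrightarrow> w \<in> space P \<Longrightarrow> norm (\<xi> i w) \<le> K i" by metis
  have abT: "0 \<le> a i" "a i \<le> b i" "b i \<le> T" "a i \<le> T" if "i < n" for i using ab[OF that] t by auto
  have mP: "\<xi> i \<in> borel_measurable P" if "i < n" for i
    using measurable_F[OF _ _ m[OF that]] abT[OF that] by auto
  define f where "f i w = (W (b i) w - W (a i) w) *\<^sub>R \<xi> i w" for i w
  define g where "g i z = indicator {a i<..b i} (fst z) *\<^sub>R \<xi> i (snd z)" for i and z :: "real \<times> 'w"
  have I: "elem_integral W ps = (\<lambda>w. \<Sum>i<n. f i w)"
    unfolding elem_integral_def f_def a_def b_def \<xi>_def n_def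
    by (auto simp: sum_list_sum_nth case_prod_unfold atLeast0LessThan)
  have Pr: "(\<lambda>(s, w). elem_process ps s w) = (\<lambda>z. \<Sum>i<n. g i z)"
    unfolding elem_process_def g_def a_def b_def \<xi>_def n_def
    by (auto simp: sum_list_sum_nth case_prod_unfold atLeast0LessThan)
  have f_int: "integrable P (\<lambda>w. f i w \<bullet> f j w)"
    and f_eq: "expectation (\<lambda>w. f i w \<bullet> f j w) =
      max 0 (min (b i) (b j) - max (a i) (a j)) * expectation (\<lambda>w. \<xi> i w \<bullet> \<xi> j w)"
    if ij: "i < n" "j < n" for i j
    using increment_product[OF abT(1-3)[OF ij(1)] abT(1-3)[OF ij(2)] m[OF ij(1)] K[OF ij(1)] m[OF ij(2)] K[OF ij(2)]]
    unfolding f_def by auto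
  have g_int: "integrable (time_prob P t) (\<lambda>z. g i z \<bullet> g j z)"
    and g_eq: "(LINT z|time_prob P t. g i z \<bullet> g j z) =
      max 0 (min (b i) (b j) - max (a i) (a j)) * expectation (\<lambda>w. \<xi> i w \<bullet> \<xi> j w)"
    if ij: "i < n" "j < n" for i j
  proof -
    note mP[OF ij(1), measurable] mP[OF ij(2), measurable]
    have bd: "\<bar>\<xi> i w \<bullet> \<xi> j w\<bar> \<le> K i * K j" if "w \<in> space P" for w
    proof -
      have "0 \<le> K i" using K[OF ij(1) that] norm_ge_zero order_trans by blast
      then have "norm (\<xi> i w) * norm (\<xi> j w) \<le> K i * K j"
        using K[OF ij(1) that] K[OF ij(2) that] by (intro mult_mono) auto
      then show ?thesis using Cauchy_Schwarz_ineq2 order_trans by blast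
    qed
    have "(\<lambda>w. \<xi> i w \<bullet> \<xi> j w) \<in> borel_measurable P" by measurable
    note pr = time_prob_product[of "a i" "b i" t "a j" "b j", OF _ _ _ _ this bd]
    have eq: "(\<lambda>z. g i z \<bullet> g j z) =
       (\<lambda>(s, w). indicator {a i<..b i} s * indicator {a j<..b j} s * (\<xi> i w \<bullet> \<xi> j w))"
      unfolding g_def by (auto simp: case_prod_unfold)
    show "integrable (time_prob P t) (\<lambda>z. g i z \<bullet> g j z)"
      unfolding eq using ab[OF ij(1)] ab[OF ij(2)] by (intro pr(1)) auto
    show "(LINT z|time_prob P t. g i z \<bullet> g j z) =
      max 0 (min (b i) (b j) - max (a i) (a j)) * expectation (\<lambda>w. \<xi> i w \<bullet> \<xi> j w)"
      unfolding eq using ab[OF ij(1)] ab[OF ij(2)] by (intro pr(2)) auto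
  qed
  have normf: "(norm (\<Sum>i<n. f i w))\<^sup>2 = (\<Sum>i<n. \<Sum>j<n. f i w \<bullet> f j w)" for w
    unfolding power2_norm_eq_inner inner_sum_left inner_sum_right by (rule sum.swap)
  have normg: "(norm (\<Sum>i<n. g i z))\<^sup>2 = (\<Sum>i<n. \<Sum>j<n. g i z \<bullet> g j z)" for z
    unfolding power2_norm_eq_inner inner_sum_left inner_sum_right by (rule sum.swap)
  have fm: "f i \<in> borel_measurable P" if "i < n" for i
  proof -
    note mP[OF that, measurable]
    have [measurable]: "W (a i) \<in> borel_measurable P" "W (b i) \<in> borel_measurable P"
      by (rule W_measurable; use abT[OF that] in linarith)+
    show ?thesis unfolding f_def by measurable
  qed
  have gm: "g i \<in> borel_measurable (time_prob P t)" if "i < n" for i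
  proof -
    note mP[OF that, measurable] measurable_time_prob_fst[measurable] measurable_snd_time_prob[measurable]
    show ?thesis unfolding g_def by measurable
  qed
  show "sq_integrable P (elem_integral W ps)"
    unfolding sq_integrable_def strongly_measurable_iff_borel_measurable I normf
    using f_int fm by (auto intro!: borel_measurable_sum Bochner_Integration.integrable_sum)
  show "sq_integrable (time_prob P t) (\<lambda>(s, w). elem_process ps s w)"
    unfolding sq_integrable_def strongly_measurable_iff_borel_measurable Pr normg
    using g_int gm by (auto intro!: borel_measurable_sum Bochner_Integration.integrable_sum)
  have "(LINT w|P. (norm (elem_integral W ps w))\<^sup>2) = (LINT z|time_prob P t. (norm (\<Sum>i<n. g i z))\<^sup>2)"
  proof -
    have "expectation (\<lambda>w. \<Sum>i<n. \<Sum>j<n. f i w \<bullet> f j w) = (\<Sum>i<n. \<Sum>j<n. expectation (\<lambda>w. f i w \<bullet> f j w))"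
      by (subst Bochner_Integration.integral_sum; (intro sum.cong Bochner_Integration.integrable_sum refl)?;
          (subst Bochner_Integration.integral_sum)?) (auto intro: f_int)
    also have "\<dots> = (\<Sum>i<n. \<Sum>j<n. LINT z|time_prob P t. g i z \<bullet> g j z)"
      by (intro sum.cong refl) (simp add: f_eq g_eq)
    also have "\<dots> = (LINT z|time_prob P t. (\<Sum>i<n. \<Sum>j<n. g i z \<bullet> g j z))"
      by (subst Bochner_Integration.integral_sum; (intro sum.cong Bochner_Integration.integrable_sum refl)?;
          (subst Bochner_Integration.integral_sum)?) (auto intro: g_int)
    finally show ?thesis unfolding I normf normg .
  qed
  also have "\<dots> = (LINT (s, w)|time_prob P t. (norm (elem_process ps s w))\<^sup>2)"
    using Pr by (simp add: case_prod_unfold fun_eq_iff)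
  finally show "(LINT w|P. (norm (elem_integral W ps w))\<^sup>2) =
    (LINT (s, w)|time_prob P t. (norm (elem_process ps s w))\<^sup>2)" .
qed

end

section \<open>Bound and linearity of the Ito integral\<close>

lemma sq_integrable_norm_add_le:
  assumes "sq_integrable N f" "sq_integrable N g"
  shows "(\<integral>x. (norm (f x + g x))\<^sup>2 \<partial>N) \<le> 2 * (\<integral>x. (norm (f x))\<^sup>2 \<partial>N) + 2 * (\<integral>x. (norm (g x))\<^sup>2 \<partial>N)"
proof -
  have "(\<integral>x. (norm (f x + g x))\<^sup>2 \<partial>N) \<le> (\<integral>x. 2 * (norm (f x))\<^sup>2 + 2 * (norm (g x))\<^sup>2 \<partial>N)"
    using assms sq_integrable_add[OF assms]
    by (intro integral_mono norm_add_sq_le) (auto simp: sq_integrable_def)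
  also have "\<dots> = 2 * (\<integral>x. (norm (f x))\<^sup>2 \<partial>N) + 2 * (\<integral>x. (norm (g x))\<^sup>2 \<partial>N)"
    using assms by (simp add: sq_integrable_def)
  finally show ?thesis .
qed

lemma sq_integrable_lincomb_tendsto_0:
  assumes f: "\<And>n. sq_integrable N (f n)" and g: "\<And>n. sq_integrable N (g n)"
    and f0: "(\<lambda>n. \<integral>x. (norm (f n x))\<^sup>2 \<partial>N) \<longlonglongrightarrow> 0" and g0: "(\<lambda>n. \<integral>x. (norm (g n x))\<^sup>2 \<partial>N) \<longlonglongrightarrow> 0"
  shows "(\<lambda>n. \<integral>x. (norm (a *\<^sub>R f n x + c *\<^sub>R g n x))\<^sup>2 \<partial>N) \<longlonglongrightarrow> 0"
proof (rule tendsto_sandwich[OF _ _ tendsto_const])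
  show "eventually (\<lambda>n. 0 \<le> (\<integral>x. (norm (a *\<^sub>R f n x + c *\<^sub>R g n x))\<^sup>2 \<partial>N)) sequentially" by simp
  show "eventually (\<lambda>n. (\<integral>x. (norm (a *\<^sub>R f n x + c *\<^sub>R g n x))\<^sup>2 \<partial>N) \<le>
      2 * a\<^sup>2 * (\<integral>x. (norm (f n x))\<^sup>2 \<partial>N) + 2 * c\<^sup>2 * (\<integral>x. (norm (g n x))\<^sup>2 \<partial>N)) sequentially"
    using sq_integrable_norm_add_le[OF sq_integrable_scaleR[OF f] sq_integrable_scaleR[OF g], of a _ c]
    by (intro always_eventually allI) (simp add: power_mult_distrib mult.assoc)
  show "(\<lambda>n. 2 * a\<^sup>2 * (\<integral>x. (norm (f n x))\<^sup>2 \<partial>N) + 2 * c\<^sup>2 * (\<integral>x. (norm (g n x))\<^sup>2 \<partial>N)) \<longlonglongrightarrow> 0"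
    using tendsto_add[OF tendsto_mult_left[OF f0, of "2 * a\<^sup>2"] tendsto_mult_left[OF g0, of "2 * c\<^sup>2"]] by simp
qed

context brownian_filtration
begin

lemma L2F_sq_integrable: "f \<in> L2F P F t \<Longrightarrow> 0 \<le> t \<Longrightarrow> t \<le> T \<Longrightarrow> sq_integrable (time_prob P t) (\<lambda>(s, w). f s w)"
  using L2F_iff_sq_integrable[of P F t f] subalgebra_F[of t] by auto

text \<open>A Bochner integral of a non-integrable function is 0 by convention, so the two limits
  carry information only together with square integrability of the differences, supplied
  here.\<close>

lemma has_ito_integralE:
  fixes f :: "real \<Rightarrow> 'w \<Rightarrow> 'h::{real_inner, second_countable_topology}"
  assumes I: "has_ito_integral P F W t f I" and t: "0 \<le> t" "t \<le> T"
  obtains ps where "\<And>n::nat. elementary F t (ps n)"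
    "\<And>n. sq_integrable (time_prob P t) (\<lambda>(s, w). elem_process (ps n) s w - f s w)"
    "\<And>n. sq_integrable P (\<lambda>w. elem_integral W (ps n) w - I w)"
    "(\<lambda>n. LINT (s, w)|time_prob P t. (norm (elem_process (ps n) s w - f s w))\<^sup>2) \<longlonglongrightarrow> 0"
    "(\<lambda>n. LINT w|P. (norm (elem_integral W (ps n) w - I w))\<^sup>2) \<longlonglongrightarrow> 0"
proof -
  obtain ps where ps: "\<And>n::nat. elementary F t (ps n)"
    "(\<lambda>n. LINT (s, w)|time_prob P t. (norm (elem_process (ps n) s w - f s w))\<^sup>2) \<longlonglongrightarrow> 0"
    "(\<lambda>n. LINT w|P. (norm (elem_integral W (ps n) w - I w))\<^sup>2) \<longlonglongrightarrow> 0"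
    using I unfolding has_ito_integral_def by blast
  have f: "sq_integrable (time_prob P t) (\<lambda>(s, w). f s w)"
    using I t unfolding has_ito_integral_def by (auto intro: L2F_sq_integrable)
  have "sq_integrable P I" using I unfolding has_ito_integral_def sq_integrable_def by auto
  show thesis
  proof (rule that[OF ps(1) _ _ ps(2,3)])
    fix n
    show "sq_integrable (time_prob P t) (\<lambda>(s, w). elem_process (ps n) s w - f s w)"
      using sq_integrable_diff[OF elementary_isometry(2)[OF ps(1) t] f] by (simp add: case_prod_unfold)
    show "sq_integrable P (\<lambda>w. elem_integral W (ps n) w - I w)"
      by (rule sq_integrable_diff[OF elementary_isometry(1)[OF ps(1) t]]) fact
  qed
qed

text \<open>Comparison with elementary processes uses the inequality for squared sums twice, at a
  factor 2 each. In the limit the factor 4 stays, which is harmless for a bound.\<close>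

lemma ito_integral_bound:
  fixes f :: "real \<Rightarrow> 'w \<Rightarrow> 'h::{real_inner, second_countable_topology}"
  assumes I: "has_ito_integral P F W t f I" and t: "0 \<le> t" "t \<le> T"
  shows "(LINT w|P. (norm (I w))\<^sup>2) \<le> 4 * (LINT (s, w)|time_prob P t. (norm (f s w))\<^sup>2)"
proof -
  obtain ps where ps: "\<And>n::nat. elementary F t (ps n)"
    and p: "\<And>n. sq_integrable (time_prob P t) (\<lambda>(s, w). elem_process (ps n) s w - f s w)"
    and i: "\<And>n. sq_integrable P (\<lambda>w. elem_integral W (ps n) w - I w)"
    and p0: "(\<lambda>n. LINT (s, w)|time_prob P t. (norm (elem_process (ps n) s w - f s w))\<^sup>2) \<longlonglongrightarrow> 0"
    and i0: "(\<lambda>n. LINT w|P. (norm (elem_integral W (ps n) w - I w))\<^sup>2) \<longlonglongrightarrow> 0"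
    by (rule has_ito_integralE[OF I t]) (rule that)
  have f: "sq_integrable (time_prob P t) (\<lambda>(s, w). f s w)"
    using I t unfolding has_ito_integral_def by (auto intro: L2F_sq_integrable)
  let ?F = "LINT (s, w)|time_prob P t. (norm (f s w))\<^sup>2"
  let ?p = "\<lambda>n. LINT (s, w)|time_prob P t. (norm (elem_process (ps n) s w - f s w))\<^sup>2"
  let ?i = "\<lambda>n. LINT w|P. (norm (elem_integral W (ps n) w - I w))\<^sup>2"
  have le: "(LINT w|P. (norm (I w))\<^sup>2) \<le> 2 * ?i n + 4 * ?p n + 4 * ?F" for n
  proof -
    have "(LINT w|P. (norm (I w))\<^sup>2) \<le> 2 * (LINT w|P. (norm (elem_integral W (ps n) w))\<^sup>2) + 2 * ?i n"
      using sq_integrable_norm_add_le[OF elementary_isometry(1)[OF ps[of n] t] sq_integrable_scaleR[OF i[of n], of "-1"]]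
      by (simp add: algebra_simps norm_minus_commute)
    also have "(LINT w|P. (norm (elem_integral W (ps n) w))\<^sup>2) \<le> 2 * ?p n + 2 * ?F"
      using sq_integrable_norm_add_le[OF p[of n] f] unfolding elementary_isometry(3)[OF ps[of n] t]
      by (simp add: case_prod_unfold)
    finally show ?thesis by simp
  qed
  have "(\<lambda>n. 2 * ?i n + 4 * ?p n + 4 * ?F) \<longlonglongrightarrow> 2 * 0 + 4 * 0 + 4 * ?F"
    by (intro tendsto_intros p0 i0)
  then have "(\<lambda>n. 2 * ?i n + 4 * ?p n + 4 * ?F) \<longlonglongrightarrow> 4 * ?F" by simp
  then show ?thesis by (rule LIMSEQ_le_const) (use le in blast)
qed

text \<open>Scaled approximating lists are simply concatenated, which is legitimate because
  intervals in an elementary process may overlap.\<close>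

lemma has_ito_integral_lincomb:
  fixes f g :: "real \<Rightarrow> 'w \<Rightarrow> 'h::{real_inner, second_countable_topology}"
  assumes f: "has_ito_integral P F W t f I" and g: "has_ito_integral P F W t g J" and t: "0 \<le> t" "t \<le> T"
  shows "has_ito_integral P F W t (\<lambda>s w. a *\<^sub>R f s w + c *\<^sub>R g s w) (\<lambda>w. a *\<^sub>R I w + c *\<^sub>R J w)"
proof -
  obtain ps where ps: "\<And>n::nat. elementary F t (ps n)"
    and p: "\<And>n. sq_integrable (time_prob P t) (\<lambda>(s, w). elem_process (ps n) s w - f s w)"
    and i: "\<And>n. sq_integrable P (\<lambda>w. elem_integral W (ps n) w - I w)"
    and p0: "(\<lambda>n. LINT (s, w)|time_prob P t. (norm (elem_process (ps n) s w - f s w))\<^sup>2) \<longlonglongrightarrow> 0"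
    and i0: "(\<lambda>n. LINT w|P. (norm (elem_integral W (ps n) w - I w))\<^sup>2) \<longlonglongrightarrow> 0"
    by (rule has_ito_integralE[OF f t]) (rule that)
  obtain qs where qs: "\<And>n::nat. elementary F t (qs n)"
    and q: "\<And>n. sq_integrable (time_prob P t) (\<lambda>(s, w). elem_process (qs n) s w - g s w)"
    and j: "\<And>n. sq_integrable P (\<lambda>w. elem_integral W (qs n) w - J w)"
    and q0: "(\<lambda>n. LINT (s, w)|time_prob P t. (norm (elem_process (qs n) s w - g s w))\<^sup>2) \<longlonglongrightarrow> 0"
    and j0: "(\<lambda>n. LINT w|P. (norm (elem_integral W (qs n) w - J w))\<^sup>2) \<longlonglongrightarrow> 0"
    by (rule has_ito_integralE[OF g t]) (rule that)
  define sc where "sc k = map (\<lambda>(x, y, \<xi>). (x :: real, y :: real, \<lambda>w :: 'w. k *\<^sub>R (\<xi> w :: 'h)))" for k :: real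
  have sc_process: "elem_process (sc k xs) s w = k *\<^sub>R elem_process xs s w" for k xs s w
    unfolding elem_process_def sc_def by (induction xs) (auto simp: algebra_simps)
  have sc_integral: "elem_integral W (sc k xs) w = k *\<^sub>R elem_integral W xs w" for k xs w
    unfolding elem_integral_def sc_def by (induction xs) (auto simp: algebra_simps)
  have sc_el: "elementary F t (sc k xs)" if "elementary F t xs" for k xs
    unfolding elementary_def sc_def
  proof (clarsimp)
    fix x y \<xi> assume "(x, y, \<xi>) \<in> set xs"
    then have *: "0 \<le> x" "x \<le> y" "y \<le> t" "strongly_measurable (F x) \<xi>" "bounded (\<xi> ` space (F x))"
      using that unfolding elementary_def by auto
    moreover have "bounded ((\<lambda>w. k *\<^sub>R \<xi> w) ` space (F x))"
      using bounded_scaling[OF *(5), of k] by (simp add: image_image)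
    ultimately show "0 \<le> x \<and> x \<le> y \<and> y \<le> t \<and> strongly_measurable (F x) (\<lambda>w. k *\<^sub>R \<xi> w) \<and>
        bounded ((\<lambda>w. k *\<^sub>R \<xi> w) ` space (F x))"
      by (auto intro!: strongly_measurable_scaleR strongly_measurable_const)
  qed
  define rs where "rs n = sc a (ps n) @ sc c (qs n)" for n
  have rs_el: "elementary F t (rs n)" for n
    using sc_el[OF ps[of n], of a] sc_el[OF qs[of n], of c] unfolding rs_def elementary_def by auto
  have rs_process: "elem_process (rs n) s w = a *\<^sub>R elem_process (ps n) s w + c *\<^sub>R elem_process (qs n) s w" for n s w
    unfolding rs_def sc_process[symmetric] by (simp add: elem_process_def)
  have rs_integral: "elem_integral W (rs n) w = a *\<^sub>R elem_integral W (ps n) w + c *\<^sub>R elem_integral W (qs n) w" for n w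
    unfolding rs_def sc_integral[symmetric] by (simp add: elem_integral_def)
  have fg: "f \<in> L2F P F t" "g \<in> L2F P F t" "sq_integrable P I" "sq_integrable P J"
    using f g unfolding has_ito_integral_def sq_integrable_def by auto
  have "(\<lambda>s w. a *\<^sub>R f s w + c *\<^sub>R g s w) \<in> L2F P F t"
    using t fg by (intro L2F_lincomb subalgebra_F)
  moreover have "sq_integrable P (\<lambda>w. a *\<^sub>R I w + c *\<^sub>R J w)"
    by (rule sq_integrable_lincomb) (use fg in auto)
  moreover have "(\<lambda>n. LINT (s, w)|time_prob P t.
      (norm (elem_process (rs n) s w - (a *\<^sub>R f s w + c *\<^sub>R g s w)))\<^sup>2) \<longlonglongrightarrow> 0"
    using sq_integrable_lincomb_tendsto_0[OF p q, where a=a and c=c] p0 q0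
    by (simp add: rs_process case_prod_unfold algebra_simps)
  moreover have "(\<lambda>n. LINT w|P. (norm (elem_integral W (rs n) w - (a *\<^sub>R I w + c *\<^sub>R J w)))\<^sup>2) \<longlonglongrightarrow> 0"
    using sq_integrable_lincomb_tendsto_0[OF i j i0 j0, where a=a and c=c]
    by (simp add: rs_integral algebra_simps)
  ultimately show ?thesis unfolding has_ito_integral_def sq_integrable_def using rs_el by blast
qed

end

text \<open>In the supremum norm with weight exp(- \<gamma> t) the integral term has norm at most c
  / \<gamma>, hence at most one half. The bound \<open>b\<close> makes that supremum finite, so that
  half of it can be absorbed; it leaves no trace in the conclusion.\<close>

lemma Gronwall_nn_integral:
  fixes a :: "real \<Rightarrow> ennreal" and c d b T :: real
  assumes nn: "0 \<le> c" "0 \<le> d" and T: "0 \<le> T"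
    and bd: "\<And>t. t \<in> {0..T} \<Longrightarrow> a t \<le> ennreal b"
    and le: "\<And>t. t \<in> {0..T} \<Longrightarrow> a t \<le> ennreal d + ennreal c * (\<integral>\<^sup>+s. a s * indicator {0..t} s \<partial>lborel)"
    and t: "t \<in> {0..T}"
  shows "a t \<le> ennreal (2 * exp ((2 * c + 1) * T) * d)"
proof -
  \<comment> \<open>The summand 2 c yields the factor one half, and 1 keeps \<gamma> positive when c
    = 0.\<close>
  define \<gamma> where "\<gamma> = 2 * c + 1"
  have \<gamma>: "\<gamma> > 0" "2 * c \<le> \<gamma>" using nn unfolding \<gamma>_def by auto
  define r where "r s = enn2real (a s)" for s
  have a_r: "a s = ennreal (r s)" if "s \<in> {0..T}" for s
  proof -
    have "a s < top" using bd[OF that] by (rule order_le_less_trans) simp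
    then show ?thesis unfolding r_def by simp
  qed
  have r0: "0 \<le> r s" for s unfolding r_def by simp
  have rb: "r s \<le> max 0 b" if "s \<in> {0..T}" for s
  proof -
    have "ennreal (r s) \<le> ennreal b" using bd[OF that] a_r[OF that] by simp
    then show ?thesis by (auto simp: ennreal_le_iff2)
  qed
  \<comment> \<open>With \<open>\<gamma> \<ge> 2c\<close> the weighted supremum satisfies \<open>m \<le> d + m / 2\<close>.\<close>
  define m where "m = (SUP s\<in>{0..T}. r s * exp (- \<gamma> * s))"
  have bdd: "bdd_above ((\<lambda>s. r s * exp (- \<gamma> * s)) ` {0..T})"
  proof (intro bdd_aboveI2)
    fix s assume s: "s \<in> {0..T}"
    have "r s * exp (- \<gamma> * s) \<le> max 0 b * 1" using rb[OF s] r0 s \<gamma> by (intro mult_mono) auto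
    then show "r s * exp (- \<gamma> * s) \<le> max 0 b" by simp
  qed
  have r_m: "r s \<le> m * exp (\<gamma> * s)" if "s \<in> {0..T}" for s
  proof -
    have "r s * exp (- \<gamma> * s) \<le> m" unfolding m_def using that bdd by (rule cSUP_upper)
    then have "r s * exp (- \<gamma> * s) * exp (\<gamma> * s) \<le> m * exp (\<gamma> * s)" by (intro mult_right_mono) auto
    then show ?thesis by (simp add: mult.assoc flip: exp_add)
  qed
  have m0: "0 \<le> m" using r_m[of 0] r0[of 0] T by simp
  have step: "r s * exp (- \<gamma> * s) \<le> d + m / 2" if s: "s \<in> {0..T}" for s
  proof -
    have "(\<integral>\<^sup>+x. a x * indicator {0..s} x \<partial>lborel) \<le> (\<integral>\<^sup>+x. ennreal (m * exp (\<gamma> * x)) * indicator {0..s} x \<partial>lborel)"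
      using s r_m by (intro nn_integral_mono) (auto simp: indicator_def a_r intro!: ennreal_leI)
    also have "\<dots> = ennreal (m / \<gamma> * exp (\<gamma> * s) - m / \<gamma> * exp (\<gamma> * 0))"
    proof (rule nn_integral_FTC_Icc)
      show "((\<lambda>x. m / \<gamma> * exp (\<gamma> * x)) has_real_derivative m * exp (\<gamma> * x)) (at x)" for x
        using \<gamma> by (auto intro!: derivative_eq_intros)
    qed (use m0 s in auto)
    also have "\<dots> \<le> ennreal (m / \<gamma> * exp (\<gamma> * s))" using m0 \<gamma> by (intro ennreal_leI) auto
    finally have "a s \<le> ennreal d + ennreal c * ennreal (m / \<gamma> * exp (\<gamma> * s))"
      by (intro order_trans[OF le[OF s]] add_left_mono mult_left_mono) auto
    also have "\<dots> = ennreal (d + c * (m / \<gamma> * exp (\<gamma> * s)))"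
      using nn m0 \<gamma> by (simp flip: ennreal_plus ennreal_mult)
    finally have "ennreal (r s) \<le> ennreal (d + c * (m / \<gamma> * exp (\<gamma> * s)))" unfolding a_r[OF s] .
    then have "r s \<le> d + c * (m / \<gamma> * exp (\<gamma> * s))"
      by (rule ennreal_le_iff[THEN iffD1, rotated]) (use nn m0 \<gamma> in simp)
    also have "\<dots> = d + (c / \<gamma>) * (m * exp (\<gamma> * s))" by simp
    also have "\<dots> \<le> d * exp (\<gamma> * s) + (1/2) * (m * exp (\<gamma> * s))"
    proof (intro add_mono mult_right_mono)
      have "d * 1 \<le> d * exp (\<gamma> * s)" using nn s \<gamma> by (intro mult_left_mono) auto
      then show "d \<le> d * exp (\<gamma> * s)" by simp
    qed (use nn m0 \<gamma> in \<open>auto simp: field_simps\<close>)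
    finally have "r s \<le> (d + m / 2) * exp (\<gamma> * s)" by (simp add: algebra_simps)
    then have "r s * exp (- \<gamma> * s) \<le> (d + m / 2) * exp (\<gamma> * s) * exp (- \<gamma> * s)" by (intro mult_right_mono) auto
    then show ?thesis by (simp add: mult.assoc flip: exp_add)
  qed
  have "m \<le> d + m / 2" unfolding m_def[symmetric]
    using cSUP_least[of "{0..T}" "\<lambda>s. r s * exp (- \<gamma> * s)", OF _ step] T unfolding m_def by auto
  then have "m \<le> 2 * d" by simp
  have "r t \<le> m * exp (\<gamma> * t)" by (rule r_m[OF t])
  also have "\<dots> \<le> (2 * d) * exp (\<gamma> * T)" using \<open>m \<le> 2 * d\<close> nn t \<gamma> by (intro mult_mono) auto
  finally show ?thesis unfolding a_r[OF t] \<gamma>_def by (intro ennreal_leI) (simp add: algebra_simps)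
qed

section \<open>The state equation\<close>

abbreviation nn_sq :: "'a measure \<Rightarrow> ('a \<Rightarrow> 'x::real_normed_vector) \<Rightarrow> ennreal" where
  "nn_sq N f \<equiv> \<integral>\<^sup>+x. ennreal ((norm (f x))\<^sup>2) \<partial>N"

lemma power_mono_ennreal_norm: "norm x \<le> K * norm y \<Longrightarrow> ennreal ((norm x)\<^sup>2) \<le> ennreal (K\<^sup>2) * ennreal ((norm y)\<^sup>2)"
  by (auto simp: power_mono simp flip: ennreal_mult power_mult_distrib intro!: ennreal_leI)

lemma nn_sq_add_le:
  assumes "strongly_measurable N f" "strongly_measurable N g"
  shows "nn_sq N (\<lambda>x. f x + g x) \<le> 2 * nn_sq N f + 2 * nn_sq N g"
proof -
  note strongly_measurable_norm[OF assms(1), measurable] strongly_measurable_norm[OF assms(2), measurable]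
  have "nn_sq N (\<lambda>x. f x + g x) \<le> (\<integral>\<^sup>+x. 2 * ennreal ((norm (f x))\<^sup>2) + 2 * ennreal ((norm (g x))\<^sup>2) \<partial>N)"
  proof (rule nn_integral_mono)
    fix x
    have "ennreal ((norm (f x + g x))\<^sup>2) \<le> ennreal (2 * (norm (f x))\<^sup>2 + 2 * (norm (g x))\<^sup>2)"
      by (intro ennreal_leI norm_add_sq_le)
    then show "ennreal ((norm (f x + g x))\<^sup>2) \<le> 2 * ennreal ((norm (f x))\<^sup>2) + 2 * ennreal ((norm (g x))\<^sup>2)"
      by (simp add: ennreal_mult)
  qed
  also have "\<dots> = 2 * nn_sq N f + 2 * nn_sq N g"
    by (simp add: nn_integral_add nn_integral_cmult)
  finally show ?thesis .
qed

lemma sq_integrable_time_prob_mono: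
  assumes "prob_space P" "sq_integrable (time_prob P T) f" "t \<le> T"
  shows "sq_integrable (time_prob P t) f"
proof -
  have sm: "strongly_measurable (time_prob P T) f" using assms unfolding sq_integrable_def by auto
  have "strongly_measurable (time_prob P t) f"
    using strongly_measurable_compose[OF sm measurable_time_prob_mono[OF assms(3) measurable_ident_sets[OF refl]]] .
  moreover have "nn_sq (time_prob P t) f \<le> nn_sq (time_prob P T) f"
    using strongly_measurable_norm[OF sm] assms by (intro nn_integral_time_prob_mono) auto
  ultimately show ?thesis using assms unfolding sq_integrable_iff_nn_integral by (auto intro: order_le_less_trans)
qed

context brownian_filtration
begin

lemma L2F_sq_integrable_upto:
  assumes "f \<in> L2F P F T" "0 \<le> t" "t \<le> T"
  shows "sq_integrable (time_prob P t) (\<lambda>(s, w). f s w)"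
  using T_pos by (intro sq_integrable_time_prob_mono[OF prob_space_axioms L2F_sq_integrable[OF assms(1)] assms(3)]) auto

text \<open>The square of \<open>X\<close> is kept up to time t, in the form Gronwall's inequality
  can absorb. The control is a datum and may be measured over the whole interval. The constant
  depends on the coefficients alone.\<close>

lemma LinfF_sum_bound:
  fixes a :: "real \<Rightarrow> 'w \<Rightarrow> 'h::{real_normed_vector} \<Rightarrow>\<^sub>L 'k::real_normed_vector"
    and b :: "real \<Rightarrow> 'w \<Rightarrow> 'u::{real_normed_vector} \<Rightarrow>\<^sub>L 'k"
  assumes a: "a \<in> LinfF P F T" and b: "b \<in> LinfF P F T"
  shows "\<exists>k\<ge>0. \<forall>X\<in>L2F P F T. \<forall>u\<in>L2F P F T. \<forall>t\<in>{0..T}.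
    nn_sq (time_prob P t) (\<lambda>(s, w). blinfun_apply (a s w) (X s w) + blinfun_apply (b s w) (u s w)) \<le>
    ennreal k * (nn_sq (time_prob P t) (\<lambda>(s, w). X s w) + nn_sq (time_prob P T) (\<lambda>(s, w). u s w))"
proof -
  obtain K L where K: "AE (s, w) in time_prob P T. norm (a s w) \<le> K"
    and L: "AE (s, w) in time_prob P T. norm (b s w) \<le> L"
    using a b unfolding LinfF_def by blast
  define k where "k = 2 * K\<^sup>2 + 2 * L\<^sup>2"
  have "nn_sq (time_prob P t) (\<lambda>(s, w). blinfun_apply (a s w) (X s w) + blinfun_apply (b s w) (u s w)) \<le>
    ennreal k * (nn_sq (time_prob P t) (\<lambda>(s, w). X s w) + nn_sq (time_prob P T) (\<lambda>(s, w). u s w))"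
    if X: "X \<in> L2F P F T" and u: "u \<in> L2F P F T" and t: "t \<in> {0..T}" for X u t
  proof -
    have sX: "sq_integrable (time_prob P t) (\<lambda>(s, w). X s w)" and su: "sq_integrable (time_prob P t) (\<lambda>(s, w). u s w)"
      and suT: "sq_integrable (time_prob P T) (\<lambda>(s, w). u s w)"
      using L2F_sq_integrable_upto[of X t] L2F_sq_integrable_upto[of u t] L2F_sq_integrable_upto[of u T] X u t T_pos
      by auto
    have [measurable]: "(\<lambda>z. norm (case z of (s, w) \<Rightarrow> X s w)) \<in> borel_measurable (time_prob P t)"
      "(\<lambda>z. norm (case z of (s, w) \<Rightarrow> u s w)) \<in> borel_measurable (time_prob P t)"
      "(\<lambda>z. norm (case z of (s, w) \<Rightarrow> u s w)) \<in> borel_measurable (time_prob P T)"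
      using sX su suT unfolding sq_integrable_def by (auto intro: strongly_measurable_norm)
    have tT: "t \<le> T" using t by simp
    have "nn_sq (time_prob P t) (\<lambda>(s, w). blinfun_apply (a s w) (X s w) + blinfun_apply (b s w) (u s w)) \<le>
      (\<integral>\<^sup>+z. ennreal k * (ennreal ((norm (case z of (s, w) \<Rightarrow> X s w))\<^sup>2) +
         ennreal ((norm (case z of (s, w) \<Rightarrow> u s w))\<^sup>2)) \<partial>time_prob P t)"
    proof (rule nn_integral_mono_AE,
        use AE_time_prob_mono[OF prob_space_axioms K tT] AE_time_prob_mono[OF prob_space_axioms L tT] in eventually_elim)
      case (elim z)
      obtain s w where z: "z = (s, w)" by force
      let ?x = "blinfun_apply (a s w) (X s w)" and ?y = "blinfun_apply (b s w) (u s w)"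
      have "norm ?x \<le> K * norm (X s w)" "norm ?y \<le> L * norm (u s w)"
        using elim z by (auto intro!: order_trans[OF norm_blinfun mult_right_mono])
      then have "(norm ?x)\<^sup>2 \<le> K\<^sup>2 * (norm (X s w))\<^sup>2" "(norm ?y)\<^sup>2 \<le> L\<^sup>2 * (norm (u s w))\<^sup>2"
        by (auto simp: power_mono simp flip: power_mult_distrib)
      then have "2 * (norm ?x)\<^sup>2 + 2 * (norm ?y)\<^sup>2 \<le> 2 * (K\<^sup>2 * (norm (X s w))\<^sup>2) + 2 * (L\<^sup>2 * (norm (u s w))\<^sup>2)"
        by (intro add_mono mult_left_mono) auto
      also have "\<dots> \<le> k * ((norm (X s w))\<^sup>2 + (norm (u s w))\<^sup>2)"
        unfolding k_def by (simp add: algebra_simps)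
      finally have "(norm (?x + ?y))\<^sup>2 \<le> k * ((norm (X s w))\<^sup>2 + (norm (u s w))\<^sup>2)"
        by (rule order_trans[OF norm_add_sq_le])
      then have "ennreal ((norm (?x + ?y))\<^sup>2) \<le> ennreal (k * ((norm (X s w))\<^sup>2 + (norm (u s w))\<^sup>2))"
        by (rule ennreal_leI)
      then show ?case unfolding z by (simp add: ennreal_mult k_def)
    qed
    also have "\<dots> = ennreal k * (nn_sq (time_prob P t) (\<lambda>(s, w). X s w) + nn_sq (time_prob P t) (\<lambda>(s, w). u s w))"
      by (simp add: nn_integral_cmult nn_integral_add)
    also have "\<dots> \<le> ennreal k * (nn_sq (time_prob P t) (\<lambda>(s, w). X s w) + nn_sq (time_prob P T) (\<lambda>(s, w). u s w))"
      using tT by (intro mult_left_mono add_left_mono nn_integral_time_prob_mono[OF prob_space_axioms]) auto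
    finally show ?thesis .
  qed
  moreover have "0 \<le> k" unfolding k_def by simp
  ultimately show ?thesis by blast
qed

end

section \<open>Convolutions with the semigroup\<close>

locale state_equation = brownian_filtration P F T W
  for P :: "'w measure" and F T W +
  fixes S :: "real \<Rightarrow> 'h::{real_inner, banach, second_countable_topology} \<Rightarrow>\<^sub>L 'h"
    and A1 C :: "real \<Rightarrow> 'w \<Rightarrow> 'h \<Rightarrow>\<^sub>L 'h"
    and B D :: "real \<Rightarrow> 'w \<Rightarrow> 'u::{real_inner, banach} \<Rightarrow>\<^sub>L 'h"
  assumes semigroup: "C0_semigroup S"
    and coefficients: "A1 \<in> LinfF P F T" "C \<in> LinfF P F T" "B \<in> LinfF P F T" "D \<in> LinfF P F T"
begin

abbreviation "mild \<equiv> mild_solution P F T W S A1 B C D"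

lemma L2F_sum:
  assumes "a \<in> LinfF P F T" "b \<in> LinfF P F T" "X \<in> L2F P F T" "u \<in> L2F P F T"
  shows "(\<lambda>s w. blinfun_apply (a s w) (X s w) + blinfun_apply (b s w) (u s w)) \<in> L2F P F T"
proof -
  have T: "subalgebra P (F T)" "0 \<le> T" using subalgebra_F T_pos by auto
  from L2F_lincomb[OF T L2F_blinfun_apply[OF T assms(1,3)] L2F_blinfun_apply[OF T assms(2,4)], of 1 1]
  show ?thesis by simp
qed

lemma convolution_measurable:
  assumes g: "g \<in> L2F P F T" and t: "0 \<le> t" "t \<le> T"
  shows "(\<lambda>(s, w). blinfun_apply (S (t - s)) (g s w)) \<in> borel_measurable (time_prob P t)"
proof -
  have g: "(\<lambda>z. g (fst z) (snd z)) \<in> borel_measurable (time_prob P t)"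
    using L2F_sq_integrable_upto[OF g t]
    unfolding sq_integrable_def strongly_measurable_iff_borel_measurable by (simp add: case_prod_unfold)
  have "(\<lambda>z. t - fst z) \<in> borel_measurable (time_prob P t)"
    using measurable_time_prob_fst[measurable] by measurable
  from C0_semigroup_measurable[OF semigroup this _ g, of t]
  show ?thesis by (auto simp: case_prod_unfold space_time_prob)
qed

lemma convolution_nn_sq:
  assumes K: "\<And>s. s \<in> {0..T} \<Longrightarrow> norm (S s) \<le> K" and g: "g \<in> L2F P F T" and t: "0 \<le> t" "t \<le> T"
  shows "nn_sq (time_prob P t) (\<lambda>(s, w). blinfun_apply (S (t - s)) (g s w)) \<le>
    ennreal (K\<^sup>2) * nn_sq (time_prob P t) (\<lambda>(s, w). g s w)"
proof -
  have [measurable]: "(\<lambda>z. norm (case z of (s, w) \<Rightarrow> g s w)) \<in> borel_measurable (time_prob P t)"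
    using L2F_sq_integrable_upto[OF g t] unfolding sq_integrable_def by (auto intro: strongly_measurable_norm)
  have "nn_sq (time_prob P t) (\<lambda>(s, w). blinfun_apply (S (t - s)) (g s w)) \<le>
    (\<integral>\<^sup>+z. ennreal (K\<^sup>2) * ennreal ((norm (case z of (s, w) \<Rightarrow> g s w))\<^sup>2) \<partial>time_prob P t)"
  proof (rule nn_integral_mono)
    fix z assume "z \<in> space (time_prob P t)"
    then obtain s w where z: "z = (s, w)" "0 \<le> s" "s \<le> t" by (auto simp: space_time_prob)
    have "norm (blinfun_apply (S (t - s)) (g s w)) \<le> K * norm (g s w)"
      using K[of "t - s"] z t by (intro order_trans[OF norm_blinfun mult_right_mono]) auto
    from power_mono_ennreal_norm[OF this]
    show "ennreal ((norm (case z of (s, w) \<Rightarrow> blinfun_apply (S (t - s)) (g s w)))\<^sup>2)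
         \<le> ennreal (K\<^sup>2) * ennreal ((norm (case z of (s, w) \<Rightarrow> g s w))\<^sup>2)"
      unfolding z(1) by simp
  qed
  also have "\<dots> = ennreal (K\<^sup>2) * nn_sq (time_prob P t) (\<lambda>(s, w). g s w)"
    by (rule nn_integral_cmult) measurable
  finally show ?thesis .
qed

text \<open>Additivity of the drift integral in the mild equation needs integrable paths. Square
  integrability on a finite measure space gives integrability, by x \<le> 1 + x^2, and Fubini gives
  it for almost every path.\<close>

lemma convolution_AE_integrable:
  assumes g: "g \<in> L2F P F T" and t: "0 \<le> t" "t \<le> T"
  shows "AE w in P. set_integrable lborel {0..t} (\<lambda>s. blinfun_apply (S (t - s)) (g s w))"
proof -
  interpret t: pair_sigma_finite "restrict_space lborel {0..t}" P
    by (rule pair_sigma_finite_time) (rule prob_space_axioms)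
  interpret tf: finite_measure "time_prob P t" by (rule finite_measure_time_prob) (rule prob_space_axioms)
  obtain K where K: "\<And>s. s \<in> {0..T} \<Longrightarrow> norm (S s) \<le> K" using C0_semigroup_bounded[OF semigroup] by blast
  let ?f = "\<lambda>(s, w). blinfun_apply (S (t - s)) (g s w)"
  have "nn_sq (time_prob P t) ?f < \<infinity>"
    using convolution_nn_sq[OF K g t] L2F_sq_integrable_upto[OF g t]
    unfolding sq_integrable_iff_nn_integral by (auto intro: order_le_less_trans simp: ennreal_mult_less_top)
  then have sq: "sq_integrable (time_prob P t) ?f"
    unfolding sq_integrable_iff_nn_integral strongly_measurable_iff_borel_measurable
    using convolution_measurable[OF g t] by simp
  have "integrable (time_prob P t) ?f"
  proof (rule Bochner_Integration.integrable_bound)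
    show "integrable (time_prob P t) (\<lambda>z. 1 + (norm (?f z))\<^sup>2)" using sq unfolding sq_integrable_def by auto
    show "?f \<in> borel_measurable (time_prob P t)" by (rule convolution_measurable[OF g t])
    have "x \<le> 1 + x\<^sup>2" if "0 \<le> x" for x :: real
      using sum_squares_bound[of 1 x] that by simp
    then show "AE z in time_prob P t. norm (?f z) \<le> norm (1 + (norm (?f z))\<^sup>2)"
      by (intro AE_I2) (simp add: abs_of_nonneg)
  qed
  from t.AE_integrable_snd[of "\<lambda>s w. blinfun_apply (S (t - s)) (g s w)"] this
  show ?thesis
    unfolding time_prob_def set_integrable_def by (simp add: integrable_restrict_space)
qed

text \<open>Cauchy-Schwarz in time on each path costs the length of the interval, and Tonelli turns
  the remaining double integral into one over the product space.\<close>

lemma convolution_integral_nn_sq: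
  assumes K: "\<And>s. s \<in> {0..T} \<Longrightarrow> norm (S s) \<le> K" and g: "g \<in> L2F P F T" and t: "0 \<le> t" "t \<le> T"
  shows "nn_sq P (\<lambda>w. LINT s:{0..t}|lborel. blinfun_apply (S (t - s)) (g s w)) \<le>
    ennreal (T * K\<^sup>2) * nn_sq (time_prob P t) (\<lambda>(s, w). g s w)"
proof -
  let ?t = "restrict_space lborel {0..t}"
  let ?f = "\<lambda>s w. blinfun_apply (S (t - s)) (g s w)"
  have m: "(\<lambda>(s, w). ?f s w) \<in> borel_measurable (?t \<Otimes>\<^sub>M P)"
    using convolution_measurable[OF g t] unfolding time_prob_def .
  have "nn_sq P (\<lambda>w. LINT s:{0..t}|lborel. ?f s w) \<le>
     (\<integral>\<^sup>+w. (\<integral>\<^sup>+s. ennreal T * ennreal ((norm (case (s, w) of (s, w) \<Rightarrow> ?f s w))\<^sup>2) * indicator {0..t} s \<partial>lborel) \<partial>P)"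
  proof (rule nn_integral_mono)
    fix w assume w: "w \<in> space P"
    have mw[measurable]: "(\<lambda>s. ?f s w) \<in> borel_measurable ?t"
      using measurable_compose[OF measurable_Pair2'[OF w] m] by simp
    have "ennreal (norm (LINT s:{0..t}|lborel. ?f s w)) \<le> (\<integral>\<^sup>+s. ennreal (norm (?f s w)) \<partial>?t)"
    proof -
      have "(LINT s:{0..t}|lborel. ?f s w) = (LINT s|?t. ?f s w)"
        by (simp add: set_lebesgue_integral_def integral_restrict_space)
      \<comment> \<open>A path that is not integrable has integral 0, so the inequality holds on
        every path.\<close>
      moreover have "ennreal (norm (LINT s|?t. ?f s w)) \<le> (\<integral>\<^sup>+s. ennreal (norm (?f s w)) \<partial>?t)"
        by (cases "integrable ?t (\<lambda>s. ?f s w)")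
          (auto simp: integral_norm_bound_ennreal not_integrable_integral_eq)
      ultimately show ?thesis by simp
    qed
    \<comment> \<open>The factor 1 is written out as the second function for the Cauchy-Schwarz
      inequality; its square integrates to t.\<close>
    then have "ennreal ((norm (LINT s:{0..t}|lborel. ?f s w))\<^sup>2) \<le> (\<integral>\<^sup>+s. 1 * ennreal (norm (?f s w)) \<partial>?t)\<^sup>2"
      by (simp add: power_mono flip: ennreal_power)
    also have "\<dots> \<le> (\<integral>\<^sup>+s. 1\<^sup>2 \<partial>?t) * (\<integral>\<^sup>+s. (ennreal (norm (?f s w)))\<^sup>2 \<partial>?t)"
      by (rule Cauchy_Schwarz_nn_integral) measurable
    also have "(\<integral>\<^sup>+s. 1\<^sup>2 \<partial>?t) \<le> ennreal T"
      using t by (simp add: emeasure_restrict_space space_restrict_space ennreal_leI)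
    also have "ennreal T * (\<integral>\<^sup>+s. (ennreal (norm (?f s w)))\<^sup>2 \<partial>?t) =
        (\<integral>\<^sup>+s. ennreal T * (ennreal (norm (?f s w)))\<^sup>2 \<partial>?t)"
      by (rule nn_integral_cmult[symmetric]) measurable
    also have "\<dots> = (\<integral>\<^sup>+s. ennreal T * ennreal ((norm (case (s, w) of (s, w) \<Rightarrow> ?f s w))\<^sup>2) * indicator {0..t} s \<partial>lborel)"
      by (simp add: nn_integral_restrict_space ennreal_power)
    finally show "ennreal ((norm (LINT s:{0..t}|lborel. ?f s w))\<^sup>2) \<le>
      (\<integral>\<^sup>+s. ennreal T * ennreal ((norm (case (s, w) of (s, w) \<Rightarrow> ?f s w))\<^sup>2) * indicator {0..t} s \<partial>lborel)"
      by (simp add: mult_right_mono)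
  qed
  also have "\<dots> = (\<integral>\<^sup>+z. ennreal T * ennreal ((norm (case z of (s, w) \<Rightarrow> ?f s w))\<^sup>2) \<partial>time_prob P t)"
  proof (rule nn_integral_time_prob_snd[symmetric])
    note convolution_measurable[OF g t, measurable]
    show "(\<lambda>z. ennreal T * ennreal ((norm (case z of (s, w) \<Rightarrow> ?f s w))\<^sup>2)) \<in> borel_measurable (time_prob P t)"
      by measurable
  qed (rule prob_space_axioms)
  also have "\<dots> = ennreal T * nn_sq (time_prob P t) (\<lambda>(s, w). ?f s w)"
    using convolution_measurable[OF g t, measurable] by (intro nn_integral_cmult) measurable
  also have "\<dots> \<le> ennreal T * (ennreal (K\<^sup>2) * nn_sq (time_prob P t) (\<lambda>(s, w). g s w))"
    by (intro mult_left_mono convolution_nn_sq K g t) auto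
  also have "\<dots> = ennreal (T * K\<^sup>2) * nn_sq (time_prob P t) (\<lambda>(s, w). g s w)"
    using T_pos by (simp add: ennreal_mult mult.assoc)
  finally show ?thesis .
qed

text \<open>Superposition is stated for arbitrary solutions, not only for selected ones: the
  coefficients 1 and -1 turn two solutions with equal data into one with zero data, from which
  uniqueness follows.\<close>

lemma mild_lincomb:
  assumes u: "u1 \<in> L2F P F T" "u2 \<in> L2F P F T"
    and X1: "mild \<eta>1 u1 X1" and X2: "mild \<eta>2 u2 X2"
  shows "mild (a *\<^sub>R \<eta>1 + c *\<^sub>R \<eta>2) (\<lambda>s w. a *\<^sub>R u1 s w + c *\<^sub>R u2 s w) (\<lambda>s w. a *\<^sub>R X1 s w + c *\<^sub>R X2 s w)"
  unfolding mild_solution_def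
proof (intro conjI ballI)
  have XL: "X1 \<in> L2F P F T" "X2 \<in> L2F P F T" using X1 X2 unfolding mild_solution_def by auto
  then show "(\<lambda>s w. a *\<^sub>R X1 s w + c *\<^sub>R X2 s w) \<in> L2F P F T"
    using T_pos by (intro L2F_lincomb subalgebra_F) auto
  fix t assume "t \<in> {0..T}"
  then have t: "0 \<le> t" "t \<le> T" by auto
  define f where "f X u s w = blinfun_apply (S (t - s)) (blinfun_apply (C s w) (X s w) + blinfun_apply (D s w) (u s w))" for X u s w
  define g where "g X u s w = blinfun_apply (S (t - s)) (blinfun_apply (A1 s w) (X s w) + blinfun_apply (B s w) (u s w))" for X u s w
  obtain I1 where I1: "has_ito_integral P F W t (f X1 u1) I1"
    and E1: "AE w in P. X1 t w = blinfun_apply (S t) \<eta>1 + (LINT s:{0..t}|lborel. g X1 u1 s w) + I1 w"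
    using X1 \<open>t \<in> {0..T}\<close> unfolding mild_solution_def f_def[abs_def] g_def[abs_def] by blast
  obtain I2 where I2: "has_ito_integral P F W t (f X2 u2) I2"
    and E2: "AE w in P. X2 t w = blinfun_apply (S t) \<eta>2 + (LINT s:{0..t}|lborel. g X2 u2 s w) + I2 w"
    using X2 \<open>t \<in> {0..T}\<close> unfolding mild_solution_def f_def[abs_def] g_def[abs_def] by blast
  let ?X = "\<lambda>s w. a *\<^sub>R X1 s w + c *\<^sub>R X2 s w" and ?u = "\<lambda>s w. a *\<^sub>R u1 s w + c *\<^sub>R u2 s w"
  have f: "f ?X ?u s w = a *\<^sub>R f X1 u1 s w + c *\<^sub>R f X2 u2 s w" for s w
    unfolding f_def by (simp add: blinfun.add_right blinfun.scaleR_right scaleR_add_right)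
  have g: "g ?X ?u s w = a *\<^sub>R g X1 u1 s w + c *\<^sub>R g X2 u2 s w" for s w
    unfolding g_def by (simp add: blinfun.add_right blinfun.scaleR_right scaleR_add_right)
  have int: "AE w in P. set_integrable lborel {0..t} (\<lambda>s. g X1 u1 s w)"
    "AE w in P. set_integrable lborel {0..t} (\<lambda>s. g X2 u2 s w)"
    unfolding g_def using u XL coefficients t by (auto intro!: convolution_AE_integrable L2F_sum)
  show "\<exists>I. has_ito_integral P F W t (\<lambda>s w. blinfun_apply (S (t - s))
           (blinfun_apply (C s w) (?X s w) + blinfun_apply (D s w) (?u s w))) I \<and>
        (AE w in P. ?X t w = blinfun_apply (S t) (a *\<^sub>R \<eta>1 + c *\<^sub>R \<eta>2) +
           (LINT s:{0..t}|lborel. blinfun_apply (S (t - s))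
              (blinfun_apply (A1 s w) (?X s w) + blinfun_apply (B s w) (?u s w))) + I w)"
    unfolding f_def[symmetric, of _ _ ?X ?u] g_def[symmetric, of _ _ ?X ?u]
  proof (intro exI conjI)
    have "has_ito_integral P F W t (\<lambda>s w. a *\<^sub>R f X1 u1 s w + c *\<^sub>R f X2 u2 s w) (\<lambda>w. a *\<^sub>R I1 w + c *\<^sub>R I2 w)"
      by (rule has_ito_integral_lincomb[OF I1 I2 t])
    then show "has_ito_integral P F W t (f ?X ?u) (\<lambda>w. a *\<^sub>R I1 w + c *\<^sub>R I2 w)"
      using f by presburger
    show "AE w in P. ?X t w = blinfun_apply (S t) (a *\<^sub>R \<eta>1 + c *\<^sub>R \<eta>2) +
           (LINT s:{0..t}|lborel. g ?X ?u s w) + (a *\<^sub>R I1 w + c *\<^sub>R I2 w)"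
      using E1 E2 int
    proof eventually_elim
      case (elim w)
      have "(LINT s:{0..t}|lborel. g ?X ?u s w) =
          a *\<^sub>R (LINT s:{0..t}|lborel. g X1 u1 s w) + c *\<^sub>R (LINT s:{0..t}|lborel. g X2 u2 s w)"
        unfolding g using elim by simp
      then show ?case unfolding elim(1,2) by (simp add: blinfun.add_right blinfun.scaleR_right algebra_simps)
    qed
  qed
qed

end

section \<open>A priori estimate and uniqueness of mild solutions\<close>

lemma ip_proc_self: "ip_proc P T f f = (LINT (s, w)|time_prob P T. (norm (f s w))\<^sup>2)"
  unfolding ip_proc_def by (simp add: dot_square_norm)

lemma sq_integrable_zero_AE:
  assumes "sq_integrable N f" "(\<integral>x. (norm (f x))\<^sup>2 \<partial>N) = 0"
  shows "AE x in N. f x = 0"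
proof -
  have "AE x in N. (norm (f x))\<^sup>2 = 0"
    using assms integral_nonneg_eq_0_iff_AE[of N "\<lambda>x. (norm (f x))\<^sup>2"] unfolding sq_integrable_def by auto
  then show ?thesis by eventually_elim simp
qed

context state_equation
begin

lemma mild_section:
  assumes "mild \<eta> u X" "t \<in> {0..T}"
  shows "strongly_measurable P (X t)"
  using assms progressive_section[of F T X t] subalgebra_F[of t] strongly_measurable_subalgebra
  unfolding mild_solution_def L2F_def by auto

text \<open>The state at time t is controlled by its own square integral up to t. This is the shape
  of Gronwall's inequality, with one constant for all data, controls and solutions.\<close>

lemma mild_a_priori:
  "\<exists>c\<ge>0. \<forall>\<eta> u X. u \<in> L2F P F T \<longrightarrow> mild \<eta> u X \<longrightarrow> (\<forall>t\<in>{0..T}. nn_sq P (X t) \<le>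
    ennreal c * (ennreal ((norm \<eta>)\<^sup>2) + nn_sq (time_prob P t) (\<lambda>(s, w). X s w) + nn_sq (time_prob P T) (\<lambda>(s, w). u s w)))"
proof -
  obtain K where K1: "K \<ge> 1" and K: "\<And>s. s \<in> {0..T} \<Longrightarrow> norm (S s) \<le> K" using C0_semigroup_bounded[OF semigroup] by blast
  obtain k where k0: "k \<ge> 0" and k: "\<And>X u t. X \<in> L2F P F T \<Longrightarrow> u \<in> L2F P F T \<Longrightarrow> t \<in> {0..T} \<Longrightarrow>
    nn_sq (time_prob P t) (\<lambda>(s, w). blinfun_apply (A1 s w) (X s w) + blinfun_apply (B s w) (u s w)) \<le>
    ennreal k * (nn_sq (time_prob P t) (\<lambda>(s, w). X s w) + nn_sq (time_prob P T) (\<lambda>(s, w). u s w))"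
    using LinfF_sum_bound[OF coefficients(1,3)] by blast
  obtain l where l0: "l \<ge> 0" and l: "\<And>X u t. X \<in> L2F P F T \<Longrightarrow> u \<in> L2F P F T \<Longrightarrow> t \<in> {0..T} \<Longrightarrow>
    nn_sq (time_prob P t) (\<lambda>(s, w). blinfun_apply (C s w) (X s w) + blinfun_apply (D s w) (u s w)) \<le>
    ennreal l * (nn_sq (time_prob P t) (\<lambda>(s, w). X s w) + nn_sq (time_prob P T) (\<lambda>(s, w). u s w))"
    using LinfF_sum_bound[OF coefficients(2,4)] by blast
  \<comment> \<open>Splitting the state as semigroup term plus (drift plus noise) gives the weights
    2, 4 and 4. The noise term carries a further 4 from \<open>ito_integral_bound\<close>.\<close>
  define c where "c = 2 * K\<^sup>2 + 4 * (T * K\<^sup>2 * k) + 16 * (K\<^sup>2 * l)"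
  have "nn_sq P (X t) \<le> ennreal c * (ennreal ((norm \<eta>)\<^sup>2) + nn_sq (time_prob P t) (\<lambda>(s, w). X s w) +
      nn_sq (time_prob P T) (\<lambda>(s, w). u s w))"
    if u: "u \<in> L2F P F T" and X: "mild \<eta> u X" and tT: "t \<in> {0..T}" for \<eta> u X t
  proof -
    have t: "0 \<le> t" "t \<le> T" using tT by auto
    have XL: "X \<in> L2F P F T" using X unfolding mild_solution_def by auto
    let ?R = "ennreal ((norm \<eta>)\<^sup>2) + nn_sq (time_prob P t) (\<lambda>(s, w). X s w) + nn_sq (time_prob P T) (\<lambda>(s, w). u s w)"
    let ?r = "nn_sq (time_prob P t) (\<lambda>(s, w). X s w) + nn_sq (time_prob P T) (\<lambda>(s, w). u s w)"
    have rR: "?r \<le> ?R" by (simp add: add.assoc)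
    define f where "f s w = blinfun_apply (C s w) (X s w) + blinfun_apply (D s w) (u s w)" for s w
    define g where "g s w = blinfun_apply (A1 s w) (X s w) + blinfun_apply (B s w) (u s w)" for s w
    have fL: "f \<in> L2F P F T" and gL: "g \<in> L2F P F T"
      unfolding f_def[abs_def] g_def[abs_def] using u XL coefficients by (auto intro: L2F_sum)
    obtain I where I: "has_ito_integral P F W t (\<lambda>s w. blinfun_apply (S (t - s)) (f s w)) I"
      and E: "AE w in P. X t w = blinfun_apply (S t) \<eta> + (LINT s:{0..t}|lborel. blinfun_apply (S (t - s)) (g s w)) + I w"
      using X tT unfolding mild_solution_def f_def[abs_def] g_def[abs_def] by blast
    \<comment> \<open>A measurable version of the drift term.\<close>
    define Y where "Y w = X t w - blinfun_apply (S t) \<eta> - I w" for w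
    have sI: "sq_integrable P I" using I unfolding has_ito_integral_def sq_integrable_def by auto
    have Im: "strongly_measurable P I" using sI unfolding sq_integrable_def by auto
    have Ym: "strongly_measurable P Y"
      unfolding Y_def by (intro strongly_measurable_diff strongly_measurable_const mild_section[OF X tT] Im)
    have "nn_sq P (\<lambda>w. blinfun_apply (S t) \<eta>) = ennreal ((norm (blinfun_apply (S t) \<eta>))\<^sup>2)"
      by (simp add: emeasure_space_1)
    also have "\<dots> \<le> ennreal (K\<^sup>2) * ennreal ((norm \<eta>)\<^sup>2)"
      by (rule power_mono_ennreal_norm) (intro order_trans[OF norm_blinfun mult_right_mono] K tT norm_ge_zero)
    also have "\<dots> \<le> ennreal (K\<^sup>2) * ?R" by (intro mult_left_mono) (auto simp: add.assoc)
    finally have 1: "nn_sq P (\<lambda>w. blinfun_apply (S t) \<eta>) \<le> ennreal (K\<^sup>2) * ?R" .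
    have "nn_sq P Y = nn_sq P (\<lambda>w. LINT s:{0..t}|lborel. blinfun_apply (S (t - s)) (g s w))"
      by (rule nn_integral_cong_AE, use E in eventually_elim) (simp add: Y_def)
    also have "\<dots> \<le> ennreal (T * K\<^sup>2) * nn_sq (time_prob P t) (\<lambda>(s, w). g s w)"
      by (rule convolution_integral_nn_sq[OF K gL t])
    also have "\<dots> \<le> ennreal (T * K\<^sup>2) * (ennreal k * ?R)"
      unfolding g_def by (intro mult_left_mono order_trans[OF k[OF XL u tT]] rR) auto
    finally have 2: "nn_sq P Y \<le> ennreal (T * K\<^sup>2 * k) * ?R"
      using k0 T_pos by (simp add: ennreal_mult mult.assoc)
    have "sq_integrable (time_prob P t) (\<lambda>(s, w). blinfun_apply (S (t - s)) (f s w))"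
      using I t unfolding has_ito_integral_def by (auto intro: L2F_sq_integrable)
    note fn = sq_integrable_nn_integral[OF this]
    have "nn_sq P I = ennreal (LINT w|P. (norm (I w))\<^sup>2)" by (rule sq_integrable_nn_integral[OF sI])
    also have "\<dots> \<le> ennreal (4 * (LINT (s, w)|time_prob P t. (norm (blinfun_apply (S (t - s)) (f s w)))\<^sup>2))"
      by (intro ennreal_leI ito_integral_bound I t)
    also have "\<dots> = 4 * nn_sq (time_prob P t) (\<lambda>(s, w). blinfun_apply (S (t - s)) (f s w))"
      unfolding fn by (simp add: ennreal_mult case_prod_unfold)
    also have "\<dots> \<le> 4 * (ennreal (K\<^sup>2) * nn_sq (time_prob P t) (\<lambda>(s, w). f s w))"
      by (intro mult_left_mono convolution_nn_sq K fL t) auto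
    also have "\<dots> \<le> 4 * (ennreal (K\<^sup>2) * (ennreal l * ?R))"
      unfolding f_def by (intro mult_left_mono order_trans[OF l[OF XL u tT]] rR) auto
    finally have 3: "nn_sq P I \<le> 4 * (ennreal (K\<^sup>2 * l) * ?R)"
      using l0 by (simp add: ennreal_mult mult.assoc)
    have "nn_sq P (X t) = nn_sq P (\<lambda>w. blinfun_apply (S t) \<eta> + (Y w + I w))" unfolding Y_def by simp
    also have "\<dots> \<le> 2 * nn_sq P (\<lambda>w. blinfun_apply (S t) \<eta>) + 2 * nn_sq P (\<lambda>w. Y w + I w)"
      by (intro nn_sq_add_le strongly_measurable_const strongly_measurable_add Ym Im)
    also have "\<dots> \<le> 2 * nn_sq P (\<lambda>w. blinfun_apply (S t) \<eta>) + 2 * (2 * nn_sq P Y + 2 * nn_sq P I)"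
      by (intro add_left_mono mult_left_mono nn_sq_add_le Ym Im) auto
    also have "\<dots> \<le> 2 * (ennreal (K\<^sup>2) * ?R) + 2 * (2 * (ennreal (T * K\<^sup>2 * k) * ?R) + 2 * (4 * (ennreal (K\<^sup>2 * l) * ?R)))"
      by (intro add_mono mult_left_mono 1 2 3) auto
    also have "\<dots> = (2 * ennreal (K\<^sup>2) + 4 * ennreal (T * K\<^sup>2 * k) + 16 * ennreal (K\<^sup>2 * l)) * ?R"
      by (simp add: algebra_simps)
    also have "2 * ennreal (K\<^sup>2) + 4 * ennreal (T * K\<^sup>2 * k) + 16 * ennreal (K\<^sup>2 * l) = ennreal c"
    proof -
      have n: "0 \<le> K\<^sup>2" "0 \<le> T * K\<^sup>2 * k" "0 \<le> K\<^sup>2 * l" using k0 l0 T_pos by auto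
      then show ?thesis unfolding c_def by (simp only: ennreal_plus ennreal_mult ennreal_numeral
            add_nonneg_nonneg mult_nonneg_nonneg zero_le_numeral)
    qed
    finally show ?thesis .
  qed
  moreover have "0 \<le> c" unfolding c_def using k0 l0 T_pos by auto
  ultimately show ?thesis by blast
qed

text \<open>The bound at each time makes the terminal map bounded, the integrated bound the map to
  the state process; these are the two operators whose adjoints are needed.\<close>

theorem mild_estimate:
  "\<exists>K\<ge>0. \<forall>\<eta> u X. u \<in> L2F P F T \<longrightarrow> mild \<eta> u X \<longrightarrow>
    (\<forall>t\<in>{0..T}. sq_integrable P (X t) \<and> (LINT w|P. (norm (X t w))\<^sup>2) \<le> K * ((norm \<eta>)\<^sup>2 + ip_proc P T u u)) \<and>
    ip_proc P T X X \<le> K * ((norm \<eta>)\<^sup>2 + ip_proc P T u u)"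
proof -
  obtain c where c0: "c \<ge> 0" and c: "\<And>\<eta> u X t. u \<in> L2F P F T \<Longrightarrow> mild \<eta> u X \<Longrightarrow> t \<in> {0..T} \<Longrightarrow> nn_sq P (X t) \<le>
    ennreal c * (ennreal ((norm \<eta>)\<^sup>2) + nn_sq (time_prob P t) (\<lambda>(s, w). X s w) + nn_sq (time_prob P T) (\<lambda>(s, w). u s w))"
    using mild_a_priori by blast
  define k where "k = 2 * exp ((2 * c + 1) * T) * c"
  \<comment> \<open>One constant serves both bounds: k at a fixed time, and T k after integration
    over \<open>{0..T}\<close>.\<close>
  define K where "K = k * (1 + T)"
  have k0: "k \<ge> 0" unfolding k_def using c0 by simp
  have kK: "k \<le> K" "T * k \<le> K" unfolding K_def using k0 T_pos by (auto simp: algebra_simps)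
  have "(\<forall>t\<in>{0..T}. sq_integrable P (X t) \<and> (LINT w|P. (norm (X t w))\<^sup>2) \<le> K * ((norm \<eta>)\<^sup>2 + ip_proc P T u u)) \<and>
    ip_proc P T X X \<le> K * ((norm \<eta>)\<^sup>2 + ip_proc P T u u)"
    if u: "u \<in> L2F P F T" and X: "mild \<eta> u X" for \<eta> u X
  proof -
    have XL: "X \<in> L2F P F T" using X unfolding mild_solution_def by auto
    have sX: "sq_integrable (time_prob P t) (\<lambda>(s, w). X s w)" if "t \<in> {0..T}" for t
      using L2F_sq_integrable_upto[OF XL] that by auto
    have su: "sq_integrable (time_prob P T) (\<lambda>(s, w). u s w)" using L2F_sq_integrable_upto[OF u] T_pos by auto
    define r where "r = (norm \<eta>)\<^sup>2 + ip_proc P T u u"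
    have ip0: "0 \<le> ip_proc P T Z Z" for Z :: "real \<Rightarrow> 'w \<Rightarrow> 'z::real_inner"
      unfolding ip_proc_self by (intro integral_nonneg_AE) auto
    have r0: "0 \<le> r" unfolding r_def using ip0[of u] by simp
    have nu: "nn_sq (time_prob P T) (\<lambda>(s, w). u s w) = ennreal (ip_proc P T u u)"
      unfolding sq_integrable_nn_integral[OF su] ip_proc_self by (simp add: case_prod_unfold)
    have nX: "nn_sq (time_prob P T) (\<lambda>(s, w). X s w) = ennreal (ip_proc P T X X)"
      using sq_integrable_nn_integral[OF sX[of T]] T_pos unfolding ip_proc_self by (simp add: case_prod_unfold)
    have er: "ennreal ((norm \<eta>)\<^sup>2) + ennreal (ip_proc P T u u) = ennreal r"
      unfolding r_def using ip0[of u] by simp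
    have Xm: "(\<lambda>z. ennreal ((norm (case z of (s, w) \<Rightarrow> X s w))\<^sup>2)) \<in> borel_measurable (time_prob P t)" if "t \<in> {0..T}" for t
      using sX[OF that] unfolding sq_integrable_def by (intro measurable_compose[OF strongly_measurable_norm]) auto
    have it: "nn_sq (time_prob P t) (\<lambda>(s, w). X s w) = (\<integral>\<^sup>+s. nn_sq P (X s) * indicator {0..t} s \<partial>lborel)"
      if "t \<in> {0..T}" for t
      using nn_integral_time_prob[OF prob_space_axioms Xm[OF that]] by simp
    have G: "nn_sq P (X t) \<le> ennreal (2 * exp ((2 * c + 1) * T) * (c * r))" if t: "t \<in> {0..T}" for t
    proof (rule Gronwall_nn_integral[OF c0 _ _ _ _ t])
      show "0 \<le> c * r" "0 \<le> T" using c0 r0 T_pos by auto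
      fix s assume s: "s \<in> {0..T}"
      have "nn_sq P (X s) \<le> ennreal c * (ennreal ((norm \<eta>)\<^sup>2) + nn_sq (time_prob P s) (\<lambda>(s, w). X s w) +
          ennreal (ip_proc P T u u))" using c[OF u X s] unfolding nu .
      also have "\<dots> = ennreal c * (ennreal r + nn_sq (time_prob P s) (\<lambda>(s, w). X s w))"
        unfolding er[symmetric] by (simp add: ac_simps)
      finally have *: "nn_sq P (X s) \<le> ennreal c * (ennreal r + nn_sq (time_prob P s) (\<lambda>(s, w). X s w))" .
      then show "nn_sq P (X s) \<le> ennreal (c * r) + ennreal c * (\<integral>\<^sup>+x. nn_sq P (X x) * indicator {0..s} x \<partial>lborel)"
        unfolding it[OF s] using c0 r0 by (simp add: distrib_left ennreal_mult)
      \<comment> \<open>The finite bound that Gronwall's inequality presupposes: membership of the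
        state in \<open>L2F\<close> makes the right-hand side of the a priori inequality bounded
        uniformly in time.\<close>
      have "nn_sq (time_prob P s) (\<lambda>(s, w). X s w) \<le> nn_sq (time_prob P T) (\<lambda>(s, w). X s w)"
        using s Xm[of T] by (intro nn_integral_time_prob_mono prob_space_axioms) auto
      then have "nn_sq P (X s) \<le> ennreal c * (ennreal r + ennreal (ip_proc P T X X))"
        unfolding nX by (intro order_trans[OF *] mult_left_mono add_left_mono) auto
      also have "\<dots> = ennreal (c * (r + ip_proc P T X X))"
        using c0 r0 ip0[of X] by (simp add: ennreal_mult)
      finally show "nn_sq P (X s) \<le> ennreal (c * (r + ip_proc P T X X))" .
    qed
    then have G: "nn_sq P (X t) \<le> ennreal (k * r)" if "t \<in> {0..T}" for t
      using that unfolding k_def by (simp add: mult.assoc)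
    have "sq_integrable P (X t) \<and> (LINT w|P. (norm (X t w))\<^sup>2) \<le> K * r" if t: "t \<in> {0..T}" for t
    proof
      show sq: "sq_integrable P (X t)"
        unfolding sq_integrable_iff_nn_integral using mild_section[OF X t] G[OF t] by (auto intro: order_le_less_trans)
      have "(LINT w|P. (norm (X t w))\<^sup>2) \<le> k * r"
        using G[OF t] k0 r0 unfolding sq_integrable_nn_integral[OF sq] by (simp add: ennreal_le_iff)
      also have "\<dots> \<le> K * r" using kK r0 by (intro mult_right_mono) auto
      finally show "(LINT w|P. (norm (X t w))\<^sup>2) \<le> K * r" .
    qed
    moreover have "ip_proc P T X X \<le> K * r"
    proof -
      have "ennreal (ip_proc P T X X) \<le> (\<integral>\<^sup>+s. ennreal (k * r) * indicator {0..T} s \<partial>lborel)"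
        unfolding nX[symmetric] using T_pos by (subst it) (auto intro!: nn_integral_mono simp: indicator_def G)
      also have "\<dots> = ennreal (T * k * r)"
        using T_pos k0 r0 by (simp add: nn_integral_cmult_indicator ennreal_mult[symmetric] ac_simps)
      finally have "ip_proc P T X X \<le> T * k * r" using T_pos k0 r0 by (simp add: ennreal_le_iff)
      also have "\<dots> \<le> K * r" using kK r0 by (intro mult_right_mono) auto
      finally show ?thesis .
    qed
    ultimately show ?thesis unfolding r_def by blast
  qed
  moreover have "0 \<le> K" unfolding K_def using k0 T_pos by auto
  ultimately show ?thesis by blast
qed

text \<open>A single time is a null set of the product measure, so the terminal state needs the
  statement at fixed times, while the running cost needs the one on the product space.\<close>

lemma mild_unique:
  assumes u: "u \<in> L2F P F T" and X: "mild \<eta> u X" and Y: "mild \<eta> u Y"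
  shows "t \<in> {0..T} \<Longrightarrow> AE w in P. X t w = Y t w" "AE (t, w) in time_prob P T. X t w = Y t w"
proof -
  let ?Z = "\<lambda>s w. X s w - Y s w"
  have mZ: "mild 0 (\<lambda>s w. 0) ?Z" using mild_lincomb[OF u u X Y, of 1 "-1"] by simp
  have "ip_proc P T (\<lambda>s w. 0 :: 'u) (\<lambda>s w. 0) = 0" by (simp add: ip_proc_def case_prod_unfold)
  with mild_estimate mZ L2F_zero have est: "(\<forall>t\<in>{0..T}. sq_integrable P (?Z t) \<and> (LINT w|P. (norm (?Z t w))\<^sup>2) \<le> 0) \<and>
      ip_proc P T ?Z ?Z \<le> 0"
    by fastforce
  have Z: "?Z \<in> L2F P F T" using mZ unfolding mild_solution_def by blast
  show "AE w in P. X t w = Y t w" if "t \<in> {0..T}"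
  proof -
    have sq: "sq_integrable P (?Z t)" "(LINT w|P. (norm (?Z t w))\<^sup>2) \<le> 0" using est that by auto
    moreover have "0 \<le> (LINT w|P. (norm (?Z t w))\<^sup>2)" by simp
    ultimately have "AE w in P. ?Z t w = 0" by (intro sq_integrable_zero_AE) auto
    then show ?thesis by simp
  qed
  have "ip_proc P T ?Z ?Z = 0" using est ip_proc_self[of P T ?Z]
    by (simp add: order_antisym case_prod_unfold)
  then have "AE z in time_prob P T. (case z of (s, w) \<Rightarrow> ?Z s w) = 0"
    using L2F_sq_integrable_upto[OF Z, of T] T_pos unfolding ip_proc_self
    by (intro sq_integrable_zero_AE) (auto simp: case_prod_unfold)
  then show "AE (t, w) in time_prob P T. X t w = Y t w" by (simp add: case_prod_unfold)
qed

end

section \<open>The linear-quadratic problem\<close>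

lemma sq_integrable_blinfun_apply:
  assumes "strongly_measurable N a" "AE z in N. norm (a z) \<le> K" "sq_integrable N f"
  shows "sq_integrable N (\<lambda>z. blinfun_apply (a z) (f z))"
proof (rule sq_integrable_bound[OF assms(3)])
  show "strongly_measurable N (\<lambda>z. blinfun_apply (a z) (f z))"
    using assms by (auto simp: sq_integrable_def intro: strongly_measurable_blinfun_apply)
  show "AE z in N. norm (blinfun_apply (a z) (f z)) \<le> K * norm (f z)"
    using assms(2) by eventually_elim (rule order_trans[OF norm_blinfun mult_right_mono]; simp)
qed

lemma integral_inner_lincomb_left:
  assumes "sq_integrable N f" "sq_integrable N g" "sq_integrable N h"
  shows "(\<integral>z. (a *\<^sub>R f z + c *\<^sub>R g z) \<bullet> h z \<partial>N) = a * (\<integral>z. f z \<bullet> h z \<partial>N) + c * (\<integral>z. g z \<bullet> h z \<partial>N)"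
  using sq_integrable_inner[OF assms(1,3)] sq_integrable_inner[OF assms(2,3)]
  by (simp add: inner_add_left)

lemma integral_selfadjoint_sym:
  assumes "AE z in N. selfadjoint (a z)" "strongly_measurable N a" "sq_integrable N f" "sq_integrable N g"
  shows "(\<integral>z. blinfun_apply (a z) (f z) \<bullet> g z \<partial>N) = (\<integral>z. blinfun_apply (a z) (g z) \<bullet> f z \<partial>N)"
proof (rule integral_cong_AE)
  show "(\<lambda>z. blinfun_apply (a z) (f z) \<bullet> g z) \<in> borel_measurable N"
    "(\<lambda>z. blinfun_apply (a z) (g z) \<bullet> f z) \<in> borel_measurable N"
    using assms by (auto simp: sq_integrable_def intro!: strongly_measurable_inner strongly_measurable_blinfun_apply)
  show "AE z in N. blinfun_apply (a z) (f z) \<bullet> g z = blinfun_apply (a z) (g z) \<bullet> f z"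
    using assms(1) by eventually_elim (simp add: selfadjoint_def inner_commute)
qed

text \<open>The equality is required only almost everywhere, as for the splitting of the state into
  its control and initial parts. Self-adjointness merges the two mixed terms into one.\<close>

lemma integral_selfadjoint_square_add:
  assumes a: "AE z in N. selfadjoint (a z)" "strongly_measurable N a" "AE z in N. norm (a z) \<le> K"
    and f: "sq_integrable N f" and g: "sq_integrable N g" and h: "strongly_measurable N h"
    and eq: "AE z in N. h z = f z + g z"
  shows "(\<integral>z. blinfun_apply (a z) (h z) \<bullet> h z \<partial>N) =
    (\<integral>z. blinfun_apply (a z) (f z) \<bullet> f z \<partial>N) + 2 * (\<integral>z. blinfun_apply (a z) (g z) \<bullet> f z \<partial>N) +
    (\<integral>z. blinfun_apply (a z) (g z) \<bullet> g z \<partial>N)"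
proof -
  have af: "sq_integrable N (\<lambda>z. blinfun_apply (a z) (f z))" and ag: "sq_integrable N (\<lambda>z. blinfun_apply (a z) (g z))"
    using sq_integrable_blinfun_apply a f g by blast+
  note i = sq_integrable_inner[OF af f] sq_integrable_inner[OF af g] sq_integrable_inner[OF ag f] sq_integrable_inner[OF ag g]
  have "(\<integral>z. blinfun_apply (a z) (h z) \<bullet> h z \<partial>N) =
     (\<integral>z. (blinfun_apply (a z) (f z) \<bullet> f z + blinfun_apply (a z) (f z) \<bullet> g z) +
       (blinfun_apply (a z) (g z) \<bullet> f z + blinfun_apply (a z) (g z) \<bullet> g z) \<partial>N)"
  proof (rule integral_cong_AE)
    show "(\<lambda>z. blinfun_apply (a z) (h z) \<bullet> h z) \<in> borel_measurable N"
      using a h by (intro strongly_measurable_inner strongly_measurable_blinfun_apply)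
    show "AE z in N. blinfun_apply (a z) (h z) \<bullet> h z =
      (blinfun_apply (a z) (f z) \<bullet> f z + blinfun_apply (a z) (f z) \<bullet> g z) +
       (blinfun_apply (a z) (g z) \<bullet> f z + blinfun_apply (a z) (g z) \<bullet> g z)"
      using eq by eventually_elim (simp add: blinfun.add_right inner_add_left inner_add_right)
  qed (use i in auto)
  also have "\<dots> = ((\<integral>z. blinfun_apply (a z) (f z) \<bullet> f z \<partial>N) + (\<integral>z. blinfun_apply (a z) (f z) \<bullet> g z \<partial>N)) +
     ((\<integral>z. blinfun_apply (a z) (g z) \<bullet> f z \<partial>N) + (\<integral>z. blinfun_apply (a z) (g z) \<bullet> g z \<partial>N))"
    using i by simp
  finally show ?thesis using integral_selfadjoint_sym[OF a(1,2) f g] by simp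
qed

text \<open>Weaker than Cauchy-Schwarz, but already of the type \<open>K * (q f f + 1)\<close> that
  \<open>Riesz\<close> asks for.\<close>

lemma abs_integral_inner_le:
  assumes "sq_integrable N f" "sq_integrable N g"
  shows "\<bar>\<integral>z. f z \<bullet> g z \<partial>N\<bar> \<le> (\<integral>z. (norm (f z))\<^sup>2 \<partial>N) + (\<integral>z. (norm (g z))\<^sup>2 \<partial>N)"
proof -
  have "\<bar>\<integral>z. f z \<bullet> g z \<partial>N\<bar> \<le> (\<integral>z. \<bar>f z \<bullet> g z\<bar> \<partial>N)" by (rule integral_abs_bound)
  also have "\<dots> \<le> (\<integral>z. (norm (f z))\<^sup>2 + (norm (g z))\<^sup>2 \<partial>N)"
    using assms sq_integrable_inner[OF assms]
    by (intro integral_mono abs_inner_le_norm_sq) (auto simp: sq_integrable_def)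
  also have "\<dots> = (\<integral>z. (norm (f z))\<^sup>2 \<partial>N) + (\<integral>z. (norm (g z))\<^sup>2 \<partial>N)"
    using assms by (simp add: sq_integrable_def)
  finally show ?thesis .
qed

text \<open>The choice in the definition of the adjoint means something only once a representative
  exists; the Riesz theorem will provide one.\<close>

lemma hilbert_adjoint_eq:
  assumes "\<exists>v\<in>V. \<forall>u\<in>V. ipV u v = ipY (L u) y"
  shows "hilbert_adjoint V ipV ipY L y \<in> V" "u \<in> V \<Longrightarrow> ipV u (hilbert_adjoint V ipV ipY L y) = ipY (L u) y"
proof -
  have "\<exists>v. v \<in> V \<and> (\<forall>u\<in>V. ipV u v = ipY (L u) y)" using assms by blast
  from someI_ex[OF this]
  show "hilbert_adjoint V ipV ipY L y \<in> V" "u \<in> V \<Longrightarrow> ipV u (hilbert_adjoint V ipV ipY L y) = ipY (L u) y"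
    unfolding hilbert_adjoint_def by auto
qed

lemma ip_proc_case_prod:
  "ip_proc P T f g = (\<integral>z. (case z of (s, w) \<Rightarrow> f s w) \<bullet> (case z of (s, w) \<Rightarrow> g s w) \<partial>time_prob P T)"
  unfolding ip_proc_def by (simp add: case_prod_unfold)

section \<open>The Hilbert spaces of processes\<close>

context brownian_filtration
begin

lemma L2F_sq_integrable_T: "f \<in> L2F P F T \<Longrightarrow> sq_integrable (time_prob P T) (\<lambda>(s, w). f s w)"
  using L2F_sq_integrable[of f T] T_pos by simp

text \<open>The limit has to be progressive, not merely measurable on the product space. It is
  therefore taken pointwise, with the value 0 where the sequence diverges.\<close>

lemma complete_form_L2F:
  "complete_form (L2F P F T :: (real \<Rightarrow> 'w \<Rightarrow> 'u::{real_inner, banach}) set) (ip_proc P T)"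
proof
  have T: "subalgebra P (F T)" "0 \<le> T" using subalgebra_F T_pos by auto
  show "(\<lambda>s w. 0) \<in> L2F P F T" by (rule L2F_zero)
  fix f g :: "real \<Rightarrow> 'w \<Rightarrow> 'u" and a c :: real
  assume f: "f \<in> L2F P F T"
  show "0 \<le> ip_proc P T f f" unfolding ip_proc_self by (intro integral_nonneg_AE) auto
  assume g: "g \<in> L2F P F T"
  show "(\<lambda>s w. a *\<^sub>R f s w + c *\<^sub>R g s w) \<in> L2F P F T" by (rule L2F_lincomb[OF T f g])
  show "ip_proc P T f g = ip_proc P T g f" unfolding ip_proc_def by (simp add: inner_commute)
  fix h :: "real \<Rightarrow> 'w \<Rightarrow> 'u" assume h: "h \<in> L2F P F T"
  show "ip_proc P T (\<lambda>s w. a *\<^sub>R f s w + c *\<^sub>R g s w) h = a * ip_proc P T f h + c * ip_proc P T g h"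
    using integral_inner_lincomb_left[OF f[THEN L2F_sq_integrable_T] g[THEN L2F_sq_integrable_T] h[THEN L2F_sq_integrable_T], of a c]
    unfolding ip_proc_case_prod by (simp add: case_prod_unfold)
next
  fix u :: "nat \<Rightarrow> real \<Rightarrow> 'w \<Rightarrow> 'u" and c :: real
  assume u: "\<And>n. u n \<in> L2F P F T"
    and c: "\<And>n m. n \<le> m \<Longrightarrow> ip_proc P T (\<lambda>s w. u n s w - u m s w) (\<lambda>s w. u n s w - u m s w) \<le> c * (1/4)^n"
  define l where "l s w = (if convergent (\<lambda>n. u n s w) then lim (\<lambda>n. u n s w) else 0)" for s w
  have T: "subalgebra P (F T)" "0 \<le> T" using subalgebra_F T_pos by auto
  let ?u = "\<lambda>n z. u n (fst z) (snd z)" and ?l = "\<lambda>z. l (fst z) (snd z)"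
  have su: "sq_integrable (time_prob P T) (?u n)" for n using L2F_sq_integrable_T[OF u[of n]] by (simp add: case_prod_unfold)
  have cu: "(\<integral>z. (norm (?u n z - ?u m z))\<^sup>2 \<partial>time_prob P T) \<le> c * (1/4)^n" if "n \<le> m" for n m
    using c[OF that] unfolding ip_proc_self by (simp add: case_prod_unfold)
  have pl: "progressive F T l" unfolding l_def[abs_def] using u by (intro progressive_lim) (auto simp: L2F_def)
  have sl: "strongly_measurable (time_prob P T) ?l"
    using progressive_strongly_measurable[OF pl T] by (simp add: case_prod_unfold)
  have "AE z in time_prob P T. convergent (\<lambda>n. ?u n z)"
    by (rule sq_integrable_fast_Cauchy_convergent[OF su cu])
  then have lim: "AE z in time_prob P T. (\<lambda>n. ?u n z) \<longlonglongrightarrow> ?l z"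
    by eventually_elim (simp add: l_def convergent_LIMSEQ_iff)
  note Fatou = sq_integrable_Fatou[OF su cu sl lim]
  have "l \<in> L2F P F T"
    unfolding L2F_iff_sq_integrable[of P F T, OF T] using pl Fatou(1) by (simp add: case_prod_unfold)
  moreover have "(\<lambda>n. ip_proc P T (\<lambda>s w. u n s w - l s w) (\<lambda>s w. u n s w - l s w)) \<longlonglongrightarrow> 0"
  proof (rule tendsto_sandwich[OF _ _ tendsto_const])
    show "eventually (\<lambda>n. 0 \<le> ip_proc P T (\<lambda>s w. u n s w - l s w) (\<lambda>s w. u n s w - l s w)) sequentially"
      unfolding ip_proc_self by (intro always_eventually allI integral_nonneg_AE) auto
    show "eventually (\<lambda>n. ip_proc P T (\<lambda>s w. u n s w - l s w) (\<lambda>s w. u n s w - l s w) \<le> c * (1/4)^n) sequentially"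
      using Fatou(2) unfolding ip_proc_self by (simp add: case_prod_unfold)
    show "(\<lambda>n. c * (1/4)^n) \<longlonglongrightarrow> 0"
      using tendsto_mult_left[OF LIMSEQ_power_zero[of "1/4::real"], of c] by simp
  qed
  ultimately show "\<exists>l\<in>L2F P F T. (\<lambda>n. ip_proc P T (\<lambda>s w. u n s w - l s w) (\<lambda>s w. u n s w - l s w)) \<longlonglongrightarrow> 0" by blast
qed

lemma ip_proc_cong:
  assumes "f \<in> L2F P F T" "g \<in> L2F P F T" "h \<in> L2F P F T" "AE (t, w) in time_prob P T. f t w = g t w"
  shows "ip_proc P T f h = ip_proc P T g h"
  unfolding ip_proc_case_prod
proof (rule integral_cong_AE)
  show "AE z in time_prob P T. (case z of (s, w) \<Rightarrow> f s w) \<bullet> (case z of (s, w) \<Rightarrow> h s w) =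
      (case z of (s, w) \<Rightarrow> g s w) \<bullet> (case z of (s, w) \<Rightarrow> h s w)"
    using assms(4) by eventually_elim auto
qed (intro borel_measurable_integrable sq_integrable_inner L2F_sq_integrable_T assms)+

lemma ip_proc_eq_0_iff:
  assumes "f \<in> L2F P F T"
  shows "ip_proc P T f f = 0 \<longleftrightarrow> eq_proc P T f (\<lambda>t w. 0)"
proof
  assume "ip_proc P T f f = 0"
  then have "AE z in time_prob P T. (case z of (s, w) \<Rightarrow> f s w) = 0"
    using L2F_sq_integrable_T[OF assms] unfolding ip_proc_self
    by (intro sq_integrable_zero_AE) (auto simp: case_prod_unfold)
  then show "eq_proc P T f (\<lambda>t w. 0)" unfolding eq_proc_def by (simp add: case_prod_unfold)
next
  assume "eq_proc P T f (\<lambda>t w. 0)"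
  then have "ip_proc P T f f = ip_proc P T (\<lambda>s w. 0) f"
    unfolding eq_proc_def by (intro ip_proc_cong assms L2F_zero)
  then show "ip_proc P T f f = 0" unfolding ip_proc_def by (simp add: case_prod_unfold)
qed

end

section \<open>Adjoints of the maps from controls to states\<close>

locale slq_problem = state_equation P F T W S A1 C B D
  for P :: "'w measure" and F T W
    and S :: "real \<Rightarrow> 'h::{real_inner, banach, second_countable_topology} \<Rightarrow>\<^sub>L 'h"
    and A1 C and B D :: "real \<Rightarrow> 'w \<Rightarrow> 'u::{real_inner, banach} \<Rightarrow>\<^sub>L 'h" +
  fixes M :: "real \<Rightarrow> 'w \<Rightarrow> 'h \<Rightarrow>\<^sub>L 'h" and R :: "real \<Rightarrow> 'w \<Rightarrow> 'u \<Rightarrow>\<^sub>L 'u" and G :: "'w \<Rightarrow> 'h \<Rightarrow>\<^sub>L 'h"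
    and X :: "'h \<Rightarrow> (real \<Rightarrow> 'w \<Rightarrow> 'u) \<Rightarrow> real \<Rightarrow> 'w \<Rightarrow> 'h"
  assumes M: "M \<in> LinfF P F T" "AE (t, w) in time_prob P T. selfadjoint (M t w)"
    and R: "R \<in> LinfF P F T" "AE (t, w) in time_prob P T. selfadjoint (R t w)"
    and G: "G \<in> Linf_rv P (F T)" "AE w in P. selfadjoint (G w)"
    and X: "\<And>\<eta> u. u \<in> L2F P F T \<Longrightarrow> mild \<eta> u (X \<eta> u)"
begin

abbreviation U :: "(real \<Rightarrow> 'w \<Rightarrow> 'u) set" where "U \<equiv> L2F P F T"
abbreviation ip :: "(real \<Rightarrow> 'w \<Rightarrow> 'z::real_inner) \<Rightarrow> (real \<Rightarrow> 'w \<Rightarrow> 'z) \<Rightarrow> real" where "ip \<equiv> ip_proc P T"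
abbreviation "N \<equiv> op_N P F T M R G X"
abbreviation "H \<equiv> vec_H P F T M G X"

sublocale U: complete_form U ip by (rule complete_form_L2F)

lemma subalgebra_T: "subalgebra P (F T)" and T_nonneg: "0 \<le> T" and T_in: "T \<in> {0..T}"
  using subalgebra_F T_pos by auto

lemma X_in: "u \<in> U \<Longrightarrow> X \<eta> u \<in> L2F P F T"
  using X unfolding mild_solution_def by blast

lemma X_T_sq_integrable: "u \<in> U \<Longrightarrow> sq_integrable P (X \<eta> u T)"
  using mild_estimate X T_in by blast

text \<open>A combination of selected solutions solves the equation for the combined data, hence
  agrees with the selected solution there, by uniqueness.\<close>

lemma X_lincomb:
  assumes "u \<in> U" "v \<in> U"
  shows "AE (t, w) in time_prob P T. X (a *\<^sub>R \<eta> + c *\<^sub>R \<zeta>) (\<lambda>s w. a *\<^sub>R u s w + c *\<^sub>R v s w) t w = a *\<^sub>R X \<eta> u t w + c *\<^sub>R X \<zeta> v t w"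
    "AE w in P. X (a *\<^sub>R \<eta> + c *\<^sub>R \<zeta>) (\<lambda>s w. a *\<^sub>R u s w + c *\<^sub>R v s w) T w = a *\<^sub>R X \<eta> u T w + c *\<^sub>R X \<zeta> v T w"
  using mild_unique[OF U.lincomb_in[OF assms] X[OF U.lincomb_in[OF assms]] mild_lincomb[OF assms X[OF assms(1)] X[OF assms(2)]]]
    T_in by blast+

lemma M_in: "Y \<in> L2F P F T \<Longrightarrow> (\<lambda>s w. blinfun_apply (M s w) (Y s w)) \<in> L2F P F T"
  by (rule L2F_blinfun_apply[OF subalgebra_T T_nonneg M(1)])

lemma R_in: "u \<in> U \<Longrightarrow> (\<lambda>s w. blinfun_apply (R s w) (u s w)) \<in> U"
  by (rule L2F_blinfun_apply[OF subalgebra_T T_nonneg R(1)])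

lemma G_strongly_measurable: "strongly_measurable P G"
  using G(1) strongly_measurable_subalgebra[OF subalgebra_T] unfolding Linf_rv_def by auto

lemma G_sq_integrable: "sq_integrable P Y \<Longrightarrow> sq_integrable P (\<lambda>w. blinfun_apply (G w) (Y w))"
  using G(1) sq_integrable_blinfun_apply[OF G_strongly_measurable] unfolding Linf_rv_def by auto

text \<open>The functional u \<mapsto> \<langle>\<Xi>u, y\<rangle> is linear because \<Xi> is linear
  up to null sets, and it is bounded by the integrated part of \<open>mild_estimate\<close>, so
  \<open>Riesz\<close> applies.\<close>

lemma Xi_adj:
  assumes y: "y \<in> L2F P F T"
  shows "Xi_adj P F T X y \<in> U" "u \<in> U \<Longrightarrow> ip u (Xi_adj P F T X y) = ip (Xi X u) y"
proof -
  obtain K where K0: "K \<ge> 0" and K: "\<And>\<eta> u. u \<in> U \<Longrightarrow> ip (X \<eta> u) (X \<eta> u) \<le> K * ((norm \<eta>)\<^sup>2 + ip u u)"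
    using mild_estimate X by blast
  interpret Y: complete_form "L2F P F T :: (real \<Rightarrow> 'w \<Rightarrow> 'h) set" ip by (rule complete_form_L2F)
  have "\<exists>v\<in>U. \<forall>u\<in>U. ip u v = ip (Xi X u) y"
  proof (rule U.Riesz)
    fix a c :: real and u v assume uv: "u \<in> U" "v \<in> U"
    have "ip (Xi X (\<lambda>s w. a *\<^sub>R u s w + c *\<^sub>R v s w)) y = ip (\<lambda>s w. a *\<^sub>R X 0 u s w + c *\<^sub>R X 0 v s w) y"
      unfolding Xi_def using X_lincomb(1)[OF uv, of a 0 c 0]
      by (intro ip_proc_cong X_in Y.lincomb_in U.lincomb_in uv y) simp
    also have "\<dots> = a * ip (Xi X u) y + c * ip (Xi X v) y"
      unfolding Xi_def by (intro Y.lincomb_left X_in uv y)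
    finally show "ip (Xi X (\<lambda>s w. a *\<^sub>R u s w + c *\<^sub>R v s w)) y = a * ip (Xi X u) y + c * ip (Xi X v) y" .
  next
    fix u assume u: "u \<in> U"
    have "\<bar>ip (Xi X u) y\<bar> \<le> ip (X 0 u) (X 0 u) + ip y y"
      unfolding Xi_def ip_proc_self using abs_integral_inner_le[OF L2F_sq_integrable_T[OF X_in[OF u]] L2F_sq_integrable_T[OF y]]
      unfolding ip_proc_case_prod by (simp add: case_prod_unfold)
    also have "\<dots> \<le> K * ip u u + ip y y" using K[OF u, of 0] by simp
    also have "\<dots> \<le> (K + ip y y) * (ip u u + 1)"
      using U.nonneg[OF u] Y.nonneg[OF y] K0 by (simp add: algebra_simps)
    finally show "\<bar>ip (Xi X u) y\<bar> \<le> (K + ip y y) * (ip u u + 1)" .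
  qed
  from hilbert_adjoint_eq[of U ip ip "Xi X" y, OF this]
  show "Xi_adj P F T X y \<in> U" "u \<in> U \<Longrightarrow> ip u (Xi_adj P F T X y) = ip (Xi X u) y"
    unfolding Xi_adj_def by auto
qed

text \<open>Here boundedness rests on \<open>mild_estimate\<close> at the single time T.\<close>

lemma Xi_hat_adj:
  assumes y: "sq_integrable P y"
  shows "Xi_hat_adj P F T X y \<in> U" "u \<in> U \<Longrightarrow> ip u (Xi_hat_adj P F T X y) = ip_rv P (Xi_hat T X u) y"
proof -
  obtain K where K0: "K \<ge> 0" and K: "\<And>\<eta> u. u \<in> U \<Longrightarrow> (LINT w|P. (norm (X \<eta> u T w))\<^sup>2) \<le> K * ((norm \<eta>)\<^sup>2 + ip u u)"
    using mild_estimate X T_in by blast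
  have "\<exists>v\<in>U. \<forall>u\<in>U. ip u v = ip_rv P (Xi_hat T X u) y"
  proof (rule U.Riesz)
    fix a c :: real and u v assume uv: "u \<in> U" "v \<in> U"
    have XT: "sq_integrable P (X 0 u T)" "sq_integrable P (X 0 v T)" using X_T_sq_integrable uv by auto
    have "ip_rv P (Xi_hat T X (\<lambda>s w. a *\<^sub>R u s w + c *\<^sub>R v s w)) y = (LINT w|P. (a *\<^sub>R X 0 u T w + c *\<^sub>R X 0 v T w) \<bullet> y w)"
      unfolding Xi_hat_def ip_rv_def
    proof (rule integral_cong_AE)
      show "AE w in P. X 0 (\<lambda>s w. a *\<^sub>R u s w + c *\<^sub>R v s w) T w \<bullet> y w = (a *\<^sub>R X 0 u T w + c *\<^sub>R X 0 v T w) \<bullet> y w"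
        using X_lincomb(2)[OF uv, of a 0 c 0] by eventually_elim simp
    qed (use sq_integrable_inner[OF X_T_sq_integrable[OF U.lincomb_in[OF uv]] y]
        sq_integrable_inner[OF sq_integrable_lincomb[OF XT] y] in auto)
    also have "\<dots> = a * ip_rv P (Xi_hat T X u) y + c * ip_rv P (Xi_hat T X v) y"
      unfolding Xi_hat_def ip_rv_def by (rule integral_inner_lincomb_left[OF XT y])
    finally show "ip_rv P (Xi_hat T X (\<lambda>s w. a *\<^sub>R u s w + c *\<^sub>R v s w)) y =
        a * ip_rv P (Xi_hat T X u) y + c * ip_rv P (Xi_hat T X v) y" .
  next
    fix u assume u: "u \<in> U"
    let ?y = "LINT w|P. (norm (y w))\<^sup>2"
    have y0: "0 \<le> ?y" by simp
    have "\<bar>ip_rv P (Xi_hat T X u) y\<bar> \<le> (LINT w|P. (norm (X 0 u T w))\<^sup>2) + ?y"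
      unfolding Xi_hat_def ip_rv_def by (rule abs_integral_inner_le[OF X_T_sq_integrable[OF u] y])
    also have "\<dots> \<le> K * ip u u + ?y" using K[OF u, of 0] by simp
    also have "\<dots> \<le> (K + ?y) * (ip u u + 1)"
      using U.nonneg[OF u] y0 K0 by (simp add: algebra_simps)
    finally show "\<bar>ip_rv P (Xi_hat T X u) y\<bar> \<le> (K + ?y) * (ip u u + 1)" .
  qed
  from hilbert_adjoint_eq[of U ip "ip_rv P" "Xi_hat T X" y, OF this]
  show "Xi_hat_adj P F T X y \<in> U" "u \<in> U \<Longrightarrow> ip u (Xi_hat_adj P F T X y) = ip_rv P (Xi_hat T X u) y"
    unfolding Xi_hat_adj_def by auto
qed

end

lemma integral_blinfun_inner_le:
  assumes a: "strongly_measurable N a" "AE z in N. norm (a z) \<le> K" and f: "sq_integrable N f"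
  shows "(\<integral>z. blinfun_apply (a z) (f z) \<bullet> f z \<partial>N) \<le> \<bar>K\<bar> * (\<integral>z. (norm (f z))\<^sup>2 \<partial>N)"
proof -
  have "(\<integral>z. blinfun_apply (a z) (f z) \<bullet> f z \<partial>N) \<le> (\<integral>z. \<bar>K\<bar> * (norm (f z))\<^sup>2 \<partial>N)"
  proof (rule integral_mono_AE)
    show "integrable N (\<lambda>z. blinfun_apply (a z) (f z) \<bullet> f z)"
      by (intro sq_integrable_inner sq_integrable_blinfun_apply[OF a f] f)
    show "integrable N (\<lambda>z. \<bar>K\<bar> * (norm (f z))\<^sup>2)" using f by (simp add: sq_integrable_def)
    show "AE z in N. blinfun_apply (a z) (f z) \<bullet> f z \<le> \<bar>K\<bar> * (norm (f z))\<^sup>2"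
      using a(2)
    proof eventually_elim
      case (elim z)
      have "norm (blinfun_apply (a z) (f z)) \<le> \<bar>K\<bar> * norm (f z)"
        using elim by (intro order_trans[OF norm_blinfun mult_right_mono]) auto
      then have "norm (blinfun_apply (a z) (f z)) * norm (f z) \<le> \<bar>K\<bar> * norm (f z) * norm (f z)"
        by (rule mult_right_mono) simp
      then show ?case using norm_cauchy_schwarz[of "blinfun_apply (a z) (f z)" "f z"]
        by (simp add: power2_eq_square mult.assoc)
    qed
  qed
  then show ?thesis by simp
qed

section \<open>The quadratic form of the cost and its minimisers\<close>

context slq_problem
begin

text \<open>This is \<langle>\<N>u, v\<rangle> with the adjoints moved to the other side. In this
  shape symmetry can be read off from the self-adjoint weights, and no chosen representative occurs
  besides the states.\<close>

definition bform :: "(real \<Rightarrow> 'w \<Rightarrow> 'u) \<Rightarrow> (real \<Rightarrow> 'w \<Rightarrow> 'u) \<Rightarrow> real" where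
  "bform u v = ip (\<lambda>s w. blinfun_apply (R s w) (u s w)) v +
     ip (\<lambda>s w. blinfun_apply (M s w) (Xi X u s w)) (Xi X v) +
     ip_rv P (\<lambda>w. blinfun_apply (G w) (Xi_hat T X u w)) (Xi_hat T X v)"

lemma Xi_in: "u \<in> U \<Longrightarrow> Xi X u \<in> L2F P F T" and Gam_in: "Gam X \<eta> \<in> L2F P F T"
  and Xi_hat_sq: "u \<in> U \<Longrightarrow> sq_integrable P (Xi_hat T X u)" and Gam_hat_sq: "sq_integrable P (Gam_hat T X \<eta>)"
  unfolding Xi_def Gam_def Xi_hat_def Gam_hat_def by (auto intro: X_in X_T_sq_integrable L2F_zero)

lemma ip_commute: "ip f g = ip g f"
  unfolding ip_proc_def by (simp add: inner_commute)

lemma ip_rv_commute: "ip_rv P f g = ip_rv P g f"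
  unfolding ip_rv_def by (simp add: inner_commute)

lemma sum_in: "f \<in> U \<Longrightarrow> g \<in> U \<Longrightarrow> (\<lambda>s w. f s w + g s w) \<in> U"
  using U.lincomb_in[of f g 1 1] by simp

lemma ip_sum_left: "f \<in> U \<Longrightarrow> g \<in> U \<Longrightarrow> h \<in> U \<Longrightarrow> ip (\<lambda>s w. f s w + g s w) h = ip f h + ip g h"
  using U.lincomb_left[of f g h 1 1] by simp

lemma N_in: "u \<in> U \<Longrightarrow> N u \<in> U"
  unfolding op_N_def
  by (intro sum_in R_in Xi_adj(1) Xi_hat_adj(1) M_in Xi_in G_sq_integrable Xi_hat_sq)

lemma N_eq:
  assumes u: "u \<in> U" and v: "v \<in> U"
  shows "ip (N u) v = bform u v"
proof -
  note y = M_in[OF Xi_in[OF u]] and z = G_sq_integrable[OF Xi_hat_sq[OF u]]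
  show ?thesis
    unfolding op_N_def bform_def
    using ip_sum_left[OF sum_in[OF R_in[OF u] Xi_adj(1)[OF y]] Xi_hat_adj(1)[OF z] v]
      ip_sum_left[OF R_in[OF u] Xi_adj(1)[OF y] v] Xi_adj(2)[OF y v] Xi_hat_adj(2)[OF z v]
    by (simp add: ip_commute[of "Xi_adj _ _ _ _ _" v] ip_commute[of "Xi_hat_adj _ _ _ _ _" v]
        ip_commute[of "Xi X v"] ip_rv_commute[of "Xi_hat T X v"])
qed

lemma H_in: "H \<eta> \<in> U"
  unfolding vec_H_def
  by (intro sum_in Xi_adj(1) Xi_hat_adj(1) M_in Gam_in G_sq_integrable Gam_hat_sq)

lemma H_eq:
  assumes v: "v \<in> U"
  shows "ip (H \<eta>) v = ip (\<lambda>s w. blinfun_apply (M s w) (Gam X \<eta> s w)) (Xi X v) +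
    ip_rv P (\<lambda>w. blinfun_apply (G w) (Gam_hat T X \<eta> w)) (Xi_hat T X v)"
proof -
  note y = M_in[OF Gam_in[of \<eta>]] and z = G_sq_integrable[OF Gam_hat_sq[of \<eta>]]
  show ?thesis
    unfolding vec_H_def
    using ip_sum_left[OF Xi_adj(1)[OF y] Xi_hat_adj(1)[OF z] v] Xi_adj(2)[OF y v] Xi_hat_adj(2)[OF z v]
    by (simp add: ip_commute[of "Xi_adj _ _ _ _ _" v] ip_commute[of "Xi_hat_adj _ _ _ _ _" v]
        ip_commute[of "Xi X v"] ip_rv_commute[of "Xi_hat T X v"])
qed

lemma M_strongly_measurable: "strongly_measurable (time_prob P T) (\<lambda>z. M (fst z) (snd z))"
  using progressive_strongly_measurable[of F T M P] subalgebra_T T_nonneg M(1)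
  unfolding LinfF_def by (simp add: case_prod_unfold)

lemma R_strongly_measurable: "strongly_measurable (time_prob P T) (\<lambda>z. R (fst z) (snd z))"
  using progressive_strongly_measurable[of F T R P] subalgebra_T T_nonneg R(1)
  unfolding LinfF_def by (simp add: case_prod_unfold)

lemma sq_integrable_process: "f \<in> L2F P F T \<Longrightarrow> sq_integrable (time_prob P T) (\<lambda>z. f (fst z) (snd z))"
  using L2F_sq_integrable_T[of f] by (simp add: case_prod_unfold)

lemma bform_sym:
  assumes u: "u \<in> U" and v: "v \<in> U"
  shows "bform u v = bform v u"
proof -
  have "ip (\<lambda>s w. blinfun_apply (R s w) (u s w)) v = ip (\<lambda>s w. blinfun_apply (R s w) (v s w)) u"
    using integral_selfadjoint_sym[OF _ R_strongly_measurable sq_integrable_process[OF u] sq_integrable_process[OF v]] R(2)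
    unfolding ip_proc_def by (simp add: case_prod_unfold)
  moreover have "ip (\<lambda>s w. blinfun_apply (M s w) (Xi X u s w)) (Xi X v) =
      ip (\<lambda>s w. blinfun_apply (M s w) (Xi X v s w)) (Xi X u)"
    using integral_selfadjoint_sym[OF _ M_strongly_measurable sq_integrable_process[OF Xi_in[OF u]]
        sq_integrable_process[OF Xi_in[OF v]]] M(2)
    unfolding ip_proc_def by (simp add: case_prod_unfold)
  moreover have "ip_rv P (\<lambda>w. blinfun_apply (G w) (Xi_hat T X u w)) (Xi_hat T X v) =
      ip_rv P (\<lambda>w. blinfun_apply (G w) (Xi_hat T X v w)) (Xi_hat T X u)"
    unfolding ip_rv_def
    by (rule integral_selfadjoint_sym[OF G(2) G_strongly_measurable Xi_hat_sq[OF u] Xi_hat_sq[OF v]])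
  ultimately show ?thesis unfolding bform_def by simp
qed

text \<open>In the second argument \<open>bform\<close> is the inner product with the fixed process
  \<open>N h\<close>, so linearity there is that of \<open>ip\<close>. Symmetry carries it to the
  first argument.\<close>

lemma form_on_bform: "form_on U bform"
proof
  fix f g h :: "real \<Rightarrow> 'w \<Rightarrow> 'u" and a c :: real assume f: "f \<in> U" and g: "g \<in> U" 
  show "bform f g = bform g f" by (rule bform_sym[OF f g])
  assume h: "h \<in> U"
  have lc: "(\<lambda>s w. a *\<^sub>R f s w + c *\<^sub>R g s w) \<in> U" by (rule U.lincomb_in[OF f g])
  have "bform h (\<lambda>s w. a *\<^sub>R f s w + c *\<^sub>R g s w) = a * bform h f + c * bform h g"
    unfolding N_eq[OF h lc, symmetric] N_eq[OF h f, symmetric] N_eq[OF h g, symmetric]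
    by (rule U.lincomb_right[OF f g N_in[OF h]])
  then show "bform (\<lambda>s w. a *\<^sub>R f s w + c *\<^sub>R g s w) h = a * bform f h + c * bform g h"
    using bform_sym[OF lc h] bform_sym[OF f h] bform_sym[OF g h] by simp
qed (auto intro: U.zero_in U.lincomb_in)

text \<open>The upper half of the equivalence between \<open>bform\<close> and \<open>ip\<close>;
  uniform positivity of \<N> is the lower half.\<close>

lemma bform_bounded: "\<exists>K. \<forall>u\<in>U. bform u u \<le> K * ip u u"
proof -
  obtain K where K: "\<And>\<eta> u. u \<in> U \<Longrightarrow> (LINT w|P. (norm (X \<eta> u T w))\<^sup>2) \<le> K * ((norm \<eta>)\<^sup>2 + ip u u)"
    "\<And>\<eta> u. u \<in> U \<Longrightarrow> ip (X \<eta> u) (X \<eta> u) \<le> K * ((norm \<eta>)\<^sup>2 + ip u u)"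
    using mild_estimate X T_in by blast
  obtain k where k: "AE z in time_prob P T. norm (R (fst z) (snd z)) \<le> k"
    using R(1) unfolding LinfF_def by (auto simp: case_prod_unfold)
  obtain l where l: "AE z in time_prob P T. norm (M (fst z) (snd z)) \<le> l"
    using M(1) unfolding LinfF_def by (auto simp: case_prod_unfold)
  obtain m where m: "AE w in P. norm (G w) \<le> m"
    using G(1) unfolding Linf_rv_def by auto
  have "bform u u \<le> (\<bar>k\<bar> + \<bar>l\<bar> * K + \<bar>m\<bar> * K) * ip u u" if u: "u \<in> U" for u
  proof -
    have "ip (\<lambda>s w. blinfun_apply (R s w) (u s w)) u \<le> \<bar>k\<bar> * ip u u"
      using integral_blinfun_inner_le[OF R_strongly_measurable k sq_integrable_process[OF u]]
      unfolding ip_proc_self unfolding ip_proc_def by (simp add: case_prod_unfold)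
    moreover have "ip (\<lambda>s w. blinfun_apply (M s w) (Xi X u s w)) (Xi X u) \<le> \<bar>l\<bar> * ip (Xi X u) (Xi X u)"
      using integral_blinfun_inner_le[OF M_strongly_measurable l sq_integrable_process[OF Xi_in[OF u]]]
      unfolding ip_proc_self unfolding ip_proc_def by (simp add: case_prod_unfold)
    moreover have "\<bar>l\<bar> * ip (Xi X u) (Xi X u) \<le> \<bar>l\<bar> * (K * ip u u)"
      using K(2)[OF u, of 0] unfolding Xi_def by (intro mult_left_mono) auto
    moreover have "ip_rv P (\<lambda>w. blinfun_apply (G w) (Xi_hat T X u w)) (Xi_hat T X u) \<le>
        \<bar>m\<bar> * (LINT w|P. (norm (Xi_hat T X u w))\<^sup>2)"
      unfolding ip_rv_def by (rule integral_blinfun_inner_le[OF G_strongly_measurable m Xi_hat_sq[OF u]])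
    moreover have "\<bar>m\<bar> * (LINT w|P. (norm (Xi_hat T X u w))\<^sup>2) \<le> \<bar>m\<bar> * (K * ip u u)"
      using K(1)[OF u, of 0] unfolding Xi_hat_def by (intro mult_left_mono) auto
    ultimately show ?thesis unfolding bform_def by (simp add: algebra_simps)
  qed
  then show ?thesis by blast
qed

text \<open>The state is the sum of its parts \<Xi>u and \<Gamma>\<eta>, almost everywhere and at
  time T. Expanding both weighted squares gives the form, twice the linear term and the constant;
  Fubini identifies the iterated time integral with the one over the product space.\<close>

lemma cost_eq:
  assumes u: "u \<in> U"
  shows "cost P T M R G X \<eta> u = 1 / 2 * (bform u u + 2 * ip (H \<eta>) u + quad_M P T M G X \<eta>)"
proof -
  interpret t: pair_sigma_finite "restrict_space lborel {0..T}" P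
    by (rule pair_sigma_finite_time) (rule prob_space_axioms)
  let ?f = "\<lambda>t w. blinfun_apply (M t w) (X \<eta> u t w) \<bullet> X \<eta> u t w + blinfun_apply (R t w) (u t w) \<bullet> u t w"
  let ?g = "\<lambda>w. blinfun_apply (G w) (X \<eta> u T w) \<bullet> X \<eta> u T w"
  have iM: "integrable (time_prob P T) (\<lambda>z. blinfun_apply (M (fst z) (snd z)) (X \<eta> u (fst z) (snd z)) \<bullet> X \<eta> u (fst z) (snd z))"
    by (intro sq_integrable_inner sq_integrable_process[OF M_in[OF X_in[OF u]]] sq_integrable_process[OF X_in[OF u]])
  have iR: "integrable (time_prob P T) (\<lambda>z. blinfun_apply (R (fst z) (snd z)) (u (fst z) (snd z)) \<bullet> u (fst z) (snd z))"
    by (intro sq_integrable_inner sq_integrable_process[OF R_in[OF u]] sq_integrable_process[OF u])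
  have if': "integrable (restrict_space lborel {0..T} \<Otimes>\<^sub>M P) (\<lambda>(t, w). ?f t w)"
    using iM iR unfolding time_prob_def[symmetric] by (simp add: case_prod_unfold)
  have ig: "integrable P ?g"
    by (intro sq_integrable_inner G_sq_integrable X_T_sq_integrable u)
  have lt: "(LINT t:{0..T}|lborel. ?f t w) = (LINT t|restrict_space lborel {0..T}. ?f t w)" for w
    by (simp add: set_lebesgue_integral_def integral_restrict_space)
  have "cost P T M R G X \<eta> u = 1 / 2 * ((LINT w|P. LINT t|restrict_space lborel {0..T}. ?f t w) + (LINT w|P. ?g w))"
    unfolding cost_def lt using t.integrable_snd[OF if'] ig by simp
  also have "(LINT w|P. LINT t|restrict_space lborel {0..T}. ?f t w) = (LINT z|time_prob P T. ?f (fst z) (snd z))"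
    using t.integral_snd[OF if'] unfolding time_prob_def by (simp add: case_prod_unfold)
  also have "\<dots> = ip (\<lambda>t w. blinfun_apply (M t w) (X \<eta> u t w)) (X \<eta> u) + ip (\<lambda>t w. blinfun_apply (R t w) (u t w)) u"
    using iM iR unfolding ip_proc_def by (simp add: case_prod_unfold)
  also have "ip (\<lambda>t w. blinfun_apply (M t w) (X \<eta> u t w)) (X \<eta> u) =
      ip (\<lambda>s w. blinfun_apply (M s w) (Xi X u s w)) (Xi X u) +
      2 * ip (\<lambda>s w. blinfun_apply (M s w) (Gam X \<eta> s w)) (Xi X u) +
      ip (\<lambda>s w. blinfun_apply (M s w) (Gam X \<eta> s w)) (Gam X \<eta>)"
  proof -
    obtain l where l: "AE z in time_prob P T. norm (M (fst z) (snd z)) \<le> l"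
      using M(1) unfolding LinfF_def by (auto simp: case_prod_unfold)
    have s: "AE z in time_prob P T. selfadjoint (M (fst z) (snd z))" using M(2) by (simp add: case_prod_unfold)
    \<comment> \<open>The pair (\<eta>, u) is the superposition of (0, u) and (\<eta>, 0).\<close>
    have eq: "AE z in time_prob P T. X \<eta> u (fst z) (snd z) = Xi X u (fst z) (snd z) + Gam X \<eta> (fst z) (snd z)"
      using X_lincomb(1)[OF u L2F_zero, of 1 0 1 \<eta>] unfolding Xi_def Gam_def by (simp add: case_prod_unfold)
    have sm: "strongly_measurable (time_prob P T) (\<lambda>z. X \<eta> u (fst z) (snd z))"
      using sq_integrable_process[OF X_in[OF u]] unfolding sq_integrable_def by blast
    show ?thesis
      using integral_selfadjoint_square_add[OF s M_strongly_measurable l sq_integrable_process[OF Xi_in[OF u]]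
          sq_integrable_process[OF Gam_in] sm eq]
      unfolding ip_proc_def by (simp add: case_prod_unfold)
  qed
  also have "(LINT w|P. ?g w) = ip_rv P (\<lambda>w. blinfun_apply (G w) (Xi_hat T X u w)) (Xi_hat T X u) +
      2 * ip_rv P (\<lambda>w. blinfun_apply (G w) (Gam_hat T X \<eta> w)) (Xi_hat T X u) +
      ip_rv P (\<lambda>w. blinfun_apply (G w) (Gam_hat T X \<eta> w)) (Gam_hat T X \<eta>)"
  proof -
    obtain m where m: "AE w in P. norm (G w) \<le> m"
      using G(1) unfolding Linf_rv_def by auto
    have eq: "AE w in P. X \<eta> u T w = Xi_hat T X u w + Gam_hat T X \<eta> w"
      using X_lincomb(2)[OF u L2F_zero, of 1 0 1 \<eta>] unfolding Xi_hat_def Gam_hat_def by simp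
    have sm: "strongly_measurable P (X \<eta> u T)"
      using X_T_sq_integrable[OF u] unfolding sq_integrable_def by blast
    show ?thesis
      unfolding ip_rv_def
      by (rule integral_selfadjoint_square_add[OF G(2) G_strongly_measurable m Xi_hat_sq[OF u] Gam_hat_sq sm eq])
  qed
  finally show ?thesis
    unfolding bform_def H_eq[OF u] quad_M_def by (simp add: algebra_simps)
qed

lemma quadratic_cost_slq: "quadratic_cost U ip bform N (H \<eta>) (cost P T M R G X \<eta>) (quad_M P T M G X \<eta>)"
proof (intro quadratic_cost.intro quadratic_cost_axioms.intro)
  show "complete_form U ip" by (rule U.complete_form_axioms)
  show "form_on U bform" by (rule form_on_bform)
qed (fact N_in N_eq H_in cost_eq)+

lemma pos_semidef_N_iff: "pos_semidef U ip N \<longleftrightarrow> (\<forall>v\<in>U. 0 \<le> bform v v)"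
  unfolding pos_semidef_def by (simp add: N_eq)

lemma stationary_iff_eq_proc:
  assumes u: "u \<in> U"
  shows "(\<forall>v\<in>U. bform u v + ip (H \<eta>) v = 0) \<longleftrightarrow> eq_proc P T (\<lambda>t w. N u t w + H \<eta> t w) (\<lambda>t w. 0)"
  unfolding quadratic_cost.stationary_iff[OF quadratic_cost_slq u]
  by (rule ip_proc_eq_0_iff[OF sum_in[OF N_in[OF u] H_in]])

text \<open>Solvability and the optimality of every solution of the linear equation are both read
  off from this characterisation of a single minimiser.\<close>

lemma optimal_slq_iff:
  "optimal U (cost P T M R G X \<eta>) u \<longleftrightarrow>
     u \<in> U \<and> pos_semidef U ip N \<and> eq_proc P T (\<lambda>t w. N u t w + H \<eta> t w) (\<lambda>t w. 0)"
  unfolding optimal_iff pos_semidef_N_iff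
  using quadratic_cost.minimizer_iff[OF quadratic_cost_slq] stationary_iff_eq_proc by blast

lemma finite_slq_imp_pos_semidef:
  assumes "finite_problem U (cost P T M R G X \<eta>)"
  shows "pos_semidef U ip N"
  using finite_problem_bounded_below[OF assms] quadratic_cost.form_nonneg_if_bounded_below[OF quadratic_cost_slq]
  unfolding pos_semidef_N_iff by blast

text \<open>Riesz for \<open>bform\<close> solves \<N>u = \<H>(\<eta>) weakly. Testing with the
  residual itself makes it an equation almost everywhere, so the choice in \<open>op_inverse\<close>
  is made from a nonempty set.\<close>

lemma op_inverse_N:
  assumes "unif_pos U ip N"
  shows "op_inverse U (eq_proc P T) N (H \<eta>) \<in> U"
    "eq_proc P T (N (op_inverse U (eq_proc P T) N (H \<eta>))) (H \<eta>)"
proof -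
  obtain \<delta> where \<delta>: "\<delta> > 0" "\<And>u. u \<in> U \<Longrightarrow> \<delta> * ip u u \<le> bform u u"
    using assms N_eq unfolding unif_pos_def by auto
  obtain K where K: "\<And>u. u \<in> U \<Longrightarrow> bform u u \<le> K * ip u u" using bform_bounded by blast
  obtain u where u: "u \<in> U" "\<And>v. v \<in> U \<Longrightarrow> bform u v = ip (H \<eta>) v"
    using quadratic_cost.stationary_exists[OF quadratic_cost_slq \<delta>(2,1) K] by blast
  let ?d = "\<lambda>s w. N u s w - H \<eta> s w"
  have d: "?d \<in> U" by (rule U.diff_in[OF N_in[OF u(1)] H_in])
  have "ip ?d ?d = 0" using U.diff_left[OF N_in[OF u(1)] H_in d] N_eq[OF u(1) d] u(2)[OF d] by simp
  then have "eq_proc P T (N u) (H \<eta>)" using ip_proc_eq_0_iff[OF d] unfolding eq_proc_def by (simp add: case_prod_unfold)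
  then have "\<exists>u. u \<in> U \<and> eq_proc P T (N u) (H \<eta>)" using u by blast
  from someI_ex[OF this] show "op_inverse U (eq_proc P T) N (H \<eta>) \<in> U"
    "eq_proc P T (N (op_inverse U (eq_proc P T) N (H \<eta>))) (H \<eta>)"
    unfolding op_inverse_def by auto
qed

text \<open>The difference of two stationary controls has vanishing \<open>bform\<close>, hence
  vanishing norm, which gives uniqueness. At the minimiser the form equals minus the linear term, so
  one of the two copies of \<langle>\<H>(\<eta>), u\<rangle> cancels and the other gives the stated
  value.\<close>

lemma unif_pos_minimizer:
  fixes \<eta> :: 'h
  assumes up: "unif_pos U ip N"
  defines "ub \<equiv> \<lambda>t w. - op_inverse U (eq_proc P T) N (H \<eta>) t w"
  shows "optimal U (cost P T M R G X \<eta>) ub"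
    "optimal U (cost P T M R G X \<eta>) v \<Longrightarrow> eq_proc P T v ub"
    "cost P T M R G X \<eta> ub = 1 / 2 * (quad_M P T M G X \<eta> - ip (op_inverse U (eq_proc P T) N (H \<eta>)) (H \<eta>))"
proof -
  interpret b: form_on U bform by (rule form_on_bform)
  obtain \<delta> where \<delta>: "\<delta> > 0" "\<And>u. u \<in> U \<Longrightarrow> \<delta> * ip u u \<le> bform u u"
    using up N_eq unfolding unif_pos_def by auto
  have "0 \<le> bform u u" if "u \<in> U" for u
    using \<delta>(2)[OF that] mult_nonneg_nonneg[OF less_imp_le[OF \<delta>(1)] U.nonneg[OF that]] by linarith
  then have psd: "pos_semidef U ip N" unfolding pos_semidef_N_iff by blast
  define h where "h = op_inverse U (eq_proc P T) N (H \<eta>)"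
  have h: "h \<in> U" and Nh: "eq_proc P T (N h) (H \<eta>)" unfolding h_def using op_inverse_N[OF up] by auto
  \<comment> \<open>Adding a term with coefficient 0 writes the negative as a linear combination, to
    which the rules for forms apply.\<close>
  have ub_eq: "ub = (\<lambda>s w. (- 1) *\<^sub>R h s w + 0 *\<^sub>R h s w)" unfolding ub_def h_def by simp
  have ub: "ub \<in> U" unfolding ub_eq by (rule U.lincomb_in[OF h h])
  have stat: "bform ub v + ip (H \<eta>) v = 0" if v: "v \<in> U" for v
  proof -
    have "bform ub v = - bform h v" unfolding ub_eq using b.lincomb_left[OF h h v, of "- 1" 0] by simp
    moreover have "bform h v = ip (H \<eta>) v"
      unfolding N_eq[OF h v, symmetric] using Nh unfolding eq_proc_def by (intro ip_proc_cong N_in h H_in v)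
    ultimately show ?thesis by simp
  qed
  show opt: "optimal U (cost P T M R G X \<eta>) ub"
    unfolding optimal_slq_iff using ub psd stat stationary_iff_eq_proc[OF ub] by blast
  show "eq_proc P T v ub" if "optimal U (cost P T M R G X \<eta>) v"
  proof -
    have v: "v \<in> U" and "\<And>x. x \<in> U \<Longrightarrow> bform v x + ip (H \<eta>) x = 0"
      using that stationary_iff_eq_proc[of v \<eta>] unfolding optimal_slq_iff by auto
    then have eq: "bform v x = bform ub x" if "x \<in> U" for x using stat[OF that] that by fastforce
    let ?d = "\<lambda>s w. v s w - ub s w"
    have d: "?d \<in> U" by (rule U.diff_in[OF v ub])
    have "bform ?d ?d = 0" using b.diff_left[OF v ub d] eq[OF d] by simp
    then have "\<delta> * ip ?d ?d \<le> 0" using \<delta>(2)[OF d] by simp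
    then have "ip ?d ?d \<le> 0" using \<delta>(1) by (simp add: mult_le_0_iff)
    then have "ip ?d ?d = 0" using U.nonneg[OF d] by simp
    then show ?thesis using ip_proc_eq_0_iff[OF d] unfolding eq_proc_def by (simp add: case_prod_unfold)
  qed
  have "ip (H \<eta>) ub = - ip (H \<eta>) h" unfolding ub_eq using U.lincomb_right[OF h h H_in[of \<eta>], of "- 1" 0] by simp
  then show "cost P T M R G X \<eta> ub = 1 / 2 * (quad_M P T M G X \<eta> - ip (op_inverse U (eq_proc P T) N (H \<eta>)) (H \<eta>))"
    unfolding h_def[symmetric] cost_eq[OF ub] using stat[OF ub] ip_commute[of h "H \<eta>"] by simp
qed

end
theorem theorem7p1:
  fixes P :: "'w measure" and F :: "real \<Rightarrow> 'w measure" and T :: real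
    and W :: "real \<Rightarrow> 'w \<Rightarrow> real"
    and S :: "real \<Rightarrow> 'h::{real_inner, banach, second_countable_topology} \<Rightarrow>\<^sub>L 'h"
    and domA :: "'h set" and A :: "'h \<Rightarrow> 'h"
    and A1 C M :: "real \<Rightarrow> 'w \<Rightarrow> 'h \<Rightarrow>\<^sub>L 'h"
    and B D :: "real \<Rightarrow> 'w \<Rightarrow> 'u::{real_inner, banach} \<Rightarrow>\<^sub>L 'h"
    and R :: "real \<Rightarrow> 'w \<Rightarrow> 'u \<Rightarrow>\<^sub>L 'u"
    and G :: "'w \<Rightarrow> 'h \<Rightarrow>\<^sub>L 'h"
    and X :: "'h \<Rightarrow> (real \<Rightarrow> 'w \<Rightarrow> 'u) \<Rightarrow> real \<Rightarrow> 'w \<Rightarrow> 'h"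
  assumes "T > 0"
    and "prob_space P" and "complete_measure P" and "usual_filtration P F T"
    and "brownian_motion P F T W"
    and "C0_semigroup S" and "is_generator S domA A"
    and "A1 \<in> LinfF P F T" and "C \<in> LinfF P F T"
    and "B \<in> LinfF P F T" and "D \<in> LinfF P F T"
    and "M \<in> LinfF P F T" and "AE (t, w) in time_prob P T. selfadjoint (M t w)"
    and "R \<in> LinfF P F T" and "AE (t, w) in time_prob P T. selfadjoint (R t w)"
    and "G \<in> Linf_rv P (F T)" and "AE w in P. selfadjoint (G w)"
    and "\<And>\<eta> u. u \<in> L2F P F T \<Longrightarrow> mild_solution P F T W S A1 B C D \<eta> u (X \<eta> u)"
  shows "let U = L2F P F T :: (real \<Rightarrow> 'w \<Rightarrow> 'u) set;
             ip = ip_proc P T;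
             J = cost P T M R G X;
             N = op_N P F T M R G X;
             H = vec_H P F T M G X;
             Ninv = op_inverse U (eq_proc P T) N
         in
           ((\<exists>\<eta>. finite_problem U (J \<eta>)) \<longrightarrow> pos_semidef U ip N) \<and>
           (\<forall>\<eta>.
              (solvable_problem U (J \<eta>) \<longleftrightarrow>
                 pos_semidef U ip N \<and>
                 (\<exists>ub\<in>U. eq_proc P T (\<lambda>t w. N ub t w + H \<eta> t w) (\<lambda>t w. 0))) \<and>
              (pos_semidef U ip N \<longrightarrow>
                 (\<forall>ub\<in>U. eq_proc P T (\<lambda>t w. N ub t w + H \<eta> t w) (\<lambda>t w. 0) \<longrightarrow>
                    optimal U (J \<eta>) ub))) \<and>
           (unif_pos U ip N \<longrightarrow>
              (\<forall>\<eta>. let ub = (\<lambda>t w. - Ninv (H \<eta>) t w) in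
                 optimal U (J \<eta>) ub \<and>
                 (\<forall>v. optimal U (J \<eta>) v \<longrightarrow> eq_proc P T v ub) \<and>
                 cost_inf U (J \<eta>) = ereal (J \<eta> ub) \<and>
                 J \<eta> ub = 1 / 2 * (quad_M P T M G X \<eta> - ip (Ninv (H \<eta>)) (H \<eta>))))"
proof -
  interpret slq_problem P F T W S A1 C B D M R G X
    using assms
    by (intro slq_problem.intro slq_problem_axioms.intro state_equation.intro state_equation_axioms.intro
        brownian_filtration.intro brownian_filtration_axioms.intro)
  have solvable: "solvable_problem U (cost P T M R G X \<eta>) \<longleftrightarrow> pos_semidef U ip N \<and>
      (\<exists>ub\<in>U. eq_proc P T (\<lambda>t w. N ub t w + H \<eta> t w) (\<lambda>t w. 0))" for \<eta>
    unfolding solvable_problem_def optimal_slq_iff by blast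
  have optimal_inf: "cost_inf U (cost P T M R G X \<eta>) = ereal (cost P T M R G X \<eta> v)"
    if "optimal U (cost P T M R G X \<eta>) v" for \<eta> v
    using that unfolding optimal_def by simp
  show ?thesis
    unfolding Let_def
  proof (intro conjI allI impI)
    show "pos_semidef U ip N" if "\<exists>\<eta>. finite_problem U (cost P T M R G X \<eta>)"
      using that finite_slq_imp_pos_semidef by blast
  next
    fix \<eta>
    show "solvable_problem U (cost P T M R G X \<eta>) \<longleftrightarrow> pos_semidef U ip N \<and>
      (\<exists>ub\<in>U. eq_proc P T (\<lambda>t w. N ub t w + H \<eta> t w) (\<lambda>t w. 0))" by (rule solvable)
  next
    fix \<eta> assume "pos_semidef U ip N"
    then show "\<forall>ub\<in>U. eq_proc P T (\<lambda>t w. N ub t w + H \<eta> t w) (\<lambda>t w. 0) \<longrightarrow> optimal U (cost P T M R G X \<eta>) ub"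
      unfolding optimal_slq_iff by blast
  qed (fact unif_pos_minimizer optimal_inf[OF unif_pos_minimizer(1)])+
qed

end
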